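(* There are an absolute constant $C>0$ and, for every integer $k\geq 1$, a polynomial $t_k(n)$ in $n$ of degree at most $Ck$ (that is, of degree $O(k)$) such that the following holds. Let $n\geq 1$, let $0\leq \ell\leq m\leq k$ be integers, let $Q_1,\ldots,Q_k$ be quadratic polynomials in $n$ variables with real coefficients, and let $$X=\{x\in \mathbb{R}^n \mid Q_1(x)=\ldots=Q_\ell(x)=0,\ Q_{\ell+1}(x)\geq 0,\ldots,Q_m(x)\geq 0,\ Q_{m+1}(x)>0,\ldots,Q_k(x)>0\}.$$ Let $M=X\cap \overline{B}^n$. Then the sum of the geodesic diameters of the connected components of $M$ is bounded from above by $t_k(n)$.
   Context: $\overline{B}^n$ denotes the closed Euclidean unit ball of $\mathbb{R}^n$ centred at the origin. "Quadratic polynomial" means polynomial of degree at most $2$. For a connected component $M_i$ of a semialgebraic set $M\subset\mathbb{R}^n$, the geodesic distance between $x,y\in M_i$ is the infimum of the (Euclidean) lengths of paths joining $x$ to $y$ inside $M_i$; the geodesic diameter of $M_i$ is the supremum of the geodesic distances between two points of $M_i$. *)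

theory Defs
  imports "HOL-Analysis.Analysis" "HOL-Library.Poly_Mapping" "HOL-Computational_Algebra.Polynomial"
begin

text \<open>
  Since the dimension is quantified inside the statement, it cannot be a type: \<open>\<real>\<^sup>n\<close> is the
  library's \<^const>\<open>Euclidean_space\<close> \<open>n\<close>, whose points are the functions \<open>nat \<Rightarrow> real\<close> vanishing
  outside \<open>{..<n}\<close>. The \<^class>\<open>metric_space\<close> instance of \<open>nat \<Rightarrow> real\<close> is not the Euclidean metric,
  so Euclidean norms and distances are expressed through \<^const>\<open>L2_set\<close>.
\<close>

definition unit_cball :: "nat \<Rightarrow> (nat \<Rightarrow> real) set" where
  "unit_cball n = {x \<in> topspace (Euclidean_space n). L2_set x {..<n} \<le> 1}"

text \<open>
  A polynomial with variables indexed by \<open>nat\<close> is a finitely supported map from exponent vectors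
  (themselves finitely supported) to coefficients.
\<close>

type_synonym rpoly = "(nat \<Rightarrow>\<^sub>0 nat) \<Rightarrow>\<^sub>0 real"

definition rpoly_eval :: "rpoly \<Rightarrow> (nat \<Rightarrow> real) \<Rightarrow> real" where
  "rpoly_eval q x = (\<Sum>e\<in>Poly_Mapping.keys q. Poly_Mapping.lookup q e *
     (\<Prod>i\<in>Poly_Mapping.keys e. x i ^ Poly_Mapping.lookup e i))"

definition quadratic_rpoly :: "nat \<Rightarrow> rpoly \<Rightarrow> bool" where
  "quadratic_rpoly n q \<longleftrightarrow> (\<forall>e\<in>Poly_Mapping.keys q. Poly_Mapping.keys e \<subseteq> {..<n} \<and>
     (\<Sum>i\<in>Poly_Mapping.keys e. Poly_Mapping.lookup e i) \<le> 2)"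

definition sign_set :: "nat \<Rightarrow> nat \<Rightarrow> nat \<Rightarrow> nat \<Rightarrow> (nat \<Rightarrow> rpoly) \<Rightarrow> (nat \<Rightarrow> real) set" where
  "sign_set n l m k Q = {x \<in> topspace (Euclidean_space n).
     (\<forall>i\<in>{1..l}. rpoly_eval (Q i) x = 0) \<and>
     (\<forall>i\<in>{l+1..m}. rpoly_eval (Q i) x \<ge> 0) \<and>
     (\<forall>i\<in>{m+1..k}. rpoly_eval (Q i) x > 0)}"

text \<open>
  The length of a path parametrised by \<open>[0, 1]\<close> is the supremum of the lengths of its inscribed
  polygons; it is \<open>\<infinity>\<close> for a non-rectifiable path.
\<close>

definition path_length :: "nat \<Rightarrow> (real \<Rightarrow> nat \<Rightarrow> real) \<Rightarrow> ennreal" where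
  "path_length n g = (SUP ts\<in>{ts. sorted ts \<and> set ts \<subseteq> {0..1}}.
     \<Sum>j<length ts - 1. ennreal (L2_set (\<lambda>i. g (ts ! Suc j) i - g (ts ! j) i) {..<n}))"

definition geodesic_dist :: "nat \<Rightarrow> (nat \<Rightarrow> real) set \<Rightarrow> (nat \<Rightarrow> real) \<Rightarrow> (nat \<Rightarrow> real) \<Rightarrow> ennreal" where
  "geodesic_dist n S x y =
     (INF g\<in>{g. pathin (subtopology (Euclidean_space n) S) g \<and> g 0 = x \<and> g 1 = y}. path_length n g)"

definition geodesic_diameter :: "nat \<Rightarrow> (nat \<Rightarrow> real) set \<Rightarrow> ennreal" where
  "geodesic_diameter n S = (SUP x\<in>S. SUP y\<in>S. geodesic_dist n S x y)"

text \<open>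
  The sum is taken in the extended non-negative reals, so that an infinite geodesic diameter or
  infinitely many components cannot make it degenerate to a default value.
\<close>

definition sum_geodesic_diameters :: "nat \<Rightarrow> (nat \<Rightarrow> real) set \<Rightarrow> ennreal" where
  "sum_geodesic_diameters n M =
     (\<Sum>\<^sub>\<infinity>S\<in>connected_components_of (subtopology (Euclidean_space n) M). geodesic_diameter n S)"

end

theory Submission
  imports Defs "Jordan_Normal_Form.Determinant"
begin

text \<open>
  After adding slack variables and replacing strict inequalities \<open>q > 0\<close> by \<open>q \<ge> \<delta>\<close>, only a set
  \<open>Z = {h\<^sub>0 = \<dots> = h\<^bsub>d-1\<^esub> = 0}\<close> of quadratic equations in a box of \<open>\<real>\<^sup>m\<close> has to be treated, and it
  suffices to find a set \<open>P\<close> of at most \<open>N\<close> points such that every point of \<open>Z\<close> is joined to \<open>P\<close> by a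
  path in \<open>Z\<close> of length at most \<open>L\<close>, with \<open>N\<close> and \<open>L\<close> of order \<open>m\<close> to the power \<open>O(d)\<close>: then \<open>Z\<close> has
  at most \<open>N\<close> components, and chains of overlapping geodesic balls around \<open>P\<close> bound their diameters
  by \<open>O(L N\<^sup>2)\<close>. By compactness \<open>Z\<close> may be replaced by its small neighbourhoods.

  In a neighbourhood, a generic penalty function
  \<open>F x = \<theta>/2 |x - a|\<^sup>2 + \<Sum> (h\<^sub>l x - \<tau>\<^sub>l)\<^sup>2 / (2 \<epsilon>)\<close> is decreased to one of its critical points. The
  length of the descent is bounded as in Kurdyka's work on gradient trajectories: it is charged to
  the variation along the polar curve, where the gradient of \<open>F\<close> is shortest on its level set.
  Both the number of critical points and the number of points where the polar curve takes a given
  coordinate are counted with multipliers \<open>\<lambda>\<^sub>l = (h\<^sub>l - \<tau>\<^sub>l) / \<epsilon>\<close> as additional unknowns. Then there are as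
  many equations linear in \<open>x\<close> as coordinates of \<open>x\<close>, and elimination by counting dimensions gives
  a bound with the number \<open>O(d)\<close> of the remaining equations in the exponent, not \<open>m\<close>.
\<close>

section \<open>Polynomial functions\<close>

text \<open>Bezout's theorem would allow 2^m solutions of a quadratic system in m unknowns,
  exponential in the dimension. The count in \<open>algebraic_dependence\<close> is asymmetric
  instead. Besides M unknowns z, met by M functions of degree 1 in z, there are e others. Products
  of powers of these M functions with total exponent at most p are as numerous as the monomials of
  degree at most p in z; the other functions raise that degree only to p + r, and for p = r M this
  multiplies the number of monomials by at most 3. Only the e remaining exponents are left to be
  beaten, hence a bound with exponent e.

  This shapes the rest. To make the equations of the polar curve linear in \<open>x\<close> and the
  gradient, the gradient becomes a vector of unknowns and further multipliers are added. To apply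
  the count at a generic target point, every equation needs a parameter as its right-hand side,
  whence \<open>a\<close>, \<open>\<tau>\<close>, the perturbation \<open>\<sigma>\<close> of the
  slope and the linear form \<open>w\<close>. Generic always means off the zero set of a nonzero
  polynomial.\<close>

inductive polyfun :: "nat \<Rightarrow> ((nat \<Rightarrow> real) \<Rightarrow> real) \<Rightarrow> bool" for n where
  polyfun_const: "polyfun n (\<lambda>_. c)"
| polyfun_var: "i < n \<Longrightarrow> polyfun n (\<lambda>x. x i)"
| polyfun_add: "polyfun n f \<Longrightarrow> polyfun n g \<Longrightarrow> polyfun n (\<lambda>x. f x + g x)"
| polyfun_mult: "polyfun n f \<Longrightarrow> polyfun n g \<Longrightarrow> polyfun n (\<lambda>x. f x * g x)"

lemma polyfun_uminus: "polyfun n f \<Longrightarrow> polyfun n (\<lambda>x. - f x)"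
  using polyfun_mult[OF polyfun_const[of n "-1"]] by fastforce

lemma polyfun_diff: "polyfun n f \<Longrightarrow> polyfun n g \<Longrightarrow> polyfun n (\<lambda>x. f x - g x)"
  using polyfun_add[OF _ polyfun_uminus[of n g]] by fastforce

lemma polyfun_power: "polyfun n f \<Longrightarrow> polyfun n (\<lambda>x. f x ^ k)"
  by (induction k) (auto intro: polyfun_const polyfun_mult)

lemma polyfun_divide: "polyfun n f \<Longrightarrow> polyfun n (\<lambda>x. f x / c)"
  unfolding divide_inverse by (intro polyfun_mult polyfun_const)

lemma polyfun_sum: "(\<And>i. i \<in> I \<Longrightarrow> polyfun n (f i)) \<Longrightarrow> polyfun n (\<lambda>x. \<Sum>i\<in>I. f i x)"
  by (induction I rule: infinite_finite_induct) (auto intro: polyfun_const polyfun_add)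

lemma polyfun_prod: "(\<And>i. i \<in> I \<Longrightarrow> polyfun n (f i)) \<Longrightarrow> polyfun n (\<lambda>x. \<Prod>i\<in>I. f i x)"
  by (induction I rule: infinite_finite_induct) (auto intro: polyfun_const polyfun_mult)

lemmas polyfun_intros = polyfun_const polyfun_var polyfun_add polyfun_mult polyfun_uminus
  polyfun_diff polyfun_power polyfun_divide polyfun_sum polyfun_prod

lemma polyfun_cong: "polyfun n f \<Longrightarrow> (\<And>i. i < n \<Longrightarrow> x i = y i) \<Longrightarrow> f x = f y"
  by (induction rule: polyfun.induct) auto

lemma polyfun_mono: "polyfun n f \<Longrightarrow> n \<le> m \<Longrightarrow> polyfun m f"
  by (induction rule: polyfun.induct) (auto intro: polyfun_intros)

lemma polyfun_compose:
  assumes "polyfun m f" "\<And>i. i < m \<Longrightarrow> polyfun n (g i)"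
  shows "polyfun n (\<lambda>x. f (\<lambda>i. g i x))"
  using assms by (induction rule: polyfun.induct) (auto intro: polyfun_intros)

lemma continuous_on_polyfun: "polyfun n f \<Longrightarrow> continuous_on S f"
proof (induction rule: polyfun.induct)
  case (polyfun_var i)
  then show ?case
    by (metis continuous_on_product_coordinates continuous_on_subset top_greatest)
qed (auto intro: continuous_intros)

lemma polyfun_line_poly:
  assumes "polyfun n f"
  shows "\<exists>p::real poly. \<forall>t. f (\<lambda>i. y i + t * u i) = poly p t"
  using assms
proof (induction rule: polyfun.induct)
  case (polyfun_const c)
  then show ?case by (auto intro: exI[of _ "[:c:]"])
next
  case (polyfun_var i)
  then show ?case by (auto intro: exI[of _ "[:y i, u i:]"])
next
  case (polyfun_add f g)
  then obtain p q where "\<forall>t. f (\<lambda>i. y i + t * u i) = poly p t" "\<forall>t. g (\<lambda>i. y i + t * u i) = poly q t"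
    by blast
  then show ?case by (auto intro: exI[of _ "p + q"])
next
  case (polyfun_mult f g)
  then obtain p q where "\<forall>t. f (\<lambda>i. y i + t * u i) = poly p t" "\<forall>t. g (\<lambda>i. y i + t * u i) = poly q t"
    by blast
  then show ?case by (auto intro: exI[of _ "p * q"])
qed

lemma polyfun_nonzero_line:
  assumes "polyfun n f" "f x \<noteq> 0"
  shows "finite {t. f (\<lambda>i. y i + t * (x i - y i)) = 0}"
proof -
  obtain p :: "real poly" where p: "\<And>t. f (\<lambda>i. y i + t * (x i - y i)) = poly p t"
    using polyfun_line_poly[OF assms(1)] by meson
  have "poly p 1 \<noteq> 0"
    using p[of 1] assms(2) by simp
  then show ?thesis
    using poly_roots_finite[of p] p by force
qed

text \<open>Polynomial functions form an integral domain: on the line through the two witnesses each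
  factor has only finitely many zeros. Generic conditions can therefore be combined into
  one.\<close>

lemma polyfun_nonzero_mult:
  assumes "polyfun n f" "polyfun n g" "f x \<noteq> 0" "g y \<noteq> 0"
  shows "\<exists>z. f z * g z \<noteq> 0"
proof -
  have 1: "finite {t. f (\<lambda>i. y i + t * (x i - y i)) = 0}"
    using polyfun_nonzero_line assms by blast
  have "finite {t. g (\<lambda>i. x i + t * (y i - x i)) = 0}"
    using polyfun_nonzero_line assms by blast
  \<comment> \<open>Both restrictions are to the same line, run through in opposite directions by t
    and 1 - t.\<close>
  then have "finite ((\<lambda>t. 1 - t) -` {t. g (\<lambda>i. x i + t * (y i - x i)) = 0})"
    by (rule finite_vimageI) (auto simp: inj_def)
  moreover have "x i + (1 - t) * (y i - x i) = y i + t * (x i - y i)" for t i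
    by (simp add: algebra_simps)
  ultimately have 2: "finite {t. g (\<lambda>i. y i + t * (x i - y i)) = 0}"
    by (simp add: vimage_def)
  obtain t where "t \<notin> {t. f (\<lambda>i. y i + t * (x i - y i)) = 0} \<union> {t. g (\<lambda>i. y i + t * (x i - y i)) = 0}"
    using ex_new_if_finite[OF infinite_UNIV_char_0 finite_UnI[OF 1 2]] by blast
  then show ?thesis by auto
qed

lemma polyfun_nonzero_prod:
  assumes "finite I" "\<And>i. i \<in> I \<Longrightarrow> polyfun n (f i)" "\<And>i. i \<in> I \<Longrightarrow> \<exists>x. f i x \<noteq> 0"
  shows "\<exists>x. (\<Prod>i\<in>I. f i x) \<noteq> 0"
  using assms
proof (induction I rule: finite_induct)
  case (insert i I)
  then have "\<exists>y. (\<Prod>i\<in>I. f i y) \<noteq> 0" by blast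
  then obtain x y where "f i x \<noteq> 0" "(\<Prod>i\<in>I. f i y) \<noteq> 0" using insert.prems(2) by blast
  then have "\<exists>z. f i z * (\<Prod>i\<in>I. f i z) \<noteq> 0"
    using insert by (intro polyfun_nonzero_mult) (auto intro: polyfun_prod)
  then show ?case using insert by simp
qed auto

text \<open>The ray from the origin to a point off the zero set meets that set only finitely often,
  so scaling the point down works. This is how generic parameters become arbitrarily small
  perturbations.\<close>

lemma polyfun_nonzero_small:
  assumes "polyfun n f" "f x \<noteq> 0" "\<epsilon> > 0"
  shows "\<exists>z. (\<forall>i. \<bar>z i\<bar> < \<epsilon>) \<and> (\<forall>i\<ge>n. z i = 0) \<and> f z \<noteq> 0"
proof -
  define x' where "x' = (\<lambda>i. if i < n then x i else 0)"
  have x': "f x' \<noteq> 0"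
    using polyfun_cong[OF assms(1), of x' x] assms(2) by (simp add: x'_def)
  have fin: "finite {t. f (\<lambda>i. 0 + t * (x' i - 0)) = 0}"
    using polyfun_nonzero_line[OF assms(1), where y="\<lambda>_. 0", of x'] x' by simp
  define B where "B = (\<Sum>i<n. \<bar>x i\<bar>) + 1"
  have B: "B > 0" "\<bar>x' i\<bar> \<le> B - 1" for i
    by (auto simp: B_def x'_def sum_nonneg intro!: add_nonneg_pos member_le_sum)
  have "infinite {0<..<\<epsilon>/B}"
    using assms(3) B(1) by (simp add: infinite_Ioo)
  then obtain t where t: "0 < t" "t < \<epsilon> / B" "f (\<lambda>i. t * x' i) \<noteq> 0"
  proof -
    have "infinite ({0<..<\<epsilon>/B} - {t. f (\<lambda>i. 0 + t * (x' i - 0)) = 0})"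
      using Diff_infinite_finite[OF fin \<open>infinite {0<..<\<epsilon>/B}\<close>] .
    then obtain t where "t \<in> {0<..<\<epsilon>/B} - {t. f (\<lambda>i. 0 + t * (x' i - 0)) = 0}"
      using infinite_imp_nonempty by blast
    then show ?thesis using that[of t] by simp
  qed
  have "\<bar>t * x' i\<bar> < \<epsilon>" for i
  proof -
    have "\<bar>t * x' i\<bar> \<le> t * B"
      using t B(2)[of i] by (simp add: abs_mult)
    also have "\<dots> < \<epsilon>"
      using t B(1) by (simp add: field_simps)
    finally show ?thesis .
  qed
  moreover have "\<forall>i\<ge>n. t * x' i = 0"
    by (simp add: x'_def)
  ultimately show ?thesis
    using t(3) by (intro exI[of _ "\<lambda>i. t * x' i"]) simp
qed

section \<open>Partial derivatives, mean values and Taylor estimates\<close>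

definition pd :: "nat \<Rightarrow> ((nat \<Rightarrow> real) \<Rightarrow> real) \<Rightarrow> (nat \<Rightarrow> real) \<Rightarrow> real" where
  "pd i f x = deriv (\<lambda>t. f (x(i := t))) (x i)"

lemma polyfun_has_pd:
  assumes "polyfun n f"
  shows "((\<lambda>t. f (x(i := t))) has_real_derivative pd i f x) (at (x i))"
proof -
  have "(\<lambda>t. f (x(i := t))) differentiable (at s)" for s
    using assms
  proof (induction rule: polyfun.induct)
    case (polyfun_var j)
    then show ?case by (cases "i = j") auto
  qed (auto intro!: derivative_intros)
  then show ?thesis
    unfolding pd_def using DERIV_deriv_iff_real_differentiable by blast
qed

lemma pd_eqI: "((\<lambda>t. f (x(i := t))) has_real_derivative d) (at (x i)) \<Longrightarrow> pd i f x = d"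
  unfolding pd_def by (rule DERIV_imp_deriv)

lemma pd_const: "pd i (\<lambda>_. c) x = 0"
  by (rule pd_eqI) auto

lemma pd_var: "pd i (\<lambda>x. x j) x = (if i = j then 1 else 0)"
  by (rule pd_eqI) auto

lemma pd_add: "polyfun n f \<Longrightarrow> polyfun n g \<Longrightarrow> pd i (\<lambda>x. f x + g x) x = pd i f x + pd i g x"
  by (rule pd_eqI) (auto intro!: derivative_eq_intros polyfun_has_pd)

lemma pd_mult: "polyfun n f \<Longrightarrow> polyfun n g \<Longrightarrow>
    pd i (\<lambda>x. f x * g x) x = pd i f x * g x + f x * pd i g x"
  by (rule pd_eqI) (auto intro!: derivative_eq_intros polyfun_has_pd)

lemma pd_cmult: "polyfun n f \<Longrightarrow> pd i (\<lambda>x. c * f x) x = c * pd i f x"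
  using pd_mult[OF polyfun_const] by (simp add: pd_const)

lemma pd_diff: "polyfun n f \<Longrightarrow> polyfun n g \<Longrightarrow> pd i (\<lambda>x. f x - g x) x = pd i f x - pd i g x"
  by (rule pd_eqI) (auto intro!: derivative_eq_intros polyfun_has_pd)

lemma pd_divide: "polyfun n f \<Longrightarrow> pd i (\<lambda>x. f x / c) x = pd i f x / c"
  unfolding divide_inverse by (subst mult.commute) (simp add: pd_cmult)

lemma pd_power2: "polyfun n f \<Longrightarrow> pd i (\<lambda>x. (f x)\<^sup>2) x = 2 * f x * pd i f x"
  unfolding power2_eq_square by (simp add: pd_mult)

lemma pd_sum: "(\<And>j. j \<in> J \<Longrightarrow> polyfun n (f j)) \<Longrightarrow>
    pd i (\<lambda>x. \<Sum>j\<in>J. f j x) x = (\<Sum>j\<in>J. pd i (f j) x)"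
proof (induction J rule: infinite_finite_induct)
  case (insert j J)
  then show ?case by (simp add: pd_add[where n=n] polyfun_sum)
qed (auto simp: pd_const)

lemma polyfun_pd: "polyfun n f \<Longrightarrow> polyfun n (pd i f)"
proof (induction rule: polyfun.induct)
  case (polyfun_const c)
  have "pd i (\<lambda>_. c) = (\<lambda>_. 0)" by (auto simp: pd_const)
  then show ?case by (simp add: polyfun.polyfun_const)
next
  case (polyfun_var j)
  have "pd i (\<lambda>x. x j) = (\<lambda>_. if i = j then 1 else 0)" by (auto simp: pd_var)
  then show ?case by (simp add: polyfun_const)
next
  case (polyfun_add f g)
  then have "pd i (\<lambda>x. f x + g x) = (\<lambda>x. pd i f x + pd i g x)" by (auto simp: pd_add)
  then show ?case using polyfun_add by (simp add: polyfun.polyfun_add)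
next
  case (polyfun_mult f g)
  then have "pd i (\<lambda>x. f x * g x) = (\<lambda>x. pd i f x * g x + f x * pd i g x)" by (auto simp: pd_mult)
  then show ?case using polyfun_mult by (auto intro!: polyfun_intros)
qed

lemma pd_outside: "polyfun n f \<Longrightarrow> n \<le> i \<Longrightarrow> pd i f x = 0"
  by (rule pd_eqI) (subst polyfun_cong[where y=x], auto)

lemma polyfun_line_deriv:
  assumes "polyfun n f"
  shows "((\<lambda>t. f (\<lambda>i. y i + t * u i)) has_real_derivative
    (\<Sum>i<n. pd i f (\<lambda>i. y i + t * u i) * u i)) (at t)"
  using assms
proof (induction rule: polyfun.induct)
  case (polyfun_const c)
  then show ?case by (simp add: pd_const)
next
  case (polyfun_var j)
  have "(\<Sum>i<n. pd i (\<lambda>x. x j) (\<lambda>i. y i + t * u i) * u i) = (\<Sum>i<n. if i = j then u i else 0)"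
    by (intro sum.cong) (auto simp: pd_var)
  also have "\<dots> = u j" using polyfun_var by simp
  finally show ?case by (auto intro!: derivative_eq_intros)
next
  case (polyfun_add f g)
  then show ?case
    by (auto intro!: derivative_eq_intros simp: pd_add sum.distrib algebra_simps)
next
  case (polyfun_mult f g)
  then show ?case
    by (auto intro!: derivative_eq_intros
        simp: pd_mult sum.distrib algebra_simps sum_distrib_left sum_distrib_right)
qed

lemma polyfun_bounded:
  assumes "polyfun n f"
  shows "\<exists>C\<ge>0. \<forall>x. (\<forall>i<n. \<bar>x i\<bar> \<le> R) \<longrightarrow> \<bar>f x\<bar> \<le> C"
  using assms
proof (induction rule: polyfun.induct)
  case (polyfun_const c)
  then show ?case by (auto intro: exI[of _ "\<bar>c\<bar>"])
next
  case (polyfun_var i)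
  then show ?case by (intro exI[of _ "\<bar>R\<bar>"]) force
next
  case (polyfun_add f g)
  then obtain A B where "A \<ge> 0" "\<forall>x. (\<forall>i<n. \<bar>x i\<bar> \<le> R) \<longrightarrow> \<bar>f x\<bar> \<le> A" 
     "B \<ge> 0" "\<forall>x. (\<forall>i<n. \<bar>x i\<bar> \<le> R) \<longrightarrow> \<bar>g x\<bar> \<le> B" by blast
  then show ?case by (intro exI[of _ "A + B"]) (auto, metis abs_triangle_ineq add_mono order_trans)
next
  case (polyfun_mult f g)
  then obtain A B where "A \<ge> 0" "\<forall>x. (\<forall>i<n. \<bar>x i\<bar> \<le> R) \<longrightarrow> \<bar>f x\<bar> \<le> A" 
     "B \<ge> 0" "\<forall>x. (\<forall>i<n. \<bar>x i\<bar> \<le> R) \<longrightarrow> \<bar>g x\<bar> \<le> B" by blast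
  then show ?case by (intro exI[of _ "A * B"]) (auto simp: abs_mult intro!: mult_mono)
qed

lemma polyfun_mvt:
  assumes f: "polyfun n f"
  shows "\<exists>t. 0 < t \<and> t < 1 \<and> f x - f y = (\<Sum>i<n. pd i f (\<lambda>i. y i + t * (x i - y i)) * (x i - y i))"
proof -
  have "\<exists>t. 0 < t \<and> t < 1 \<and> f (\<lambda>i. y i + 1 * (x i - y i)) - f (\<lambda>i. y i + 0 * (x i - y i)) =
     (1 - 0) * (\<Sum>i<n. pd i f (\<lambda>i. y i + t * (x i - y i)) * (x i - y i))"
    by (rule MVT2) (auto intro: polyfun_line_deriv[OF f])
  then show ?thesis by simp
qed

lemma segment_box:
  fixes x y :: real
  assumes "\<bar>x\<bar> \<le> R" "\<bar>y\<bar> \<le> R" "0 \<le> t" "t \<le> 1"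
  shows "\<bar>y + t * (x - y)\<bar> \<le> R"
proof -
  have "y + t * (x - y) = (1 - t) * y + t * x" by (simp add: algebra_simps)
  then have "\<bar>y + t * (x - y)\<bar> \<le> (1 - t) * \<bar>y\<bar> + t * \<bar>x\<bar>"
    using assms by (metis abs_triangle_ineq abs_mult abs_of_nonneg diff_ge_0_iff_ge)
  also have "\<dots> \<le> (1 - t) * R + t * R"
    using assms by (intro add_mono mult_left_mono) auto
  finally show ?thesis by (simp add: algebra_simps)
qed

lemma polyfun_lipschitz:
  assumes f: "polyfun n f"
  shows "\<exists>C\<ge>0. \<forall>x y. (\<forall>i<n. \<bar>x i\<bar> \<le> R) \<longrightarrow> (\<forall>i<n. \<bar>y i\<bar> \<le> R) \<longrightarrow>
    \<bar>f x - f y\<bar> \<le> C * (\<Sum>i<n. \<bar>x i - y i\<bar>)"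
proof -
  have "\<forall>i. \<exists>C\<ge>0. \<forall>x. (\<forall>i<n. \<bar>x i\<bar> \<le> R) \<longrightarrow> \<bar>pd i f x\<bar> \<le> C"
    using polyfun_bounded[OF polyfun_pd[OF f]] by blast
  then obtain C where C: "\<And>i. C i \<ge> 0" "\<And>i x. (\<forall>i<n. \<bar>x i\<bar> \<le> R) \<Longrightarrow> \<bar>pd i f x\<bar> \<le> C i"
    by metis
  define K where "K = (\<Sum>i<n. C i)"
  have K: "K \<ge> 0" "\<And>i. i < n \<Longrightarrow> C i \<le> K"
    using C(1) by (auto simp: K_def sum_nonneg intro!: member_le_sum)
  have "\<bar>f x - f y\<bar> \<le> K * (\<Sum>i<n. \<bar>x i - y i\<bar>)"
    if x: "\<forall>i<n. \<bar>x i\<bar> \<le> R" and y: "\<forall>i<n. \<bar>y i\<bar> \<le> R" for x y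
  proof -
    obtain t where t: "0 < t" "t < 1"
      "f x - f y = (\<Sum>i<n. pd i f (\<lambda>i. y i + t * (x i - y i)) * (x i - y i))"
      using polyfun_mvt[OF f] by blast
    have "\<bar>f x - f y\<bar> \<le> (\<Sum>i<n. \<bar>pd i f (\<lambda>i. y i + t * (x i - y i)) * (x i - y i)\<bar>)"
      unfolding t(3) by (rule sum_abs)
    also have "\<dots> \<le> (\<Sum>i<n. K * \<bar>x i - y i\<bar>)"
    proof (rule sum_mono)
      fix i assume i: "i \<in> {..<n}"
      have "\<bar>pd i f (\<lambda>i. y i + t * (x i - y i))\<bar> \<le> C i"
        using x y t by (intro C(2)) (auto intro!: segment_box)
      then show "\<bar>pd i f (\<lambda>i. y i + t * (x i - y i)) * (x i - y i)\<bar> \<le> K * \<bar>x i - y i\<bar>"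
        unfolding abs_mult using K(2)[of i] i by (intro mult_right_mono) auto
    qed
    finally show ?thesis by (simp add: sum_distrib_left)
  qed
  then show ?thesis using K(1) by blast
qed

lemma polyfun_taylor:
  assumes f: "polyfun n f"
  shows "\<exists>C\<ge>0. \<forall>x y. (\<forall>i<n. \<bar>x i\<bar> \<le> R) \<longrightarrow> (\<forall>i<n. \<bar>y i\<bar> \<le> R) \<longrightarrow>
    \<bar>f x - f y - (\<Sum>i<n. pd i f y * (x i - y i))\<bar> \<le> C * (\<Sum>i<n. \<bar>x i - y i\<bar>)\<^sup>2"
proof -
  have "\<forall>i. \<exists>C\<ge>0. \<forall>x y. (\<forall>i<n. \<bar>x i\<bar> \<le> R) \<longrightarrow> (\<forall>i<n. \<bar>y i\<bar> \<le> R) \<longrightarrow>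
    \<bar>pd i f x - pd i f y\<bar> \<le> C * (\<Sum>i<n. \<bar>x i - y i\<bar>)"
    using polyfun_lipschitz[OF polyfun_pd[OF f]] by blast
  then obtain C where C: "\<And>i. C i \<ge> 0" "\<And>i x y. (\<forall>i<n. \<bar>x i\<bar> \<le> R) \<Longrightarrow> (\<forall>i<n. \<bar>y i\<bar> \<le> R) \<Longrightarrow>
      \<bar>pd i f x - pd i f y\<bar> \<le> C i * (\<Sum>i<n. \<bar>x i - y i\<bar>)"
    by metis
  define K where "K = (\<Sum>i<n. C i)"
  have K: "K \<ge> 0" "\<And>i. i < n \<Longrightarrow> C i \<le> K"
    using C(1) by (auto simp: K_def sum_nonneg intro!: member_le_sum)
  have "\<bar>f x - f y - (\<Sum>i<n. pd i f y * (x i - y i))\<bar> \<le> K * (\<Sum>i<n. \<bar>x i - y i\<bar>)\<^sup>2"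
    if x: "\<forall>i<n. \<bar>x i\<bar> \<le> R" and y: "\<forall>i<n. \<bar>y i\<bar> \<le> R" for x y
  proof -
    let ?S = "\<Sum>i<n. \<bar>x i - y i\<bar>"
    obtain t where t: "0 < t" "t < 1"
      "f x - f y = (\<Sum>i<n. pd i f (\<lambda>i. y i + t * (x i - y i)) * (x i - y i))"
      using polyfun_mvt[OF f] by blast
    let ?z = "\<lambda>i. y i + t * (x i - y i)"
    have "\<bar>f x - f y - (\<Sum>i<n. pd i f y * (x i - y i))\<bar> = \<bar>\<Sum>i<n. (pd i f ?z - pd i f y) * (x i - y i)\<bar>"
      unfolding t(3) by (simp add: sum_subtractf left_diff_distrib)
    also have "\<dots> \<le> (\<Sum>i<n. \<bar>(pd i f ?z - pd i f y) * (x i - y i)\<bar>)"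
      by (rule sum_abs)
    also have "\<dots> \<le> (\<Sum>i<n. (K * ?S) * \<bar>x i - y i\<bar>)"
    proof (rule sum_mono)
      fix i assume i: "i \<in> {..<n}"
      have "\<bar>pd i f ?z - pd i f y\<bar> \<le> C i * (\<Sum>i<n. \<bar>?z i - y i\<bar>)"
        using x y t by (intro C(2)) (auto intro!: segment_box)
      also have "\<dots> \<le> K * ?S"
      proof (rule mult_mono)
        show "(\<Sum>i<n. \<bar>?z i - y i\<bar>) \<le> ?S"
          using t by (intro sum_mono) (auto simp: abs_mult intro: mult_left_le_one_le)
      qed (use K C(1) i in \<open>auto intro: sum_nonneg\<close>)
      finally show "\<bar>(pd i f ?z - pd i f y) * (x i - y i)\<bar> \<le> (K * ?S) * \<bar>x i - y i\<bar>"
        unfolding abs_mult by (intro mult_right_mono) auto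
    qed
    also have "\<dots> = K * ?S\<^sup>2"
      by (simp add: sum_distrib_left[symmetric] power2_eq_square)
    finally show ?thesis .
  qed
  then show ?thesis using K(1) by blast
qed

section \<open>Algebraic dependence of polynomials of bounded degree\<close>

text \<open>Gaussian elimination: an equation with a pivot removes one unknown, and a solution of
  the reduced system extends by solving that equation for the unknown of the pivot.\<close>

lemma linear_dependence:
  fixes a :: "'j \<Rightarrow> 'i \<Rightarrow> real"
  assumes "finite I" "finite J" "card I < card J"
  shows "\<exists>u. (\<exists>j\<in>J. u j \<noteq> 0) \<and> (\<forall>i\<in>I. (\<Sum>j\<in>J. u j * a j i) = 0)"
  using assms
proof (induction I arbitrary: J a rule: finite_induct)
  case empty
  then have "J \<noteq> {}" by auto
  then show ?case by (intro exI[of _ "\<lambda>_. 1"]) auto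
next
  case (insert i I)
  show ?case
  proof (cases "\<forall>j\<in>J. a j i = 0")
    case True
    moreover obtain u where "\<exists>j\<in>J. u j \<noteq> 0" "\<forall>i\<in>I. (\<Sum>j\<in>J. u j * a j i) = 0"
      using insert.IH[of J a] insert.prems insert.hyps by auto
    ultimately show ?thesis by (intro exI[of _ u]) auto
  next
    case False
    then obtain k where k: "k \<in> J" "a k i \<noteq> 0" by blast
    define b where "b j l = a j l - a j i / a k i * a k l" for j l
    have "card I < card (J - {k})"
      using insert.prems insert.hyps k by simp
    then obtain u where u: "\<exists>j\<in>J - {k}. u j \<noteq> 0" "\<forall>l\<in>I. (\<Sum>j\<in>J - {k}. u j * b j l) = 0"
      using insert.IH[of "J - {k}" b] insert.prems by auto
    define v where "v = u(k := - (\<Sum>j\<in>J - {k}. u j * a j i) / a k i)"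
    have v: "(\<Sum>j\<in>J. v j * a j l) = (\<Sum>j\<in>J - {k}. u j * b j l)" for l
    proof -
      have "(\<Sum>j\<in>J. v j * a j l) = v k * a k l + (\<Sum>j\<in>J - {k}. v j * a j l)"
        using insert.prems(1) k(1) by (rule sum.remove)
      also have "(\<Sum>j\<in>J - {k}. v j * a j l) = (\<Sum>j\<in>J - {k}. u j * a j l)"
        by (intro sum.cong) (auto simp: v_def)
      also have "v k * a k l = - (\<Sum>j\<in>J - {k}. u j * (a j i / a k i * a k l))"
        by (simp add: v_def sum_distrib_right sum_divide_distrib mult.assoc)
      finally show ?thesis
        by (simp add: b_def right_diff_distrib sum_subtractf)
    qed
    have "b j i = 0" for j
      using k by (simp add: b_def)
    then have "\<forall>l\<in>insert i I. (\<Sum>j\<in>J. v j * a j l) = 0"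
      using u(2) by (auto simp: v)
    moreover have "\<exists>j\<in>J. v j \<noteq> 0"
      using u(1) by (auto simp: v_def)
    ultimately show ?thesis by blast
  qed
qed

section \<open>Monomials and bidegrees\<close>

definition mono :: "nat \<Rightarrow> (nat \<Rightarrow> nat) \<Rightarrow> (nat \<Rightarrow> real) \<Rightarrow> real" where
  "mono n \<kappa> x = (\<Prod>i<n. x i ^ \<kappa> i)"

lemma mono_Suc: "mono (Suc n) \<kappa> x = mono n \<kappa> x * x n ^ \<kappa> n"
  by (simp add: mono_def)

lemma polyfun_mono_fun: "polyfun n (mono n \<kappa>)"
  unfolding mono_def[abs_def] by (intro polyfun_prod polyfun_power polyfun_var) auto

text \<open>Induction on the variables, with the monomials grouped by the exponent of the last one:
  fixing the other variables where one group does not vanish leaves a nonzero polynomial in the last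
  variable.\<close>

lemma mono_independent:
  assumes "finite A" "\<And>\<kappa> \<kappa>'. \<kappa> \<in> A \<Longrightarrow> \<kappa>' \<in> A \<Longrightarrow> (\<And>i. i < n \<Longrightarrow> \<kappa> i = \<kappa>' i) \<Longrightarrow> \<kappa> = \<kappa>'"
    and "\<alpha> \<in> A" "u \<alpha> \<noteq> 0"
  shows "\<exists>x. (\<Sum>\<kappa>\<in>A. u \<kappa> * mono n \<kappa> x) \<noteq> 0"
  using assms
proof (induction n arbitrary: A \<alpha>)
  case 0
  then have "A = {\<alpha>}" by auto
  then show ?case using 0 by (simp add: mono_def)
next
  case (Suc n)
  define e where "e = \<alpha> n"
  have "\<exists>x. (\<Sum>\<kappa>\<in>{\<kappa>\<in>A. \<kappa> n = e}. u \<kappa> * mono n \<kappa> x) \<noteq> 0"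
  proof (rule Suc.IH)
    fix \<kappa> \<kappa>' assume "\<kappa> \<in> {\<kappa> \<in> A. \<kappa> n = e}" "\<kappa>' \<in> {\<kappa> \<in> A. \<kappa> n = e}" "\<And>i. i < n \<Longrightarrow> \<kappa> i = \<kappa>' i"
    then show "\<kappa> = \<kappa>'"
      by (intro Suc.prems(2)) (auto simp: less_Suc_eq)
  qed (use Suc.prems in \<open>auto simp: e_def\<close>)
  then obtain x where x: "(\<Sum>\<kappa>\<in>{\<kappa>\<in>A. \<kappa> n = e}. u \<kappa> * mono n \<kappa> x) \<noteq> 0" by blast
  define p where "p = (\<Sum>\<kappa>\<in>A. monom (u \<kappa> * mono n \<kappa> x) (\<kappa> n))"
  have "coeff p e = (\<Sum>\<kappa>\<in>A. if \<kappa> n = e then u \<kappa> * mono n \<kappa> x else 0)"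
    by (simp add: p_def coeff_sum)
  also have "\<dots> \<noteq> 0"
    using x Suc.prems(1) by (simp add: sum.inter_filter)
  finally have "p \<noteq> 0" by auto
  then obtain t where t: "poly p t \<noteq> 0"
    using poly_all_0_iff_0 by blast
  have m: "mono n \<kappa> (x(n := t)) = mono n \<kappa> x" for \<kappa>
    by (simp add: mono_def)
  have "(\<Sum>\<kappa>\<in>A. u \<kappa> * mono (Suc n) \<kappa> (x(n := t))) = poly p t"
    by (simp add: p_def poly_sum poly_monom mono_Suc m mult.assoc)
  then show ?case using t by metis
qed

text \<open>The coordinates below \<open>M\<close> form a first block z, those from \<open>M\<close>
  to \<open>n - 1\<close> a second block y; \<open>A\<close> bounds the degree in z and
  \<open>B\<close> the degree in y. Keeping the two apart is what lets \<open>M\<close> enter the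
  bounds in the base of a power and \<open>n - M\<close> in the exponent.\<close>

inductive bd :: "nat \<Rightarrow> nat \<Rightarrow> nat \<Rightarrow> nat \<Rightarrow> ((nat \<Rightarrow> real) \<Rightarrow> real) \<Rightarrow> bool" for M n where
  bd_const: "bd M n A B (\<lambda>_. c)"
| bd_add: "bd M n A B f \<Longrightarrow> bd M n A B g \<Longrightarrow> bd M n A B (\<lambda>x. f x + g x)"
| bd_mult_z: "i < M \<Longrightarrow> bd M n A B f \<Longrightarrow> bd M n (Suc A) B (\<lambda>x. x i * f x)"
| bd_mult_y: "M \<le> i \<Longrightarrow> i < n \<Longrightarrow> bd M n A B f \<Longrightarrow> bd M n A (Suc B) (\<lambda>x. x i * f x)"

lemma bd_weaken: "bd M n A B f \<Longrightarrow> A \<le> A' \<Longrightarrow> B \<le> B' \<Longrightarrow> bd M n A' B' f"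
proof (induction arbitrary: A' B' rule: bd.induct)
  case (bd_mult_z i A B f)
  then show ?case by (cases A') (auto intro: bd.intros)
next
  case (bd_mult_y i A B f)
  then show ?case by (cases B') (auto intro: bd.intros)
qed (auto intro: bd.intros)

lemma bd_cmult: "bd M n A B f \<Longrightarrow> bd M n A B (\<lambda>x. c * f x)"
proof (induction rule: bd.induct)
  case (bd_add A B f g)
  then show ?case using bd.bd_add[of M n A B "\<lambda>x. c * f x" "\<lambda>x. c * g x"] by (simp add: algebra_simps)
next
  case (bd_mult_z i A B f)
  then show ?case using bd.bd_mult_z[of i M n A B "\<lambda>x. c * f x"] by (simp add: algebra_simps)
next
  case (bd_mult_y i A B f)
  then show ?case using bd.bd_mult_y[of M i n A B "\<lambda>x. c * f x"] by (simp add: algebra_simps)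
qed (rule bd_const)

lemma bd_mult: "bd M n A B f \<Longrightarrow> bd M n A' B' g \<Longrightarrow> bd M n (A + A') (B + B') (\<lambda>x. f x * g x)"
proof (induction rule: bd.induct)
  case (bd_const A B c)
  then show ?case by (intro bd_cmult) (auto elim: bd_weaken)
next
  case (bd_add A B f h)
  then show ?case using bd.bd_add[of M n "A+A'" "B+B'" "\<lambda>x. f x * g x" "\<lambda>x. h x * g x"]
    by (simp add: algebra_simps)
next
  case (bd_mult_z i A B f)
  then show ?case using bd.bd_mult_z[of i M n "A+A'" "B+B'" "\<lambda>x. f x * g x"] by (simp add: algebra_simps)
next
  case (bd_mult_y i A B f)
  then show ?case using bd.bd_mult_y[of M i n "A+A'" "B+B'" "\<lambda>x. f x * g x"] by (simp add: algebra_simps)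
qed

lemma bd_mult': "bd M n A B f \<Longrightarrow> bd M n A' B' g \<Longrightarrow> A + A' \<le> A'' \<Longrightarrow> B + B' \<le> B'' \<Longrightarrow>
    bd M n A'' B'' (\<lambda>x. f x * g x)"
  using bd_mult bd_weaken by blast

lemma bd_var_z: "i < M \<Longrightarrow> 0 < A \<Longrightarrow> bd M n A B (\<lambda>x. x i)"
  using bd_mult_z[of i M n "A - 1" B "\<lambda>_. 1"] bd_const[of M n "A - 1" B 1] by simp

lemma bd_var_y: "M \<le> i \<Longrightarrow> i < n \<Longrightarrow> 0 < B \<Longrightarrow> bd M n A B (\<lambda>x. x i)"
  using bd_mult_y[of M i n A "B - 1" "\<lambda>_. 1"] bd_const[of M n A "B - 1" 1] by simp

lemma bd_uminus: "bd M n A B f \<Longrightarrow> bd M n A B (\<lambda>x. - f x)"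
  using bd_cmult[of M n A B f "-1"] by simp

lemma bd_diff: "bd M n A B f \<Longrightarrow> bd M n A B g \<Longrightarrow> bd M n A B (\<lambda>x. f x - g x)"
  using bd_add[OF _ bd_uminus, of M n A B f g] by simp

lemma bd_sum: "(\<And>i. i \<in> I \<Longrightarrow> bd M n A B (f i)) \<Longrightarrow> bd M n A B (\<lambda>x. \<Sum>i\<in>I. f i x)"
  by (induction I rule: infinite_finite_induct) (auto intro: bd_const bd_add)

lemma bd_power: "bd M n A B f \<Longrightarrow> bd M n (k * A) (k * B) (\<lambda>x. f x ^ k)"
  by (induction k) (auto intro: bd_const bd_mult)

lemma bd_power2: "bd M n A B f \<Longrightarrow> 2 * A \<le> A' \<Longrightarrow> 2 * B \<le> B' \<Longrightarrow> bd M n A' B' (\<lambda>x. (f x)\<^sup>2)"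
  using bd_power[of M n A B f 2] bd_weaken by fastforce

lemma bd_prod: "finite I \<Longrightarrow> (\<And>i. i \<in> I \<Longrightarrow> bd M n (A i) (B i) (f i)) \<Longrightarrow>
    bd M n (\<Sum>i\<in>I. A i) (\<Sum>i\<in>I. B i) (\<lambda>x. \<Prod>i\<in>I. f i x)"
  by (induction I rule: finite_induct) (auto intro: bd_const bd_mult)

lemma bd_imp_polyfun: "bd M n A B f \<Longrightarrow> M \<le> n \<Longrightarrow> polyfun n f"
  by (induction rule: bd.induct) (auto intro!: polyfun_intros)

lemma polyfun_imp_bd: "polyfun n f \<Longrightarrow> \<exists>B. bd 0 n 0 B f"
proof (induction rule: polyfun.induct)
  case (polyfun_const c)
  show ?case by (auto intro: bd_const)
next
  case (polyfun_var i)
  then show ?case by (auto intro!: exI[of _ 1] bd_var_y)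
next
  case (polyfun_add f g)
  then obtain B C where "bd 0 n 0 B f" "bd 0 n 0 C g" by blast
  then have "bd 0 n 0 (B + C) f" "bd 0 n 0 (B + C) g" by (auto elim: bd_weaken)
  then show ?case by (auto intro: bd_add)
next
  case (polyfun_mult f g)
  then obtain B C where "bd 0 n 0 B f" "bd 0 n 0 C g" by blast
  then show ?case using bd_mult by fastforce
qed

section \<open>Counting exponent vectors\<close>

definition exps :: "nat \<Rightarrow> nat \<Rightarrow> nat \<Rightarrow> nat \<Rightarrow> (nat \<Rightarrow> nat) set" where
  "exps M n A B = {\<kappa>. (\<forall>i\<ge>n. \<kappa> i = 0) \<and> (\<Sum>i<M. \<kappa> i) \<le> A \<and> (\<Sum>i\<in>{M..<n}. \<kappa> i) \<le> B}"

definition simplex_exps :: "nat \<Rightarrow> nat \<Rightarrow> (nat \<Rightarrow> nat) set" where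
  "simplex_exps M A = {\<sigma>. (\<forall>i\<ge>M. \<sigma> i = 0) \<and> (\<Sum>i<M. \<sigma> i) \<le> A}"

lemma simplex_exps_Suc: "simplex_exps (Suc M) A = (\<Union>j\<le>A. (\<lambda>\<sigma>. \<sigma>(M := j)) ` simplex_exps M (A - j))"
proof
  show "simplex_exps (Suc M) A \<subseteq> (\<Union>j\<le>A. (\<lambda>\<sigma>. \<sigma>(M := j)) ` simplex_exps M (A - j))"
  proof
    fix \<sigma> assume "\<sigma> \<in> simplex_exps (Suc M) A"
    then have "\<sigma>(M := 0) \<in> simplex_exps M (A - \<sigma> M)" "\<sigma> M \<le> A"
      by (auto simp: simplex_exps_def)
    then show "\<sigma> \<in> (\<Union>j\<le>A. (\<lambda>\<sigma>. \<sigma>(M := j)) ` simplex_exps M (A - j))"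
      by (intro UN_I[of "\<sigma> M"] image_eqI[of _ _ "\<sigma>(M := 0)"]) auto
  qed
qed (auto simp: simplex_exps_def)

lemma card_simplex_exps: "finite (simplex_exps M A) \<and> card (simplex_exps M A) = (A + M) choose M"
proof (induction M arbitrary: A)
  case 0
  have "simplex_exps 0 A = {\<lambda>_. 0}" by (auto simp: simplex_exps_def)
  then show ?case by simp
next
  case (Suc M)
  have inj: "inj_on (\<lambda>\<sigma>. \<sigma>(M := j)) (simplex_exps M B)" for j B
  proof (rule inj_onI)
    fix \<sigma> \<tau> assume "\<sigma> \<in> simplex_exps M B" "\<tau> \<in> simplex_exps M B" and e: "\<sigma>(M := j) = \<tau>(M := j)"
    then have "\<sigma> M = \<tau> M" by (simp add: simplex_exps_def)
    then show "\<sigma> = \<tau>" using e by (metis fun_upd_triv fun_upd_upd)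
  qed
  have "card (simplex_exps (Suc M) A) = (\<Sum>j\<le>A. card ((\<lambda>\<sigma>. \<sigma>(M := j)) ` simplex_exps M (A - j)))"
    unfolding simplex_exps_Suc
  proof (rule card_UN_disjoint)
    show "\<forall>i\<in>{..A}. \<forall>j\<in>{..A}. i \<noteq> j \<longrightarrow> (\<lambda>\<sigma>. \<sigma>(M := i)) ` simplex_exps M (A - i) \<inter>
        (\<lambda>\<sigma>. \<sigma>(M := j)) ` simplex_exps M (A - j) = {}"
      by (auto dest!: fun_cong[of _ _ M])
  qed (use Suc in auto)
  also have "\<dots> = (\<Sum>j\<le>A. (A - j + M) choose M)"
    using Suc inj by (simp add: card_image)
  also have "\<dots> = (\<Sum>j\<le>A. (j + M) choose M)"
    by (rule sum.reindex_bij_witness[where i="\<lambda>j. A - j" and j="\<lambda>j. A - j"]) auto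
  \<comment> \<open>The hockey-stick identity for binomial coefficients.\<close>
  also have "\<dots> = (A + Suc M) choose Suc M"
    by (induction A) auto
  finally show ?case
    using Suc by (simp add: simplex_exps_Suc)
qed

text \<open>For \<open>p = r * M\<close> each of the \<open>M\<close> factors of the binomial
  coefficient grows by a factor of at most 1 + 1/M, so raising the degree by \<open>r\<close>
  multiplies the number of monomials by at most (1 + 1/M)^M, which is below exp 1 whatever
  \<open>M\<close> is.\<close>

lemma card_simplex_exps_growth:
  assumes "p = r * M"
  shows "real (card (simplex_exps M (p + r))) \<le> 3 * real (card (simplex_exps M p))"
proof (cases "M = 0 \<or> r = 0")
  case True
  then show ?thesis by (auto simp: card_simplex_exps)
next
  case False
  define x where "x = 1 / real M"
  have r: "real r \<le> x * real p" and x: "x \<ge> 0"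
    using False assms by (auto simp: x_def)
  have "real ((p + r + K) choose K) \<le> (1 + x) ^ K * real ((p + K) choose K)" for K
  proof (induction K)
    case (Suc K)
    have "real (Suc K) * real ((p + r + Suc K) choose Suc K) = real (p + r + Suc K) * real ((p + r + K) choose K)"
      using Suc_times_binomial_eq[of "p + r + K" K] 
      by (metis add_Suc_right mult.commute of_nat_mult)
    also have "\<dots> \<le> ((1 + x) * real (p + Suc K)) * ((1 + x) ^ K * real ((p + K) choose K))"
    proof (rule mult_mono[OF _ Suc.IH])
      have "real r \<le> x * real (p + Suc K)"
        using r x by (auto simp: algebra_simps intro: order_trans)
      then show "real (p + r + Suc K) \<le> (1 + x) * real (p + Suc K)"
        by (simp add: algebra_simps)
    qed (use x in auto)
    also have "\<dots> = (1 + x) ^ Suc K * (real (p + Suc K) * real ((p + K) choose K))"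
      by simp
    also have "real (p + Suc K) * real ((p + K) choose K) = real (Suc K) * real ((p + Suc K) choose Suc K)"
      using Suc_times_binomial_eq[of "p + K" K] 
      by (metis add_Suc_right mult.commute of_nat_mult)
    finally have "real (Suc K) * real ((p + r + Suc K) choose Suc K) \<le>
        real (Suc K) * ((1 + x) ^ Suc K * real ((p + Suc K) choose Suc K))"
      by (simp only: mult.left_commute)
    then show ?case
      by (subst (asm) mult_le_cancel_left_pos) auto
  qed simp
  from this[of M] have "real (card (simplex_exps M (p + r))) \<le> (1 + x) ^ M * real (card (simplex_exps M p))"
    by (simp add: card_simplex_exps)
  also have "(1 + x) ^ M \<le> exp 1"
    using exp_ge_one_plus_x_over_n_power_n[of M 1] False by (simp add: x_def)
  also have "exp 1 \<le> (3::real)"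
    using exp_le by simp
  finally show ?thesis
    by (simp add: mult_right_mono)
qed

text \<open>In z the vectors of bounded total degree are counted exactly; in y each exponent is
  merely placed between 0 and \<open>B\<close>, which is crude but costs only a power with exponent
  \<open>n - M\<close>.\<close>

lemma card_exps:
  assumes "M \<le> n"
  shows "finite (exps M n A B) \<and> card (exps M n A B) \<le> card (simplex_exps M A) * (B + 1) ^ (n - M)"
proof -
  let ?T = "simplex_exps M A \<times> (PiE {M..<n} (\<lambda>_. {..B}))"
  define h where "h \<kappa> = (\<lambda>i. if i < M then \<kappa> i else 0::nat, restrict \<kappa> {M..<n})" for \<kappa>
  have "\<kappa> i \<le> B" if "\<kappa> \<in> exps M n A B" "i \<in> {M..<n}" for \<kappa> i
    using that member_le_sum[of i "{M..<n}" \<kappa>] by (auto simp: exps_def)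
  then have sub: "h ` exps M n A B \<subseteq> ?T"
    by (auto simp: h_def exps_def simplex_exps_def)
  have inj: "inj_on h (exps M n A B)"
  proof (rule inj_onI, rule ext)
    fix \<kappa> \<kappa>' i assume k: "\<kappa> \<in> exps M n A B" "\<kappa>' \<in> exps M n A B" "h \<kappa> = h \<kappa>'"
    consider "i < M" | "M \<le> i" "i < n" | "n \<le> i" by linarith
    then show "\<kappa> i = \<kappa>' i"
    proof cases
      case 1
      then show ?thesis using k(3) by (auto simp: h_def dest!: fun_cong[of _ _ i])
    next
      case 2
      then have "restrict \<kappa> {M..<n} i = restrict \<kappa>' {M..<n} i" using k(3) by (simp add: h_def)
      then show ?thesis using 2 by simp
    qed (use k in \<open>simp add: exps_def\<close>)
  qed
  have fin: "finite ?T"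
    using card_simplex_exps by (intro finite_cartesian_product finite_PiE) auto
  have "card (exps M n A B) \<le> card ?T"
    using card_inj_on_le[OF inj sub fin] .
  also have "card ?T = card (simplex_exps M A) * (B + 1) ^ (n - M)"
    by (simp add: card_cartesian_product card_PiE)
  finally show ?thesis
    using inj_on_finite[OF inj sub fin] by simp
qed

text \<open>Multiplication by a variable sends monomials to monomials; the coefficients are
  transported along the injective increment of one exponent.\<close>

lemma mono_shift:
  assumes "finite T" "i < n" "(\<lambda>\<kappa>. \<kappa>(i := Suc (\<kappa> i))) ` S \<subseteq> T"
  shows "\<exists>c. \<forall>x. x i * (\<Sum>\<kappa>\<in>S. c0 \<kappa> * mono n \<kappa> x) = (\<Sum>\<kappa>\<in>T. c \<kappa> * mono n \<kappa> x)"
proof -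
  let ?h = "\<lambda>\<kappa>::nat\<Rightarrow>nat. \<kappa>(i := Suc (\<kappa> i))" and ?k = "\<lambda>\<kappa>::nat\<Rightarrow>nat. \<kappa>(i := \<kappa> i - 1)"
  have kh: "?k (?h \<kappa>) = \<kappa>" for \<kappa> by auto
  have inj: "inj_on ?h S" by (rule inj_on_inverseI[of _ ?k]) (rule kh)
  have m: "mono n (?h \<kappa>) x = x i * mono n \<kappa> x" for \<kappa> x
  proof -
    have "mono n (?h \<kappa>) x = x i ^ Suc (\<kappa> i) * (\<Prod>j\<in>{..<n} - {i}. x j ^ ?h \<kappa> j)"
      unfolding mono_def using assms(2) by (subst prod.remove[of _ i]) auto
    also have "(\<Prod>j\<in>{..<n} - {i}. x j ^ ?h \<kappa> j) = (\<Prod>j\<in>{..<n} - {i}. x j ^ \<kappa> j)"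
      by (intro prod.cong) auto
    also have "x i ^ Suc (\<kappa> i) * \<dots> = x i * (x i ^ \<kappa> i * \<dots>)"
      by simp
    also have "x i ^ \<kappa> i * (\<Prod>j\<in>{..<n} - {i}. x j ^ \<kappa> j) = mono n \<kappa> x"
      unfolding mono_def using assms(2) by (intro prod.remove[symmetric]) auto
    finally show ?thesis .
  qed
  define c where "c \<kappa> = (if \<kappa> \<in> ?h ` S then c0 (?k \<kappa>) else 0)" for \<kappa>
  have "x i * (\<Sum>\<kappa>\<in>S. c0 \<kappa> * mono n \<kappa> x) = (\<Sum>\<kappa>\<in>T. c \<kappa> * mono n \<kappa> x)" for x
  proof -
    have "(\<Sum>\<kappa>\<in>T. c \<kappa> * mono n \<kappa> x) = (\<Sum>\<kappa>\<in>?h ` S. c \<kappa> * mono n \<kappa> x)"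
      using assms by (intro sum.mono_neutral_right) (auto simp: c_def)
    also have "\<dots> = (\<Sum>\<kappa>\<in>S. c (?h \<kappa>) * mono n (?h \<kappa>) x)"
      by (simp add: sum.reindex[OF inj] del: fun_upd_apply)
    also have "\<dots> = (\<Sum>\<kappa>\<in>S. x i * (c0 \<kappa> * mono n \<kappa> x))"
    proof (intro sum.cong refl)
      fix \<kappa> assume "\<kappa> \<in> S"
      then have "c (?h \<kappa>) = c0 \<kappa>" unfolding c_def kh by simp
      then show "c (?h \<kappa>) * mono n (?h \<kappa>) x = x i * (c0 \<kappa> * mono n \<kappa> x)"
        by (simp add: m del: fun_upd_apply)
    qed
    finally show ?thesis by (simp add: sum_distrib_left)
  qed
  then show ?thesis by blast
qed

lemma sum_increment:
  assumes "finite I"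
  shows "(\<Sum>j\<in>I. (\<kappa>(i := Suc (\<kappa> i))) j) = (\<Sum>j\<in>I. \<kappa> j) + (if i \<in> I then 1 else 0 :: nat)"
proof -
  have "(\<Sum>j\<in>I. (\<kappa>(i := Suc (\<kappa> i))) j) = (\<Sum>j\<in>I. \<kappa> j + (if i = j then 1 else 0))"
    by (intro sum.cong) auto
  then show ?thesis using assms by (simp add: sum.distrib)
qed

lemma bd_coefficients:
  assumes "bd M n A B f" "M \<le> n"
  shows "\<exists>c. \<forall>x. f x = (\<Sum>\<kappa>\<in>exps M n A B. c \<kappa> * mono n \<kappa> x)"
  using assms
proof (induction rule: bd.induct)
  case (bd_const A B c)
  have "(\<lambda>_. 0) \<in> exps M n A B" by (simp add: exps_def)
  moreover have "finite (exps M n A B)" using card_exps bd_const by blast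
  ultimately have "(\<Sum>\<kappa>\<in>exps M n A B. (if \<kappa> = (\<lambda>_. 0) then c else 0) * mono n \<kappa> x) = c * mono n (\<lambda>_. 0) x" for x
    by (simp add: if_distrib[of "\<lambda>c. c * _"] cong: if_cong)
  then show ?case
    by (intro exI[of _ "\<lambda>\<kappa>. if \<kappa> = (\<lambda>_. 0) then c else 0"]) (simp add: mono_def)
next
  case (bd_add A B f g)
  then obtain c d where "\<forall>x. f x = (\<Sum>\<kappa>\<in>exps M n A B. c \<kappa> * mono n \<kappa> x)"
    "\<forall>x. g x = (\<Sum>\<kappa>\<in>exps M n A B. d \<kappa> * mono n \<kappa> x)" by blast
  then show ?case
    by (intro exI[of _ "\<lambda>\<kappa>. c \<kappa> + d \<kappa>"]) (simp add: algebra_simps sum.distrib)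
next
  case (bd_mult_z i A B f)
  then obtain c0 where c0: "\<And>x. f x = (\<Sum>\<kappa>\<in>exps M n A B. c0 \<kappa> * mono n \<kappa> x)"
    by blast
  have "(\<lambda>\<kappa>. \<kappa>(i := Suc (\<kappa> i))) ` exps M n A B \<subseteq> exps M n (Suc A) B"
    using bd_mult_z by (auto simp: exps_def sum_increment simp del: fun_upd_apply) auto
  then show ?case
    unfolding c0 using bd_mult_z card_exps by (intro mono_shift) auto
next
  case (bd_mult_y i A B f)
  then obtain c0 where c0: "\<And>x. f x = (\<Sum>\<kappa>\<in>exps M n A B. c0 \<kappa> * mono n \<kappa> x)"
    by blast
  have "(\<lambda>\<kappa>. \<kappa>(i := Suc (\<kappa> i))) ` exps M n A B \<subseteq> exps M n A (Suc B)"
    using bd_mult_y by (auto simp: exps_def sum_increment simp del: fun_upd_apply) auto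
  then show ?case
    unfolding c0 using bd_mult_y card_exps by (intro mono_shift) auto
qed

text \<open>The number N for which the count in \<open>algebraic_dependence\<close> closes. With K =
  2 \<delta>^2 (M + 1) (e + 1), and in units of the number of monomials of degree at most p in z,
  the monomials that can occur number at most 3 K^e N^e and the products of powers N^e (N + 1); so N
  = 3 K^e is enough.\<close>

definition dep_bound :: "nat \<Rightarrow> nat \<Rightarrow> nat \<Rightarrow> nat" where
  "dep_bound M e \<delta> = 3 * (2 * \<delta>\<^sup>2 * (M + 1) * (e + 1)) ^ e"

text \<open>
  Counting dimensions: the products of powers of the \<open>n + 1\<close> functions outnumber the monomials that
  can occur in them.
\<close>

lemma algebraic_dependence:
  assumes Mn: "M \<le> n" and \<delta>: "\<delta> \<ge> 1"
    and fz: "\<And>i. i < M \<Longrightarrow> bd M n 1 \<delta> (f i)"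
    and fy: "\<And>i. M \<le> i \<Longrightarrow> i < n \<Longrightarrow> bd M n \<delta> \<delta> (f i)"
    and \<phi>: "bd M n \<delta> \<delta> \<phi>"
    and N: "N = dep_bound M (n - M) \<delta>"
  shows "\<exists>g. (\<forall>i. polyfun n (g i)) \<and> (\<exists>i\<le>N. \<exists>w. g i w \<noteq> 0) \<and>
    (\<forall>x. (\<Sum>i\<le>N. g i (\<lambda>j. f j x) * \<phi> x ^ i) = 0)"
proof -
  define e where "e = n - M"
  define K where "K = 2 * \<delta>\<^sup>2 * (M + 1) * (e + 1)"
  \<comment> \<open>\<open>r\<close> bounds the degree, in either block, of a product of powers of
    \<open>\<phi>\<close> and of the \<open>e\<close> functions with index at least
    \<open>M\<close>, all exponents being at most \<open>N\<close>.\<close>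
  define r where "r = \<delta> * (e + 1) * N"
  define p where "p = r * M"
  \<comment> \<open>The first \<open>M\<close> functions have degree 1 in z but up to
    \<open>\<delta>\<close> in y, hence the summand \<open>\<delta> * p\<close>.\<close>
  define B where "B = \<delta> * p + r"
  have K: "K \<ge> 1" using \<delta> by (simp add: K_def Suc_le_eq del: mult_Suc mult_Suc_right)
  have NK: "N = 3 * K ^ e" by (simp add: N K_def e_def dep_bound_def)
  then have N1: "N \<ge> 1" using K by simp
  have r1: "r \<ge> 1" using N1 \<delta> by (simp add: r_def)
  \<comment> \<open>The exponent of \<open>\<phi>\<close> may reach \<open>N\<close>, those of the
    functions from \<open>M\<close> on stay below \<open>N\<close>; this surplus of
    \<open>N + 1\<close> over \<open>N\<close> decides the count.\<close>
  define J where "J = {\<alpha>::nat \<Rightarrow> nat. (\<forall>i>n. \<alpha> i = 0) \<and> (\<Sum>i<M. \<alpha> i) \<le> p \<and> (\<forall>i\<in>{M..<n}. \<alpha> i < N) \<and> \<alpha> n \<le> N}"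
  define \<Phi> where "\<Phi> \<alpha> x = mono n \<alpha> (\<lambda>j. f j x) * \<phi> x ^ \<alpha> n" for \<alpha> x
  define I where "I = exps M n (p + r) B"
  have bd\<Phi>: "bd M n (p + r) B (\<Phi> \<alpha>)" if "\<alpha> \<in> J" for \<alpha>
  proof -
    have split: "mono n \<alpha> (\<lambda>j. f j x) = (\<Prod>i<M. f i x ^ \<alpha> i) * (\<Prod>i\<in>{M..<n}. f i x ^ \<alpha> i)" for x
      unfolding mono_def using Mn by (simp add: lessThan_atLeast0 prod.atLeastLessThan_concat)
    have 1: "bd M n (\<Sum>i<M. \<alpha> i * 1) (\<Sum>i<M. \<alpha> i * \<delta>) (\<lambda>x. \<Prod>i<M. f i x ^ \<alpha> i)"
      by (intro bd_prod bd_power fz) auto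
    have 2: "bd M n (\<Sum>i\<in>{M..<n}. \<alpha> i * \<delta>) (\<Sum>i\<in>{M..<n}. \<alpha> i * \<delta>) (\<lambda>x. \<Prod>i\<in>{M..<n}. f i x ^ \<alpha> i)"
      by (intro bd_prod bd_power fy) auto
    have 3: "bd M n (\<alpha> n * \<delta>) (\<alpha> n * \<delta>) (\<lambda>x. \<phi> x ^ \<alpha> n)"
      by (intro bd_power \<phi>)
    have s1: "(\<Sum>i<M. \<alpha> i * 1) \<le> p" "(\<Sum>i<M. \<alpha> i * \<delta>) \<le> \<delta> * p" "\<alpha> n * \<delta> \<le> \<delta> * N"
      using that by (auto simp: J_def sum_distrib_right[symmetric])
    have "(\<Sum>i\<in>{M..<n}. \<alpha> i * \<delta>) \<le> (\<Sum>i\<in>{M..<n}. N * \<delta>)"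
      using that by (intro sum_mono mult_right_mono) (auto simp: J_def intro: less_imp_le)
    then have s2: "(\<Sum>i\<in>{M..<n}. \<alpha> i * \<delta>) \<le> \<delta> * e * N"
      by (simp add: e_def mult_ac)
    have r': "r = \<delta> * e * N + \<delta> * N" by (simp add: r_def algebra_simps)
    show ?thesis
      unfolding \<Phi>_def[abs_def] split
      using bd_mult[OF bd_mult[OF 1 2] 3] by (rule bd_weaken) (use s1 s2 in \<open>unfold B_def r', linarith+\<close>)
  qed
  have "\<forall>\<alpha>\<in>J. \<exists>c. \<forall>x. \<Phi> \<alpha> x = (\<Sum>\<kappa>\<in>I. c \<kappa> * mono n \<kappa> x)"
    unfolding I_def using bd_coefficients[OF bd\<Phi> Mn] by blast
  then obtain c where c: "\<And>\<alpha> x. \<alpha> \<in> J \<Longrightarrow> \<Phi> \<alpha> x = (\<Sum>\<kappa>\<in>I. c \<alpha> \<kappa> * mono n \<kappa> x)"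
    by metis
  let ?T = "simplex_exps M p \<times> (PiE {M..<n} (\<lambda>_. {..<N})) \<times> {..N}"
  define h where "h = (\<lambda>(\<sigma>, \<tau>, i) j. if j < M then \<sigma> j else if j < n then \<tau> j else if j = n then i else (0::nat))"
  define h' where "h' \<alpha> = (\<lambda>j. if j < M then \<alpha> j else (0::nat), restrict \<alpha> {M..<n}, \<alpha> n)" for \<alpha>
  have hh: "h (h' \<alpha>) = \<alpha>" if "\<alpha> \<in> J" for \<alpha>
    using that by (auto simp: h_def h'_def J_def fun_eq_iff)
  have h'J: "h' \<alpha> \<in> ?T" if "\<alpha> \<in> J" for \<alpha>
    using that by (auto simp: h'_def J_def simplex_exps_def)
  have h'h: "h' (h t) = t" if "t \<in> ?T" for t
    using that Mn by (force simp: h_def h'_def simplex_exps_def fun_eq_iff PiE_def extensional_def)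
  have hT: "h t \<in> J" if "t \<in> ?T" for t
    using that Mn by (auto simp: h_def J_def simplex_exps_def PiE_def Pi_def)
  have bij: "bij_betw h ?T J"
    by (rule bij_betw_byWitness[where f'=h']) (use hh h'J h'h hT in blast)+
  have finT: "finite ?T"
    using card_simplex_exps by (intro finite_cartesian_product finite_PiE) auto
  have finJ: "finite J"
    using bij finT bij_betw_finite by blast
  have cardJ: "card J = card (simplex_exps M p) * (N ^ e * (N + 1))"
    using bij_betw_same_card[OF bij] by (simp add: card_cartesian_product card_PiE e_def)
  have finI: "finite I" and cardI: "card I \<le> card (simplex_exps M (p + r)) * (B + 1) ^ e"
    using card_exps[OF Mn] by (auto simp: I_def e_def)
  have "B + 1 \<le> \<delta> * p + 2 * (1 * r)" using r1 by (simp add: B_def)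
  also have "\<dots> \<le> \<delta> * p + 2 * (\<delta> * r)"
    using \<delta> by (intro add_left_mono mult_left_mono mult_right_mono) auto
  also have "\<dots> \<le> 2 * \<delta> * (M + 1) * r"
    by (simp add: p_def algebra_simps)
  also have "\<dots> = K * N"
    by (simp add: r_def K_def power2_eq_square algebra_simps)
  finally have B: "B + 1 \<le> K * N" .
  have pos: "card (simplex_exps M p) > 0"
    by (simp add: card_simplex_exps)
  have "real (card I) \<le> real (card (simplex_exps M (p + r))) * real ((B + 1) ^ e)"
    using cardI by (metis of_nat_le_iff of_nat_mult)
  also have "\<dots> \<le> (3 * real (card (simplex_exps M p))) * real ((K * N) ^ e)"
    using card_simplex_exps_growth[OF p_def] power_mono[OF B, of e]
    by (intro mult_mono of_nat_mono) auto
  \<comment> \<open>The factor \<open>3 * K ^ e\<close> is just one more factor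
    \<open>N\<close>.\<close>
  also have "\<dots> = real (card (simplex_exps M p) * (N ^ e * N))"
    by (subst (3) NK) (simp add: power_mult_distrib)
  also have "\<dots> < real (card J)"
    unfolding cardJ using pos N1 by (intro of_nat_less_iff[THEN iffD2] mult_strict_left_mono) auto
  finally have "card I < card J" by simp
  then obtain u where u: "\<exists>\<alpha>\<in>J. u \<alpha> \<noteq> 0" "\<And>\<kappa>. \<kappa> \<in> I \<Longrightarrow> (\<Sum>\<alpha>\<in>J. u \<alpha> * c \<alpha> \<kappa>) = 0"
    using linear_dependence[OF finI finJ, of c] by blast
  have zero: "(\<Sum>\<alpha>\<in>J. u \<alpha> * \<Phi> \<alpha> x) = 0" for x
  proof -
    have "(\<Sum>\<alpha>\<in>J. u \<alpha> * \<Phi> \<alpha> x) = (\<Sum>\<alpha>\<in>J. \<Sum>\<kappa>\<in>I. (u \<alpha> * c \<alpha> \<kappa>) * mono n \<kappa> x)"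
      by (intro sum.cong) (auto simp: c sum_distrib_left mult_ac)
    also have "\<dots> = (\<Sum>\<kappa>\<in>I. (\<Sum>\<alpha>\<in>J. u \<alpha> * c \<alpha> \<kappa>) * mono n \<kappa> x)"
      by (subst sum.swap) (simp add: sum_distrib_right)
    finally show ?thesis by (simp add: u(2))
  qed
  \<comment> \<open>Sorting the relation by powers of \<open>\<phi>\<close> turns it into an
    equation for \<open>\<phi>\<close> whose coefficients are polynomials in the
    \<open>f j\<close>.\<close>
  define g where "g i w = (\<Sum>\<alpha>\<in>{\<alpha>\<in>J. \<alpha> n = i}. u \<alpha> * mono n \<alpha> w)" for i w
  have "polyfun n (g i)" for i
    unfolding g_def[abs_def] by (intro polyfun_sum polyfun_mult polyfun_const polyfun_mono_fun)
  moreover have "\<exists>i\<le>N. \<exists>w. g i w \<noteq> 0"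
  proof -
    obtain \<alpha> where \<alpha>: "\<alpha> \<in> J" "u \<alpha> \<noteq> 0" using u(1) by blast
    have "\<exists>w. g (\<alpha> n) w \<noteq> 0"
      unfolding g_def
    proof (rule mono_independent[where \<alpha>=\<alpha>])
      fix \<kappa> \<kappa>' assume k: "\<kappa> \<in> {\<alpha>' \<in> J. \<alpha>' n = \<alpha> n}" "\<kappa>' \<in> {\<alpha>' \<in> J. \<alpha>' n = \<alpha> n}" "\<And>i. i < n \<Longrightarrow> \<kappa> i = \<kappa>' i"
      show "\<kappa> = \<kappa>'"
      proof
        fix i show "\<kappa> i = \<kappa>' i"
          using k by (cases i n rule: linorder_cases) (auto simp: J_def)
      qed
    qed (use \<alpha> finJ in auto)
    moreover have "\<alpha> n \<le> N" using \<alpha> by (simp add: J_def)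
    ultimately show ?thesis by blast
  qed
  moreover have "(\<Sum>i\<le>N. g i (\<lambda>j. f j x) * \<phi> x ^ i) = 0" for x
  proof -
    have "(\<Sum>i\<le>N. g i (\<lambda>j. f j x) * \<phi> x ^ i) = (\<Sum>i\<le>N. \<Sum>\<alpha>\<in>{\<alpha>\<in>J. \<alpha> n = i}. u \<alpha> * \<Phi> \<alpha> x)"
      by (auto simp: g_def \<Phi>_def sum_distrib_right mult.assoc intro!: sum.cong)
    also have "\<dots> = (\<Sum>\<alpha>\<in>J. u \<alpha> * \<Phi> \<alpha> x)"
      by (rule sum.group) (use finJ in \<open>auto simp: J_def\<close>)
    finally show ?thesis using zero by simp
  qed
  ultimately show ?thesis by blast
qed

section \<open>Generic values and regular branches\<close>

text \<open>Over a point \<open>w\<close> the values of \<open>\<phi>\<close> are roots of the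
  polynomial with coefficients \<open>g i w\<close>, which is nonzero as long as one fixed
  coefficient does not vanish at \<open>w\<close>; this coefficient serves as
  \<open>\<Gamma>\<close>. Values of \<open>\<phi>\<close> are counted, not points of the
  fibre.\<close>

lemma generic_values:
  assumes "M \<le> n" "\<delta> \<ge> 1"
    and "\<And>i. i < M \<Longrightarrow> bd M n 1 \<delta> (f i)"
    and "\<And>i. M \<le> i \<Longrightarrow> i < n \<Longrightarrow> bd M n \<delta> \<delta> (f i)"
    and "bd M n \<delta> \<delta> \<phi>"
  shows "\<exists>\<Gamma>. polyfun n \<Gamma> \<and> (\<exists>w. \<Gamma> w \<noteq> 0) \<and> (\<forall>w. \<Gamma> w \<noteq> 0 \<longrightarrow>
    finite {\<phi> x |x. \<forall>j<n. f j x = w j} \<and>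
    card {\<phi> x |x. \<forall>j<n. f j x = w j} \<le> dep_bound M (n - M) \<delta>)"
proof -
  define N where "N = dep_bound M (n - M) \<delta>"
  obtain g where g: "\<And>i. polyfun n (g i)" "\<exists>i\<le>N. \<exists>w. g i w \<noteq> 0"
    "\<And>x. (\<Sum>i\<le>N. g i (\<lambda>j. f j x) * \<phi> x ^ i) = 0"
    using algebraic_dependence[where f=f and \<phi>=\<phi>, OF assms N_def] by blast
  then obtain k w0 where k: "k \<le> N" "g k w0 \<noteq> 0" by blast
  have "finite {\<phi> x |x. \<forall>j<n. f j x = w j} \<and> card {\<phi> x |x. \<forall>j<n. f j x = w j} \<le> N"
    if w: "g k w \<noteq> 0" for w
  proof -
    define p where "p = (\<Sum>i\<le>N. monom (g i w) i)"
    have "coeff p k = g k w" using k by (simp add: p_def coeff_sum)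
    then have p0: "p \<noteq> 0" using w by auto
    have deg: "degree p \<le> N"
      unfolding p_def by (intro degree_sum_le) (auto intro: order_trans[OF degree_monom_le])
    have sub: "{\<phi> x |x. \<forall>j<n. f j x = w j} \<subseteq> {y. poly p y = 0}"
    proof safe
      fix x assume x: "\<forall>j<n. f j x = w j"
      have "poly p (\<phi> x) = (\<Sum>i\<le>N. g i w * \<phi> x ^ i)"
        by (simp add: p_def poly_sum poly_monom)
      also have "\<dots> = (\<Sum>i\<le>N. g i (\<lambda>j. f j x) * \<phi> x ^ i)"
        using x by (intro sum.cong arg_cong2[where f=times] polyfun_cong[OF g(1)]) auto
      finally show "poly p (\<phi> x) = 0" using g(3) by simp
    qed
    have fin: "finite {y. poly p y = 0}" using poly_roots_finite[OF p0] .
    have "card {\<phi> x |x. \<forall>j<n. f j x = w j} \<le> card {y. poly p y = 0}"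
      by (rule card_mono[OF fin sub])
    also have "\<dots> \<le> degree p" using card_poly_roots_bound[OF p0] .
    finally show ?thesis using deg finite_subset[OF sub fin] by simp
  qed
  then show ?thesis
    using g(1)[of k] k unfolding N_def by blast
qed

text \<open>
  An algebraic substitute for Sard's theorem: applied to the Jacobian determinant, it confines the
  critical values of a polynomial map to a hypersurface.
\<close>

lemma image_of_hypersurface:
  assumes f: "\<And>i. i < n \<Longrightarrow> polyfun n (f i)" and h: "polyfun n h" "h x0 \<noteq> 0"
  shows "\<exists>\<Gamma>. polyfun n \<Gamma> \<and> (\<exists>w. \<Gamma> w \<noteq> 0) \<and> (\<forall>x. h x = 0 \<longrightarrow> \<Gamma> (\<lambda>j. f j x) = 0)"
proof -
  have "\<forall>i. \<exists>B. i < n \<longrightarrow> bd 0 n 0 B (f i)" using polyfun_imp_bd f by blast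
  then obtain B where B: "\<And>i. i < n \<Longrightarrow> bd 0 n 0 (B i) (f i)" by metis
  obtain C where C: "bd 0 n 0 C h" using polyfun_imp_bd h by blast
  define \<delta> where "\<delta> = (\<Sum>i<n. B i) + C + 1"
  have "B i \<le> \<delta>" if "i < n" for i
    using that member_le_sum[of i "{..<n}" B] by (simp add: \<delta>_def)
  then have fd: "bd 0 n \<delta> \<delta> (f i)" if "i < n" for i
    using B[OF that] that by (auto elim: bd_weaken)
  have hd: "bd 0 n \<delta> \<delta> h"
    using C by (rule bd_weaken) (auto simp: \<delta>_def)
  \<comment> \<open>With \<open>M = 0\<close> all coordinates go to the second block: only the
    existence of a relation is at stake.\<close>
  define N where "N = dep_bound 0 (n - 0) \<delta>"
  have "\<exists>g. (\<forall>i. polyfun n (g i)) \<and> (\<exists>i\<le>N. \<exists>w. g i w \<noteq> 0) \<and>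
    (\<forall>x. (\<Sum>i\<le>N. g i (\<lambda>j. f j x) * h x ^ i) = 0)"
    by (rule algebraic_dependence[OF _ _ _ _ _ N_def]) (auto simp: fd hd, simp add: \<delta>_def)
  then obtain g where g: "\<And>i. polyfun n (g i)" "\<exists>i\<le>N. \<exists>w. g i w \<noteq> 0"
    "\<And>x. (\<Sum>i\<le>N. g i (\<lambda>j. f j x) * h x ^ i) = 0"
    by blast
  \<comment> \<open>The first coefficient that is not identically zero. After cancellation of
    \<open>h x ^ k\<close> the relation says that this coefficient, taken at the
    \<open>f j x\<close>, vanishes where \<open>h\<close> does.\<close>
  define k where "k = (LEAST i. \<exists>w. g i w \<noteq> 0)"
  have k1: "\<exists>w. g k w \<noteq> 0"
    unfolding k_def by (rule LeastI_ex) (use g(2) in blast)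
  have k2: "k \<le> N"
    using g(2) Least_le[of "\<lambda>i. \<exists>w. g i w \<noteq> 0"] unfolding k_def by (meson order_trans)
  have less: "g i w = 0" if "i < k" for i w
    using not_less_Least[OF that[unfolded k_def]] by blast
  define q where "q x = (\<Sum>i\<in>{k..N}. g i (\<lambda>j. f j x) * h x ^ (i - k))" for x
  have pf: "polyfun n (\<lambda>x. g i (\<lambda>j. f j x))" for i
    using g(1) f by (rule polyfun_compose)
  have q: "polyfun n q"
    unfolding q_def[abs_def] using pf h by (intro polyfun_sum polyfun_mult polyfun_power)
  have qh: "h x ^ k * q x = 0" for x
  proof -
    have "0 = (\<Sum>i\<le>N. g i (\<lambda>j. f j x) * h x ^ i)" using g(3) by simp
    also have "\<dots> = (\<Sum>i\<in>{k..N}. g i (\<lambda>j. f j x) * h x ^ i)"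
      by (rule sum.mono_neutral_right) (auto simp: less)
    also have "\<dots> = h x ^ k * q x"
      unfolding q_def sum_distrib_left
      by (intro sum.cong refl) (auto simp: power_add[symmetric] mult.left_commute)
    finally show ?thesis by simp
  qed
  have q0: "q x = 0" for x
  proof (rule ccontr)
    assume "q x \<noteq> 0"
    moreover have "polyfun n (\<lambda>x. h x ^ k)" "h x0 ^ k \<noteq> 0" using h by (auto intro: polyfun_power)
    ultimately have "\<exists>z. h z ^ k * q z \<noteq> 0"
      using polyfun_nonzero_mult[of n "\<lambda>x. h x ^ k" q] q by blast
    then show False using qh by blast
  qed
  have "g k (\<lambda>j. f j x) = 0" if "h x = 0" for x
  proof -
    have "q x = (\<Sum>i\<in>{k..N}. if i = k then g i (\<lambda>j. f j x) else 0)"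
      unfolding q_def using that by (intro sum.cong) auto
    also have "\<dots> = g k (\<lambda>j. f j x)" using k2 by simp
    finally show ?thesis using q0 by simp
  qed
  then show ?thesis using g(1) k1 by blast
qed

text \<open>\<open>h\<close> is the determinant, used through two consequences: where it does not
  vanish the adjugate yields a two-sided inverse, and where it vanishes there is a kernel
  vector.\<close>

lemma polyfun_det:
  fixes n :: nat
  assumes a: "\<And>i j. i < n \<Longrightarrow> j < n \<Longrightarrow> polyfun m (a i j)"
  shows "\<exists>h. polyfun m h \<and>
    (\<forall>x. h x \<noteq> 0 \<longrightarrow> (\<exists>B. \<forall>i<n. \<forall>j<n.
       (\<Sum>k<n. B i k * a k j x) = (if i = j then 1 else 0) \<and>
       (\<Sum>k<n. a i k x * B k j) = (if i = j then 1 else 0))) \<and>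
    (\<forall>x. h x = 0 \<longrightarrow> (\<exists>u. (\<exists>i<n. u i \<noteq> 0) \<and> (\<forall>i<n. (\<Sum>j<n. a i j x * u j) = 0)))"
proof -
  define A where "A x = mat n n (\<lambda>(i,j). a i j x)" for x
  have A: "A x \<in> carrier_mat n n" for x by (simp add: A_def)
  have "polyfun m (\<lambda>x. det (A x))"
    unfolding det_def A_def using a
    by (auto intro!: polyfun_sum polyfun_mult polyfun_const polyfun_prod)
  moreover have "\<exists>B. \<forall>i<n. \<forall>j<n.
       (\<Sum>k<n. B i k * a k j x) = (if i = j then 1 else 0) \<and>
       (\<Sum>k<n. a i k x * B k j) = (if i = j then 1 else 0)" if d: "det (A x) \<noteq> 0" for x
  proof -
    define C where "C = adj_mat (A x)"
    have C: "C \<in> carrier_mat n n" "A x * C = det (A x) \<cdot>\<^sub>m 1\<^sub>m n" "C * A x = det (A x) \<cdot>\<^sub>m 1\<^sub>m n"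
      using adj_mat[OF A] by (auto simp: C_def)
    define B where "B i j = C $$ (i, j) / det (A x)" for i j
    have "(\<Sum>k<n. B i k * a k j x) = (if i = j then 1 else 0) \<and>
       (\<Sum>k<n. a i k x * B k j) = (if i = j then 1 else 0)" if ij: "i < n" "j < n" for i j
    proof -
      have "(C * A x) $$ (i, j) = (\<Sum>k<n. C $$ (i, k) * a k j x)"
        using ij C(1) by (simp add: A_def scalar_prod_def lessThan_atLeast0)
      moreover have "(A x * C) $$ (i, j) = (\<Sum>k<n. a i k x * C $$ (k, j))"
        using ij C(1) by (simp add: A_def scalar_prod_def lessThan_atLeast0)
      ultimately show ?thesis
        using C(2,3) ij d
        by (auto simp: B_def sum_divide_distrib[symmetric])
    qed
    then show ?thesis by blast
  qed
  moreover have "\<exists>u. (\<exists>i<n. u i \<noteq> 0) \<and> (\<forall>i<n. (\<Sum>j<n. a i j x * u j) = 0)" if d0: "det (A x) = 0" for x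
  proof -
    obtain v where v: "v \<in> carrier_vec n" "v \<noteq> 0\<^sub>v n" "A x *\<^sub>v v = 0\<^sub>v n"
      using d0 det_0_iff_vec_prod_zero_field[OF A, of x] by auto
    have "\<exists>i<n. vec_index v i \<noteq> 0"
    proof (rule ccontr)
      assume "\<not> (\<exists>i<n. vec_index v i \<noteq> 0)"
      then have "v = 0\<^sub>v n" using v(1) by (intro eq_vecI) auto
      then show False using v(2) by simp
    qed
    moreover have "(\<Sum>j<n. a i j x * vec_index v j) = 0" if "i < n" for i
    proof -
      have "vec_index (A x *\<^sub>v v) i = (\<Sum>j<n. a i j x * vec_index v j)"
        using that v(1) by (simp add: A_def scalar_prod_def lessThan_atLeast0)
      then show ?thesis using v(3) that by simp
    qed
    ultimately show ?thesis by (intro exI[of _ "\<lambda>i. vec_index v i"]) auto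
  qed
  ultimately show ?thesis by (intro exI[of _ "\<lambda>x. det (A x)"]) blast
qed

section \<open>Local inverses at regular points\<close>

lemma compact_box: "compact {x::nat \<Rightarrow> real. (\<forall>i<n. \<bar>x i\<bar> \<le> R) \<and> (\<forall>i\<ge>n. x i = 0)}"
proof -
  define S where "S i = (if i < n then {-R..R} else {0::real})" for i
  have "compactin (product_topology (\<lambda>_. euclidean) UNIV) (PiE UNIV S)"
    by (subst compactin_PiE) (auto simp: S_def compactin_euclidean_iff)
  then have "compact (PiE UNIV S)"
    by (simp add: euclidean_product_topology compactin_euclidean_iff)
  also have "PiE UNIV S = {x. (\<forall>i<n. \<bar>x i\<bar> \<le> R) \<and> (\<forall>i\<ge>n. x i = 0)}"
  proof -
    have "y \<in> S i \<longleftrightarrow> (i < n \<longrightarrow> \<bar>y\<bar> \<le> R) \<and> (n \<le> i \<longrightarrow> y = 0)" for y i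
      by (auto simp: S_def abs_le_iff)
    then show ?thesis by (simp add: PiE_UNIV_domain Pi_def) blast
  qed
  finally show ?thesis .
qed

lemma continuous_on_coord: "continuous_on S (\<lambda>x::nat \<Rightarrow> real. x i)"
  by (metis continuous_on_product_coordinates continuous_on_subset top_greatest)

text \<open>
  A path of preimages of a segment near a regular point. The preimages are found by minimising the
  distance to the target, since a Newton step halves it.
\<close>

lemma regular_branch:
  assumes f: "\<And>i. i < n \<Longrightarrow> polyfun n (f i)"
    and BA: "\<And>i j. i < n \<Longrightarrow> j < n \<Longrightarrow> (\<Sum>k<n. B i k * pd j (f k) x0) = (if i = j then 1 else 0)"
    and AB: "\<And>i j. i < n \<Longrightarrow> j < n \<Longrightarrow> (\<Sum>k<n. pd k (f i) x0 * B k j) = (if i = j then 1 else 0)"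
    and x0: "\<And>i. i \<ge> n \<Longrightarrow> x0 i = 0"
  shows "\<exists>\<delta>>0. \<exists>K\<ge>0. \<exists>X. X 0 = x0 \<and>
    (\<forall>t. \<bar>t\<bar> \<le> \<delta> \<longrightarrow> (\<forall>i\<ge>n. X t i = 0) \<and> (\<forall>i<n. f i (X t) = f i x0 + t * e i)) \<and>
    (\<forall>s t. \<bar>s\<bar> \<le> \<delta> \<longrightarrow> \<bar>t\<bar> \<le> \<delta> \<longrightarrow> (\<Sum>i<n. \<bar>X s i - X t i\<bar>) \<le> K * \<bar>s - t\<bar>)"
proof -
  define D where "D x y = (\<Sum>i<n. \<bar>x i - y i\<bar>)" for x y :: "nat \<Rightarrow> real"
  have D: "D x y \<ge> 0" "D x y = D y x" "D x z \<le> D x y + D y z" for x y z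
    unfolding D_def by (auto simp: sum_nonneg abs_minus_commute sum.distrib[symmetric] intro!: sum_mono)
  \<comment> \<open>\<open>f\<close> is multiplied by the inverse Jacobian matrix, so that the
    derivative at \<open>x0\<close> becomes the identity.\<close>
  define \<Psi> where "\<Psi> i x = (\<Sum>k<n. B i k * (f k x - f k x0))" for i x
  have \<Psi>: "polyfun n (\<Psi> i)" if "i < n" for i
    unfolding \<Psi>_def[abs_def] using f by (intro polyfun_intros) auto
  have pd\<Psi>: "pd j (\<Psi> i) x0 = (if i = j then 1 else 0)" if "i < n" "j < n" for i j
  proof -
    have "pd j (\<Psi> i) x0 = (\<Sum>k<n. pd j (\<lambda>x. B i k * (f k x - f k x0)) x0)"
      unfolding \<Psi>_def[abs_def] using f by (intro pd_sum[where n=n] polyfun_intros) auto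
    also have "\<dots> = (\<Sum>k<n. B i k * pd j (f k) x0)"
      using f by (intro sum.cong refl)
        (subst pd_cmult[where n=n], auto intro!: polyfun_intros simp: pd_diff[where n=n] polyfun_const pd_const)
    finally show ?thesis using BA that by simp
  qed
  have \<Psi>0: "\<Psi> i x0 = 0" for i by (simp add: \<Psi>_def)
  define R where "R = (\<Sum>i<n. \<bar>x0 i\<bar>) + 1"
  have R: "\<bar>x i\<bar> \<le> R" if "D x x0 \<le> 1" "i < n" for x i
  proof -
    have "\<bar>x i - x0 i\<bar> \<le> D x x0" "\<bar>x0 i\<bar> \<le> (\<Sum>i<n. \<bar>x0 i\<bar>)"
      unfolding D_def using that(2) by (auto intro!: member_le_sum[of i "{..<n}" "\<lambda>i. \<bar>x i - x0 i\<bar>"] member_le_sum)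
    then show ?thesis using that(1) by (simp add: R_def)
  qed
  have "\<forall>i j. \<exists>C\<ge>0. i < n \<longrightarrow> (\<forall>x y. (\<forall>i<n. \<bar>x i\<bar> \<le> R) \<longrightarrow> (\<forall>i<n. \<bar>y i\<bar> \<le> R) \<longrightarrow>
      \<bar>pd j (\<Psi> i) x - pd j (\<Psi> i) y\<bar> \<le> C * D x y)"
  proof (intro allI)
    fix i j
    show "\<exists>C\<ge>0. i < n \<longrightarrow> (\<forall>x y. (\<forall>i<n. \<bar>x i\<bar> \<le> R) \<longrightarrow> (\<forall>i<n. \<bar>y i\<bar> \<le> R) \<longrightarrow>
        \<bar>pd j (\<Psi> i) x - pd j (\<Psi> i) y\<bar> \<le> C * D x y)"
    proof (cases "i < n")
      case True
      then show ?thesis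
        unfolding D_def using polyfun_lipschitz[OF polyfun_pd[OF \<Psi>[OF True]]] by simp
    qed auto
  qed
  then obtain C where C: "\<And>i j. C i j \<ge> 0" "\<And>i j x y. i < n \<Longrightarrow> (\<forall>i<n. \<bar>x i\<bar> \<le> R) \<Longrightarrow> (\<forall>i<n. \<bar>y i\<bar> \<le> R) \<Longrightarrow>
      \<bar>pd j (\<Psi> i) x - pd j (\<Psi> i) y\<bar> \<le> C i j * D x y"
    by metis
  define K where "K = (\<Sum>i<n. \<Sum>j<n. C i j) + 1"
  have K: "K \<ge> 1" using C(1) by (simp add: K_def sum_nonneg)
  \<comment> \<open>On the ball of this radius \<open>\<Psi>\<close> minus the identity has
    Lipschitz constant 1/2 in the sum norm \<open>D\<close>.\<close>
  define r where "r = 1 / (2 * K)"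
  have r: "0 < r" "r \<le> 1" using K by (auto simp: r_def field_simps)
  have est: "(\<Sum>i<n. \<bar>\<Psi> i x - \<Psi> i y - (x i - y i)\<bar>) \<le> D x y / 2"
    if x: "D x x0 \<le> r" and y: "D y x0 \<le> r" for x y
  proof -
    have "\<bar>\<Psi> i x - \<Psi> i y - (x i - y i)\<bar> \<le> (\<Sum>j<n. C i j * r * D x y)" if i: "i < n" for i
    proof -
      obtain t where t: "0 < t" "t < 1"
        "\<Psi> i x - \<Psi> i y = (\<Sum>j<n. pd j (\<Psi> i) (\<lambda>i. y i + t * (x i - y i)) * (x j - y j))"
        using polyfun_mvt[OF \<Psi>[OF i]] by blast
      let ?z = "\<lambda>i. y i + t * (x i - y i)"
      have "D ?z x0 \<le> (1 - t) * D y x0 + t * D x x0"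
      proof -
        have "\<bar>?z i - x0 i\<bar> \<le> (1 - t) * \<bar>y i - x0 i\<bar> + t * \<bar>x i - x0 i\<bar>" for i
        proof -
          have "?z i - x0 i = (1 - t) * (y i - x0 i) + t * (x i - x0 i)" by (simp add: algebra_simps)
          then have "\<bar>?z i - x0 i\<bar> \<le> \<bar>(1 - t) * (y i - x0 i)\<bar> + \<bar>t * (x i - x0 i)\<bar>"
            using abs_triangle_ineq by metis
          then show ?thesis using t by (simp add: abs_mult)
        qed
        then show ?thesis
          unfolding D_def sum_distrib_left sum.distrib[symmetric] by (intro sum_mono)
      qed
      also have "\<dots> \<le> (1 - t) * r + t * r"
        using t x y by (intro add_mono mult_left_mono) auto
      finally have z: "D ?z x0 \<le> r" by (simp add: algebra_simps)
      have pdz: "\<bar>pd j (\<Psi> i) ?z - (if i = j then 1 else 0)\<bar> \<le> C i j * r" if j: "j < n" for j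
      proof -
        have "\<bar>pd j (\<Psi> i) ?z - pd j (\<Psi> i) x0\<bar> \<le> C i j * D ?z x0"
          using z r D(1) by (intro C(2) i) (auto intro!: R simp: D_def)
        also have "\<dots> \<le> C i j * r" using z C(1) by (intro mult_left_mono) auto
        finally show ?thesis using pd\<Psi> i j by simp
      qed
      have "x i - y i = (\<Sum>j<n. (if i = j then 1 else 0) * (x j - y j))"
        using i by (simp add: if_distrib[of "\<lambda>c. c * _"] cong: if_cong)
      then have eq: "\<Psi> i x - \<Psi> i y - (x i - y i) =
          (\<Sum>j<n. (pd j (\<Psi> i) ?z - (if i = j then 1 else 0)) * (x j - y j))"
        by (simp only: t(3) sum_subtractf[symmetric] left_diff_distrib)
      have "\<bar>\<Psi> i x - \<Psi> i y - (x i - y i)\<bar> \<le>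
          (\<Sum>j<n. \<bar>(pd j (\<Psi> i) ?z - (if i = j then 1 else 0)) * (x j - y j)\<bar>)"
        unfolding eq by (rule sum_abs)
      also have "\<dots> \<le> (\<Sum>j<n. C i j * r * D x y)"
      proof (rule sum_mono)
        fix j assume j: "j \<in> {..<n}"
        then have "\<bar>x j - y j\<bar> \<le> D x y"
          unfolding D_def by (intro member_le_sum[of j "{..<n}" "\<lambda>j. \<bar>x j - y j\<bar>"]) auto
        then show "\<bar>(pd j (\<Psi> i) ?z - (if i = j then 1 else 0)) * (x j - y j)\<bar> \<le> C i j * r * D x y"
          unfolding abs_mult using pdz[of j] j C(1) r by (intro mult_mono) auto
      qed
      finally show ?thesis .
    qed
    then have "(\<Sum>i<n. \<bar>\<Psi> i x - \<Psi> i y - (x i - y i)\<bar>) \<le> (\<Sum>i<n. \<Sum>j<n. C i j * r * D x y)"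
      by (intro sum_mono) auto
    also have "\<dots> = (K - 1) * r * D x y"
      by (simp add: K_def sum_distrib_right)
    also have "\<dots> \<le> K * r * D x y"
      using r D(1) by (intro mult_right_mono) auto
    also have "\<dots> = D x y / 2" using K by (simp add: r_def)
    finally show ?thesis .
  qed
  have inj: "D x y \<le> 2 * (\<Sum>i<n. \<bar>\<Psi> i x - \<Psi> i y\<bar>)" if "D x x0 \<le> r" "D y x0 \<le> r" for x y
  proof -
    have "D x y \<le> (\<Sum>i<n. \<bar>\<Psi> i x - \<Psi> i y\<bar> + \<bar>\<Psi> i x - \<Psi> i y - (x i - y i)\<bar>)"
      unfolding D_def by (intro sum_mono) auto
    then show ?thesis using est[OF that] by (simp add: sum.distrib)
  qed
  define b where "b i = (\<Sum>k<n. B i k * e k)" for i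
  define \<beta> where "\<beta> = (\<Sum>i<n. \<bar>b i\<bar>)"
  have \<beta>: "\<beta> \<ge> 0" by (simp add: \<beta>_def sum_nonneg)
  \<comment> \<open>A Newton step from the ball then stays in the ball: its distance from
    \<open>x0\<close> is at most \<open>r / 2\<close> plus
    \<open>\<delta> * \<beta>\<close>.\<close>
  define \<delta> where "\<delta> = r / (2 * (\<beta> + 1))"
  have \<delta>: "\<delta> > 0" using r \<beta> by (simp add: \<delta>_def)
  define S where "S = {x. (\<forall>i\<ge>n. x i = 0) \<and> D x x0 \<le> r}"
  have "S = {x. (\<forall>i<n. \<bar>x i\<bar> \<le> R) \<and> (\<forall>i\<ge>n. x i = 0)} \<inter> {x. D x x0 \<le> r}"
    using R r by (force simp: S_def)
  moreover have "closed {x. D x x0 \<le> r}"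
    unfolding D_def by (intro closed_Collect_le continuous_intros continuous_on_coord)
  ultimately have compS: "compact S"
    using compact_Int_closed[OF compact_box[of n R], of "{x. D x x0 \<le> r}"] by simp
  have x0S: "x0 \<in> S" using x0 r by (simp add: S_def D_def)
  have ex: "\<exists>x\<in>S. \<forall>i<n. \<Psi> i x = t * b i" if t: "\<bar>t\<bar> \<le> \<delta>" for t
  proof -
    define \<phi> where "\<phi> x = (\<Sum>i<n. \<bar>\<Psi> i x - t * b i\<bar>)" for x
    have "continuous_on S \<phi>"
      unfolding \<phi>_def[abs_def] by (intro continuous_intros continuous_on_polyfun[OF \<Psi>]) auto
    then obtain x where x: "x \<in> S" "\<And>y. y \<in> S \<Longrightarrow> \<phi> x \<le> \<phi> y"
      using continuous_attains_inf[OF compS] x0S by blast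
    \<comment> \<open>The Newton step for the target \<open>t * b\<close>, with the identity in
      place of the derivative.\<close>
    define z where "z i = (if i < n then x i - (\<Psi> i x - t * b i) else 0)" for i
    have "D z x0 \<le> (\<Sum>i<n. \<bar>\<Psi> i x - \<Psi> i x0 - (x i - x0 i)\<bar> + \<bar>t\<bar> * \<bar>b i\<bar>)"
      unfolding D_def by (intro sum_mono) (auto simp: z_def \<Psi>0 abs_mult[symmetric])
    also have "\<dots> \<le> D x x0 / 2 + \<bar>t\<bar> * \<beta>"
      using est[of x x0] x(1) x0S unfolding sum.distrib \<beta>_def sum_distrib_left by (simp add: S_def)
    also have "\<dots> \<le> r / 2 + \<delta> * (\<beta> + 1)"
      using x(1) t \<beta> \<delta> by (intro add_mono mult_mono) (auto simp: S_def)
    also have "\<dots> = r" using \<beta> by (simp add: \<delta>_def field_simps)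
    finally have zS: "z \<in> S" by (simp add: S_def z_def)
    have "\<phi> z = (\<Sum>i<n. \<bar>\<Psi> i z - \<Psi> i x - (z i - x i)\<bar>)"
      unfolding \<phi>_def by (intro sum.cong) (auto simp: z_def)
    also have "\<dots> \<le> D z x / 2"
      using zS x(1) by (intro est) (auto simp: S_def)
    also have "D z x = \<phi> x"
      unfolding D_def \<phi>_def by (intro sum.cong) (auto simp: z_def)
    finally have "\<phi> x \<le> \<phi> x / 2" using x(2)[OF zS] by linarith
    then have "\<phi> x \<le> 0" by linarith
    then have "\<forall>i\<in>{..<n}. \<bar>\<Psi> i x - t * b i\<bar> = 0"
      unfolding \<phi>_def by (subst sum_nonneg_eq_0_iff[symmetric]) (auto intro: antisym sum_nonneg)
    then show ?thesis using x(1) by (intro bexI[of _ x]) auto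
  qed
  define X where "X t = (SOME x. x \<in> S \<and> (\<forall>i<n. \<Psi> i x = t * b i))" for t
  have X: "X t \<in> S" "\<And>i. i < n \<Longrightarrow> \<Psi> i (X t) = t * b i" if "\<bar>t\<bar> \<le> \<delta>" for t
  proof -
    have "X t \<in> S \<and> (\<forall>i<n. \<Psi> i (X t) = t * b i)"
      unfolding X_def by (rule someI_ex[of "\<lambda>x. x \<in> S \<and> (\<forall>i<n. \<Psi> i x = t * b i)"]) (use ex[OF that] in blast)
    then show "X t \<in> S" "\<And>i. i < n \<Longrightarrow> \<Psi> i (X t) = t * b i" by auto
  qed
  have lip: "D (X s) (X t) \<le> 2 * \<beta> * \<bar>s - t\<bar>" if "\<bar>s\<bar> \<le> \<delta>" "\<bar>t\<bar> \<le> \<delta>" for s t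
  proof -
    have "D (X s) (X t) \<le> 2 * (\<Sum>i<n. \<bar>\<Psi> i (X s) - \<Psi> i (X t)\<bar>)"
      using X(1) that by (intro inj) (auto simp: S_def)
    also have "(\<Sum>i<n. \<bar>\<Psi> i (X s) - \<Psi> i (X t)\<bar>) = (\<Sum>i<n. \<bar>s - t\<bar> * \<bar>b i\<bar>)"
      using X(2) that by (intro sum.cong) (auto simp: left_diff_distrib[symmetric] abs_mult)
    finally show ?thesis by (simp add: \<beta>_def sum_distrib_left sum_distrib_right mult_ac)
  qed
  have "D (X 0) x0 \<le> 2 * (\<Sum>i<n. \<bar>\<Psi> i (X 0) - \<Psi> i x0\<bar>)"
    using X(1)[of 0] x0S \<delta> by (intro inj) (auto simp: S_def)
  also have "\<dots> = 0" using X(2)[of 0] \<delta> by (simp add: \<Psi>0)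
  finally have D0: "D (X 0) x0 = 0" using D(1)[of "X 0" x0] by linarith
  have "X 0 = x0"
  proof
    fix i
    have "\<forall>i\<in>{..<n}. \<bar>X 0 i - x0 i\<bar> = 0"
      using D0 unfolding D_def by (subst sum_nonneg_eq_0_iff[symmetric]) auto
    then show "X 0 i = x0 i"
      using x0 X(1)[of 0] \<delta> by (cases "i < n") (auto simp: S_def)
  qed
  moreover have "f i (X t) = f i x0 + t * e i" if t: "\<bar>t\<bar> \<le> \<delta>" and i: "i < n" for i t
  proof -
    \<comment> \<open>That \<open>B\<close> is also a right inverse serves to get back from
      \<open>\<Psi>\<close> to \<open>f\<close>.\<close>
    have inv: "(\<Sum>k<n. pd k (f i) x0 * (\<Sum>l<n. B k l * c l)) = c i" for c
    proof -
      have "(\<Sum>k<n. pd k (f i) x0 * (\<Sum>l<n. B k l * c l)) = (\<Sum>l<n. (\<Sum>k<n. pd k (f i) x0 * B k l) * c l)"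
        by (simp add: sum_distrib_left sum_distrib_right mult.assoc) (rule sum.swap)
      also have "\<dots> = (\<Sum>l<n. (if i = l then 1 else 0) * c l)"
        using AB i by (intro sum.cong) auto
      also have "\<dots> = c i" using i by (simp add: if_distrib[of "\<lambda>c. c * _"] cong: if_cong)
      finally show ?thesis .
    qed
    have "f i (X t) - f i x0 = (\<Sum>k<n. pd k (f i) x0 * \<Psi> k (X t))"
      unfolding \<Psi>_def by (rule inv[symmetric])
    also have "\<dots> = (\<Sum>k<n. pd k (f i) x0 * (t * b k))"
      using X(2) t by (intro sum.cong) auto
    also have "\<dots> = t * (\<Sum>k<n. pd k (f i) x0 * b k)"
      by (simp add: sum_distrib_left mult_ac)
    also have "(\<Sum>k<n. pd k (f i) x0 * b k) = e i" unfolding b_def by (rule inv)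
    finally show ?thesis by simp
  qed
  moreover have "\<forall>i\<ge>n. X t i = 0" if "\<bar>t\<bar> \<le> \<delta>" for t
    using X(1)[OF that] by (simp add: S_def)
  ultimately show ?thesis
    using \<delta> \<beta> lip unfolding D_def
    by (intro exI[of _ \<delta>] conjI exI[of _ "2 * \<beta>"] exI[of _ X]) auto
qed

section \<open>Generic parameters of the penalty function\<close>

lemma bd_extend: "bd m m A B f \<Longrightarrow> m \<le> M \<Longrightarrow> bd M n A B f"
  by (induction rule: bd.induct) (auto intro: bd.intros)

text \<open>For \<open>A = 0\<close> the number \<open>A - 1\<close> is again 0, and the induction
  needs more: in the derivative of \<open>x j * f x\<close> with \<open>f\<close> of degree 0 in z,
  the summand \<open>x j * pd i f x\<close> has to vanish. The first conjunct records this.\<close>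

lemma bd_pd:
  assumes "bd M n A B f" "M \<le> n" "i < M"
  shows "(A = 0 \<longrightarrow> pd i f = (\<lambda>_. 0)) \<and> bd M n (A - 1) B (pd i f)"
  using assms
proof (induction rule: bd.induct)
  case (bd_const A B c)
  have "pd i (\<lambda>_. c) = (\<lambda>_. 0)" by (auto simp: pd_const)
  then show ?case by (simp add: bd.bd_const)
next
  case (bd_add A B f g)
  then have "pd i (\<lambda>x. f x + g x) = (\<lambda>x. pd i f x + pd i g x)"
    using bd_imp_polyfun pd_add by blast
  then show ?case using bd_add by (auto intro: bd.bd_add)
next
  case (bd_mult_z j A B f)
  have eq: "pd i (\<lambda>x. x j * f x) = (\<lambda>x. (if i = j then 1 else 0) * f x + x j * pd i f x)"
  proof
    fix x
    have "pd i (\<lambda>x. x j * f x) x = pd i (\<lambda>x. x j) x * f x + x j * pd i f x"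
      using bd_mult_z bd_imp_polyfun by (intro pd_mult[where n=n] polyfun_var) auto
    then show "pd i (\<lambda>x. x j * f x) x = (if i = j then 1 else 0) * f x + x j * pd i f x"
      by (simp add: pd_var)
  qed
  have "bd M n A B (\<lambda>x. x j * pd i f x)"
  proof (cases A)
    case 0
    then have "(\<lambda>x. x j * pd i f x) = (\<lambda>_. 0)" using bd_mult_z by simp
    then show ?thesis by (simp add: bd_const)
  next
    case (Suc A')
    then show ?thesis using bd_mult_z by (auto intro: bd.bd_mult_z)
  qed
  then show ?case
    unfolding eq using bd_mult_z by (auto intro: bd.bd_add bd_cmult)
next
  case (bd_mult_y j A B f)
  have eq: "pd i (\<lambda>x. x j * f x) = (\<lambda>x. x j * pd i f x)"
  proof
    fix x
    have "pd i (\<lambda>x. x j * f x) x = pd i (\<lambda>x. x j) x * f x + x j * pd i f x"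
      using bd_mult_y bd_imp_polyfun by (intro pd_mult[where n=n] polyfun_var) auto
    then show "pd i (\<lambda>x. x j * f x) x = x j * pd i f x"
      using bd_mult_y by (simp add: pd_var)
  qed
  show ?case unfolding eq using bd_mult_y by (auto intro: bd.bd_mult_y)
qed

text \<open>Two distinct points agree under the form with coefficients 1, t, t^2, ... only when t is
  a root of a nonzero polynomial of degree at most \<open>m\<close>, and there are at most
  \<open>card S ^ 2\<close> pairs. This converts a bound for the number of values of a function into
  a bound for a number of points.\<close>

lemma moment_separation:
  fixes S :: "(nat \<Rightarrow> real) set"
  assumes "finite S" "\<And>x i. x \<in> S \<Longrightarrow> i \<ge> m \<Longrightarrow> x i = 0" "card S ^ 2 * m < T"
  shows "\<exists>t<T. inj_on (\<lambda>x. \<Sum>i<m. real t ^ i * x i) S"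
proof -
  define P where "P p q = (\<Sum>i<m. monom (p i - q i) i)" for p q :: "nat \<Rightarrow> real"
  have P: "poly (P p q) t = (\<Sum>i<m. t ^ i * p i) - (\<Sum>i<m. t ^ i * q i)" for p q t
    by (simp add: P_def poly_sum poly_monom algebra_simps sum_subtractf)
  define Z where "Z z = {t::nat. poly (P (fst z) (snd z)) (real t) = 0}" for z
  have Z: "finite (Z (p, q)) \<and> card (Z (p, q)) \<le> m" if "p \<in> S" "q \<in> S" "p \<noteq> q" for p q
  proof -
    obtain i where i: "p i \<noteq> q i" using \<open>p \<noteq> q\<close> by blast
    have "i < m"
    proof (rule ccontr)
      assume "\<not> i < m"
      then have "p i = 0" "q i = 0" using assms(2) \<open>p \<in> S\<close> \<open>q \<in> S\<close> by auto
      then show False using i by simp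
    qed
    then have "coeff (P p q) i = p i - q i" by (simp add: P_def coeff_sum)
    then have nz: "P p q \<noteq> 0" using i by auto
    have "degree (P p q) \<le> m"
      unfolding P_def by (intro degree_sum_le) (auto intro: order_trans[OF degree_monom_le])
    then have c: "card {t. poly (P p q) t = 0} \<le> m"
      using card_poly_roots_bound[OF nz] by linarith
    have inj: "inj_on real (Z (p, q))" and sub: "real ` Z (p, q) \<subseteq> {t. poly (P p q) t = 0}"
      by (auto simp: Z_def)
    have fin: "finite {t. poly (P p q) t = 0}" using poly_roots_finite[OF nz] .
    show ?thesis
      using card_inj_on_le[OF inj sub fin] inj_on_finite[OF inj sub fin] c by simp
  qed
  define I where "I = {z \<in> S \<times> S. fst z \<noteq> snd z}"
  have I: "finite I" "card I \<le> card S ^ 2"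
    using assms(1) card_mono[of "S \<times> S" I] by (auto simp: I_def card_cartesian_product power2_eq_square)
  have "card (\<Union>z\<in>I. Z z) \<le> (\<Sum>z\<in>I. card (Z z))"
    by (rule card_UN_le[OF I(1)])
  also have "\<dots> \<le> (\<Sum>z\<in>I. m)"
    using Z by (intro sum_mono) (auto simp: I_def)
  also have "\<dots> \<le> card S ^ 2 * m"
    using I(2) by simp
  finally have c: "card (\<Union>z\<in>I. Z z) < T" using assms(3) by simp
  have "finite (\<Union>z\<in>I. Z z)" using I(1) Z by (auto simp: I_def)
  then have "\<not> {..<T} \<subseteq> (\<Union>z\<in>I. Z z)"
    using c card_mono[of "\<Union>z\<in>I. Z z" "{..<T}"] by auto
  then obtain t where t: "t < T" "t \<notin> (\<Union>z\<in>I. Z z)" by auto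
  have "inj_on (\<lambda>x. \<Sum>i<m. real t ^ i * x i) S"
  proof (rule inj_onI, rule ccontr)
    fix x y assume "x \<in> S" "y \<in> S" "(\<Sum>i<m. real t ^ i * x i) = (\<Sum>i<m. real t ^ i * y i)" "x \<noteq> y"
    then have "(x, y) \<in> I" "t \<in> Z (x, y)" by (auto simp: I_def Z_def P)
    then show False using t by blast
  qed
  then show ?thesis using t by blast
qed

section \<open>The penalty function and its derivatives\<close>

locale penalty =
  fixes m d :: nat and h :: "nat \<Rightarrow> (nat \<Rightarrow> real) \<Rightarrow> real" and eps \<theta> :: real
  assumes bd_h: "l < d \<Longrightarrow> bd m m 2 0 (h l)"
    and eps: "eps > 0" and \<theta>: "\<theta> > 0"
begin

definition lam :: "(nat \<Rightarrow> real) \<Rightarrow> nat \<Rightarrow> (nat \<Rightarrow> real) \<Rightarrow> real" where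
  "lam \<tau> l x = (h l x - \<tau> l) / eps"

definition F :: "(nat \<Rightarrow> real) \<Rightarrow> (nat \<Rightarrow> real) \<Rightarrow> (nat \<Rightarrow> real) \<Rightarrow> real" where
  "F a \<tau> x = \<theta> / 2 * (\<Sum>i<m. (x i - a i)\<^sup>2) + eps / 2 * (\<Sum>l<d. (lam \<tau> l x)\<^sup>2)"

definition grad :: "(nat \<Rightarrow> real) \<Rightarrow> (nat \<Rightarrow> real) \<Rightarrow> nat \<Rightarrow> (nat \<Rightarrow> real) \<Rightarrow> real" where
  "grad a \<tau> i x = \<theta> * (x i - a i) + (\<Sum>l<d. lam \<tau> l x * pd i (h l) x)"

text \<open>The squared slope of \<open>F\<close>, perturbed by \<open>\<sigma>\<close>. The second
  family of multipliers in \<open>generic_polar\<close> satisfies equations with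
  \<open>\<sigma>\<close> as right-hand side, so varying \<open>\<sigma>\<close> makes these
  equations generic.\<close>

definition E :: "(nat \<Rightarrow> real) \<Rightarrow> (nat \<Rightarrow> real) \<Rightarrow> (nat \<Rightarrow> real) \<Rightarrow> (nat \<Rightarrow> real) \<Rightarrow> real" where
  "E a \<tau> \<sigma> x = (\<Sum>i<m. (grad a \<tau> i x)\<^sup>2) + 2 * (\<Sum>l<d. \<sigma> l * lam \<tau> l x)"

lemma polyfun_h: "l < d \<Longrightarrow> polyfun m (h l)"
  using bd_h bd_imp_polyfun by blast

lemma polyfun_lam: "l < d \<Longrightarrow> polyfun m (lam \<tau> l)"
  unfolding lam_def[abs_def] by (intro polyfun_intros polyfun_h)

lemma polyfun_F: "polyfun m (F a \<tau>)"
  unfolding F_def[abs_def] by (intro polyfun_intros polyfun_lam) auto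

lemma polyfun_grad: "i < m \<Longrightarrow> polyfun m (grad a \<tau> i)"
  unfolding grad_def[abs_def] by (intro polyfun_intros polyfun_lam polyfun_pd polyfun_h) auto

lemma polyfun_E: "polyfun m (E a \<tau> \<sigma>)"
  unfolding E_def[abs_def] by (intro polyfun_intros polyfun_lam polyfun_grad) auto

lemma pd_lam: "l < d \<Longrightarrow> pd i (lam \<tau> l) x = pd i (h l) x / eps"
  unfolding lam_def[abs_def]
  by (simp add: pd_divide[OF polyfun_diff[OF polyfun_h polyfun_const]]
      pd_diff[OF polyfun_h polyfun_const] pd_const)

lemma pd_F:
  assumes i: "i < m"
  shows "pd i (F a \<tau>) x = grad a \<tau> i x"
proof -
  let ?P = "\<lambda>x. \<Sum>j<m. (x j - a j)\<^sup>2" and ?Q = "\<lambda>x. \<Sum>l<d. (lam \<tau> l x)\<^sup>2"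
  have P: "polyfun m ?P" and Q: "polyfun m ?Q"
    by (intro polyfun_intros polyfun_lam; simp)+
  have "pd i ?P x = (\<Sum>j<m. pd i (\<lambda>x. (x j - a j)\<^sup>2) x)"
    by (intro pd_sum[where n=m] polyfun_intros) auto
  also have "\<dots> = (\<Sum>j<m. 2 * (x j - a j) * (if i = j then 1 else 0))"
  proof (intro sum.cong refl)
    fix j assume j: "j \<in> {..<m}"
    have "pd i (\<lambda>x. (x j - a j)\<^sup>2) x = 2 * (x j - a j) * pd i (\<lambda>x. x j - a j) x"
      using j by (intro pd_power2[where n=m] polyfun_intros) auto
    also have "pd i (\<lambda>x. x j - a j) x = (if i = j then 1 else 0)"
      using j pd_diff[where n=m and f="\<lambda>x. x j" and g="\<lambda>_. a j"]
      by (simp add: polyfun_var polyfun_const pd_var pd_const)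
    finally show "pd i (\<lambda>x. (x j - a j)\<^sup>2) x = 2 * (x j - a j) * (if i = j then 1 else 0)" .
  qed
  also have "\<dots> = 2 * (x i - a i)" using i by (simp add: if_distrib[of "\<lambda>c. _ * c"] cong: if_cong)
  finally have 1: "pd i ?P x = 2 * (x i - a i)" .
  have "pd i ?Q x = (\<Sum>l<d. pd i (\<lambda>x. (lam \<tau> l x)\<^sup>2) x)"
    by (intro pd_sum[where n=m] polyfun_intros polyfun_lam) auto
  also have "\<dots> = (\<Sum>l<d. 2 * lam \<tau> l x * (pd i (h l) x / eps))"
    by (intro sum.cong refl) (simp add: pd_power2[OF polyfun_lam] pd_lam)
  finally have 2: "pd i ?Q x = (\<Sum>l<d. 2 * lam \<tau> l x * (pd i (h l) x / eps))" .
  have "pd i (F a \<tau>) x = pd i (\<lambda>x. \<theta> / 2 * ?P x) x + pd i (\<lambda>x. eps / 2 * ?Q x) x"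
    unfolding F_def[abs_def] by (intro pd_add[where n=m] polyfun_mult polyfun_const P Q)
  also have "\<dots> = \<theta> / 2 * pd i ?P x + eps / 2 * pd i ?Q x"
    using P Q by (simp only: pd_cmult)
  also have "\<dots> = grad a \<tau> i x"
    unfolding 1 2 grad_def using eps by (simp add: sum_distrib_left)
  finally show ?thesis .
qed

lemma pd_grad:
  assumes i: "i < m" and j: "j < m"
  shows "pd j (grad a \<tau> i) x = \<theta> * (if i = j then 1 else 0) +
    (\<Sum>l<d. pd j (h l) x / eps * pd i (h l) x + lam \<tau> l x * pd j (pd i (h l)) x)"
proof -
  have "pd j (grad a \<tau> i) x = pd j (\<lambda>x. \<theta> * (x i - a i)) x + pd j (\<lambda>x. \<Sum>l<d. lam \<tau> l x * pd i (h l) x) x"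
    unfolding grad_def[abs_def] using i
    by (intro pd_add[where n=m] polyfun_intros polyfun_lam polyfun_pd polyfun_h) auto
  also have "pd j (\<lambda>x. \<theta> * (x i - a i)) x = \<theta> * pd j (\<lambda>x. x i - a i) x"
    using i by (intro pd_cmult[where n=m] polyfun_intros)
  also have "pd j (\<lambda>x. x i - a i) x = (if i = j then 1 else 0)"
    using i pd_diff[where n=m and f="\<lambda>x. x i" and g="\<lambda>_. a i"]
    by (simp add: polyfun_var polyfun_const pd_var pd_const)
  also have "pd j (\<lambda>x. \<Sum>l<d. lam \<tau> l x * pd i (h l) x) x = (\<Sum>l<d. pd j (\<lambda>x. lam \<tau> l x * pd i (h l) x) x)"
    by (intro pd_sum[where n=m] polyfun_intros polyfun_lam polyfun_pd polyfun_h) auto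
  also have "\<dots> = (\<Sum>l<d. pd j (h l) x / eps * pd i (h l) x + lam \<tau> l x * pd j (pd i (h l)) x)"
    by (intro sum.cong refl)
      (simp add: pd_mult[OF polyfun_lam polyfun_pd[OF polyfun_h]] pd_lam)
  finally show ?thesis .
qed

lemma pd_E:
  assumes j: "j < m"
  shows "pd j (E a \<tau> \<sigma>) x =
    2 * (\<Sum>i<m. grad a \<tau> i x * pd j (grad a \<tau> i) x) + 2 * (\<Sum>l<d. \<sigma> l * (pd j (h l) x / eps))"
proof -
  let ?P = "\<lambda>x. \<Sum>i<m. (grad a \<tau> i x)\<^sup>2" and ?Q = "\<lambda>x. \<Sum>l<d. \<sigma> l * lam \<tau> l x"
  have P: "polyfun m ?P" and Q: "polyfun m ?Q"
    by (intro polyfun_intros polyfun_lam polyfun_grad; simp)+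
  have "pd j ?P x = (\<Sum>i<m. pd j (\<lambda>x. (grad a \<tau> i x)\<^sup>2) x)"
    by (intro pd_sum[where n=m] polyfun_intros polyfun_grad) auto
  also have "\<dots> = (\<Sum>i<m. 2 * (grad a \<tau> i x * pd j (grad a \<tau> i) x))"
    by (intro sum.cong refl) (simp add: pd_power2[OF polyfun_grad])
  finally have 1: "pd j ?P x = (\<Sum>i<m. 2 * (grad a \<tau> i x * pd j (grad a \<tau> i) x))" .
  have "pd j ?Q x = (\<Sum>l<d. pd j (\<lambda>x. \<sigma> l * lam \<tau> l x) x)"
    by (intro pd_sum[where n=m] polyfun_intros polyfun_lam) auto
  also have "\<dots> = (\<Sum>l<d. \<sigma> l * (pd j (h l) x / eps))"
    by (intro sum.cong refl) (simp add: pd_cmult[OF polyfun_lam] pd_lam)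
  finally have 2: "pd j ?Q x = (\<Sum>l<d. \<sigma> l * (pd j (h l) x / eps))" .
  have "pd j (E a \<tau> \<sigma>) x = pd j ?P x + pd j (\<lambda>x. 2 * ?Q x) x"
    unfolding E_def[abs_def] by (intro pd_add[where n=m] polyfun_mult polyfun_const P Q)
  also have "pd j (\<lambda>x. 2 * ?Q x) x = 2 * pd j ?Q x"
    using Q by (rule pd_cmult)
  finally show ?thesis unfolding 1 2 by (simp add: sum_distrib_left)
qed

lemma bd_pd_h: "l < d \<Longrightarrow> i < m \<Longrightarrow> bd m m 1 0 (pd i (h l))"
  using bd_pd[OF bd_h] by simp

lemma bd_pd_pd_h: "l < d \<Longrightarrow> i < m \<Longrightarrow> j < m \<Longrightarrow> bd m m 0 0 (pd j (pd i (h l)))"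
  using bd_pd[OF bd_pd_h] by simp

definition crit :: "(nat \<Rightarrow> real) \<Rightarrow> (nat \<Rightarrow> real) \<Rightarrow> (nat \<Rightarrow> real) set" where
  "crit a \<tau> = {x. (\<forall>i\<ge>m. x i = 0) \<and> (\<forall>i<m. grad a \<tau> i x = 0)}"

text \<open>Critical points solve \<theta> x_i + \<Sum> \<lambda>_l \<partial>_i h_l = \<theta> a_i
  and eps \<lambda>_l - h_l = - \<tau>_l. As h is quadratic, the first m equations are linear in x,
  so x is the first block and \<lambda> the second. The parameters are exactly the right-hand sides:
  a generic target point is a generic choice of \<open>a\<close> and \<open>\<tau>\<close>.\<close>

lemma generic_crit:
  shows "\<exists>\<Gamma>. polyfun (m + d) \<Gamma> \<and> (\<exists>w. \<Gamma> w \<noteq> 0) \<and>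
    (\<forall>a \<tau>. \<Gamma> (\<lambda>i. if i < m then \<theta> * a i else - \<tau> (i - m)) \<noteq> 0 \<longrightarrow>
      finite (crit a \<tau>) \<and> card (crit a \<tau>) \<le> dep_bound m d 2)"
proof -
  define f where "f i X = (if i < m then \<theta> * X i + (\<Sum>l<d. X (m + l) * pd i (h l) X)
    else eps * X i - h (i - m) X)" for i X
  define \<phi> where "\<phi> t X = (\<Sum>i<m. real t ^ i * X i)" for t :: nat and X :: "nat \<Rightarrow> real"
  define N where "N = dep_bound m d 2"
  have "\<exists>\<Gamma>. polyfun (m + d) \<Gamma> \<and> (\<exists>w. \<Gamma> w \<noteq> 0) \<and> (\<forall>w. \<Gamma> w \<noteq> 0 \<longrightarrow>
    finite {\<phi> t x |x. \<forall>j<m+d. f j x = w j} \<and> card {\<phi> t x |x. \<forall>j<m+d. f j x = w j} \<le> dep_bound m (m + d - m) 2)" for t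
  proof (rule generic_values)
    show "bd m (m + d) 1 2 (f i)" if "i < m" for i
    proof -
      have "bd m (m + d) 1 2 (\<lambda>X. \<theta> * X i + (\<Sum>l<d. X (m + l) * pd i (h l) X))"
        using that bd_extend[OF bd_pd_h]
        by (intro bd_add bd_cmult bd_var_z bd_sum bd_mult'[OF bd_var_y[of _ _ _ 1 0]]) auto
      then show ?thesis using that by (simp add: f_def[abs_def])
    qed
    show "bd m (m + d) 2 2 (f i)" if "m \<le> i" "i < m + d" for i
    proof -
      have "bd m (m + d) 2 2 (\<lambda>X. eps * X i - h (i - m) X)"
        using that bd_weaken[OF bd_extend[OF bd_h[of "i - m"]], of m 2 2]
        by (intro bd_diff bd_cmult bd_var_y) auto
      then show ?thesis using that by (simp add: f_def[abs_def])
    qed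
    show "bd m (m + d) 2 2 (\<phi> t)"
      unfolding \<phi>_def[abs_def] by (intro bd_sum bd_cmult bd_var_z) auto
  qed auto
  then have "\<forall>t. \<exists>\<Gamma>. polyfun (m + d) \<Gamma> \<and> (\<exists>w. \<Gamma> w \<noteq> 0) \<and> (\<forall>w. \<Gamma> w \<noteq> 0 \<longrightarrow>
    finite {\<phi> t x |x. \<forall>j<m+d. f j x = w j} \<and> card {\<phi> t x |x. \<forall>j<m+d. f j x = w j} \<le> N)"
    by (simp add: N_def)
  from choice[OF this] obtain \<Gamma> where \<Gamma>': "\<And>t. polyfun (m + d) (\<Gamma> t) \<and> (\<exists>w. \<Gamma> t w \<noteq> 0) \<and>
    (\<forall>w. \<Gamma> t w \<noteq> 0 \<longrightarrow> finite {\<phi> t x |x. \<forall>j<m+d. f j x = w j} \<and>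
      card {\<phi> t x |x. \<forall>j<m+d. f j x = w j} \<le> N)"
    by blast
  then have \<Gamma>: "\<And>t. polyfun (m + d) (\<Gamma> t)" "\<And>t. \<exists>w. \<Gamma> t w \<noteq> 0"
    "\<And>t w. \<Gamma> t w \<noteq> 0 \<Longrightarrow> finite {\<phi> t x |x. \<forall>j<m+d. f j x = w j}"
    "\<And>t w. \<Gamma> t w \<noteq> 0 \<Longrightarrow> card {\<phi> t x |x. \<forall>j<m+d. f j x = w j} \<le> N"
    by simp_all
  \<comment> \<open>\<open>moment_separation\<close> for \<open>N + 1\<close> points needs more than
    (N + 1)^2 m candidates. The polynomials of all candidates are multiplied, because the separating
    \<open>t\<close> depends on the points.\<close>
  define T where "T = (N + 1) ^ 2 * m + 1"
  define \<Theta> where "\<Theta> w = (\<Prod>t<T. \<Gamma> t w)" for w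
  have "polyfun (m + d) \<Theta>" unfolding \<Theta>_def[abs_def] by (intro polyfun_prod \<Gamma>)
  moreover have "\<exists>w. \<Theta> w \<noteq> 0" unfolding \<Theta>_def by (rule polyfun_nonzero_prod[where n="m + d"]) (use \<Gamma> in auto)
  moreover have "finite (crit a \<tau>) \<and> card (crit a \<tau>) \<le> N"
    if nz: "\<Theta> (\<lambda>i. if i < m then \<theta> * a i else - \<tau> (i - m)) \<noteq> 0" for a \<tau>
  proof (rule ccontr)
    assume "\<not> (finite (crit a \<tau>) \<and> card (crit a \<tau>) \<le> N)"
    then have "infinite (crit a \<tau>) \<or> N + 1 \<le> card (crit a \<tau>)" by auto
    then obtain S where S: "S \<subseteq> crit a \<tau>" "finite S" "card S = N + 1"
      by (metis infinite_arbitrarily_large obtain_subset_with_card_n)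
    let ?w = "\<lambda>i. if i < m then \<theta> * a i else - \<tau> (i - m)"
    have "\<exists>t<T. inj_on (\<lambda>x. \<Sum>i<m. real t ^ i * x i) S"
      using S by (intro moment_separation) (auto simp: crit_def T_def)
    then obtain t where t: "t < T" "inj_on (\<lambda>x. \<Sum>i<m. real t ^ i * x i) S" by blast
    have \<Gamma>t: "\<Gamma> t ?w \<noteq> 0" using nz t(1) by (auto simp: \<Theta>_def)
    have "(\<lambda>x. \<Sum>i<m. real t ^ i * x i) ` S \<subseteq> {\<phi> t x |x. \<forall>j<m+d. f j x = ?w j}"
    proof safe
      fix x assume "x \<in> S"
      then have x: "\<And>i. i < m \<Longrightarrow> grad a \<tau> i x = 0" using S(1) by (auto simp: crit_def)
      define X where "X i = (if i < m then x i else lam \<tau> (i - m) x)" for i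
      have hX: "h l X = h l x" "pd i (h l) X = pd i (h l) x" if "l < d" for l i
        using polyfun_cong[OF polyfun_h[OF that], of X x]
          polyfun_cong[OF polyfun_pd[OF polyfun_h[OF that]], of X x] by (auto simp: X_def)
      have "f j X = ?w j" if "j < m + d" for j
      proof (cases "j < m")
        case True
        then have "f j X = \<theta> * x j + (\<Sum>l<d. lam \<tau> l x * pd j (h l) x)"
          by (simp add: f_def hX) (simp add: X_def)
        then show ?thesis using True x[OF True] by (simp add: grad_def right_diff_distrib)
      next
        case False
        then have "j - m < d" using that by auto
        then show ?thesis
          using False eps by (simp add: f_def hX) (simp add: X_def lam_def)
      qed
      moreover have "\<phi> t X = (\<Sum>i<m. real t ^ i * x i)"
        by (simp add: \<phi>_def X_def)
      ultimately show "\<exists>xa. (\<Sum>i<m. real t ^ i * x i) = \<phi> t xa \<and> (\<forall>j<m + d. f j xa = ?w j)"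
        by (intro exI[of _ X]) auto
    qed
    then have "card ((\<lambda>x. \<Sum>i<m. real t ^ i * x i) ` S) \<le> N"
      using \<Gamma>(3,4)[OF \<Gamma>t] card_mono order_trans by blast
    then show False using S(3) card_image[OF t(2)] by simp
  qed
  ultimately show ?thesis unfolding N_def by blast
qed

text \<open>The Lagrange condition for critical points of \<open>E\<close> plus the linear form
  \<open>w\<close> on the levels of \<open>F\<close>, recorded together with the multiplier
  \<open>s\<close>. With one equation less than unknowns this is a curve in generic
  situations.\<close>

definition polar :: "(nat \<Rightarrow> real) \<Rightarrow> (nat \<Rightarrow> real) \<Rightarrow> (nat \<Rightarrow> real) \<Rightarrow> (nat \<Rightarrow> real) \<Rightarrow> ((nat \<Rightarrow> real) \<times> real) set" where
  "polar a \<tau> \<sigma> w = {(x, s). (\<forall>i\<ge>m. x i = 0) \<and>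
    (\<forall>j<m. pd j (E a \<tau> \<sigma>) x + w j + s * grad a \<tau> j x = 0)}"

text \<open>The parameters in the order in which they are the right-hand sides of the system in
  \<open>generic_polar\<close>.\<close>

definition rhs :: "(nat \<Rightarrow> real) \<Rightarrow> (nat \<Rightarrow> real) \<Rightarrow> (nat \<Rightarrow> real) \<Rightarrow> (nat \<Rightarrow> real) \<Rightarrow> real \<Rightarrow> nat \<Rightarrow> real" where
  "rhs a \<tau> \<sigma> w c i = (if i < m then - \<theta> * a i else if i < 2 * m then - w (i - m)
    else if i < 2 * m + d then - \<tau> (i - 2 * m) else if i < 2 * m + 2 * d then \<sigma> (i - (2 * m + d)) else c)"

text \<open>The gradient of \<open>F\<close> gets unknowns g of its own. The first block is (x, g),
  of dimension 2m, the second (\<lambda>, \<nu>, s), of dimension 2d + 1, where \<nu>_l =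
  (\<nabla>h_l . g + \<sigma>_l) / eps absorbs the products of gradients. The definition of g and
  the polar equations are linear in (x, g), because the second derivatives of h are constant; the
  other 2d + 1 equations define \<lambda> and \<nu> and prescribe x_k.\<close>

lemma generic_polar:
  assumes k: "k < m"
  shows "\<exists>\<Gamma>. polyfun (2 * m + 2 * d + 1) \<Gamma> \<and> (\<exists>w. \<Gamma> w \<noteq> 0) \<and>
    (\<forall>a \<tau> \<sigma> w c. \<Gamma> (rhs a \<tau> \<sigma> w c) \<noteq> 0 \<longrightarrow>
      finite {F a \<tau> x |x s. (x, s) \<in> polar a \<tau> \<sigma> w \<and> x k = c} \<and>
      card {F a \<tau> x |x s. (x, s) \<in> polar a \<tau> \<sigma> w \<and> x k = c} \<le> dep_bound (2 * m) (2 * d + 1) 2)"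
proof -
  define n where "n = 2 * m + 2 * d + 1"
  define G where "G i X = (\<Sum>l<d. X (2 * m + l) * pd i (h l) X)" for i X
  define f where "f i X = (if i < m then X (m + i) - \<theta> * X i - G i X
    else if i < 2 * m then 2 * (\<theta> * X i +
        (\<Sum>l<d. X (2 * m + l) * (\<Sum>j<m. pd (i - m) (pd j (h l)) X * X (m + j))) +
        (\<Sum>l<d. X (2 * m + d + l) * pd (i - m) (h l) X)) + X (2 * m + 2 * d) * X i
    else if i < 2 * m + d then eps * X i - h (i - 2 * m) X
    else if i < 2 * m + 2 * d then eps * X i - (\<Sum>j<m. pd j (h (i - (2 * m + d))) X * X (m + j))
    else X k)" for i X
  \<comment> \<open>On solutions \<open>X (m + i) - G i X\<close> equals \<theta> (x_i - a_i). So
    this is \<open>F\<close>, written without \<open>a\<close>, which may occur only as a right-hand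
    side.\<close>
  define \<phi> where "\<phi> X = 1 / (2 * \<theta>) * (\<Sum>i<m. (X (m + i) - G i X)\<^sup>2) +
    eps / 2 * (\<Sum>l<d. (X (2 * m + l))\<^sup>2)" for X
  have bh: "bd (2 * m) n 1 0 (pd i (h l))" "bd (2 * m) n 0 0 (pd j (pd i (h l)))" "bd (2 * m) n 2 2 (h l)"
    if "i < m" "j < m" "l < d" for i j l
    using that bd_extend[OF bd_pd_h] bd_extend[OF bd_pd_pd_h] bd_weaken[OF bd_extend[OF bd_h], of l "2 * m" 2 2 n] by auto
  have bG: "bd (2 * m) n 1 1 (G i)" if "i < m" for i
    unfolding G_def[abs_def] using that
    by (intro bd_sum bd_mult'[OF bd_var_y[of _ _ _ 1 0] bh(1)[of i i]]) (auto simp: n_def)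
  have "\<exists>\<Gamma>. polyfun n \<Gamma> \<and> (\<exists>w. \<Gamma> w \<noteq> 0) \<and> (\<forall>w. \<Gamma> w \<noteq> 0 \<longrightarrow>
    finite {\<phi> x |x. \<forall>j<n. f j x = w j} \<and> card {\<phi> x |x. \<forall>j<n. f j x = w j} \<le> dep_bound (2 * m) (n - 2 * m) 2)"
  proof (rule generic_values)
    show "bd (2 * m) n 1 2 (f i)" if i: "i < 2 * m" for i
    proof (cases "i < m")
      case True
      have "bd (2 * m) n 1 2 (\<lambda>X. X (m + i) - \<theta> * X i - G i X)"
        using True bd_weaken[OF bG[OF True], of 1 2] by (intro bd_diff bd_cmult bd_var_z) auto
      then show ?thesis using True by (simp add: f_def[abs_def])
    next
      case False
      then have im: "i - m < m" using i by auto
      have "bd (2 * m) n 1 2 (\<lambda>X. 2 * (\<theta> * X i +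
        (\<Sum>l<d. X (2 * m + l) * (\<Sum>j<m. pd (i - m) (pd j (h l)) X * X (m + j))) +
        (\<Sum>l<d. X (2 * m + d + l) * pd (i - m) (h l) X)) + X (2 * m + 2 * d) * X i)"
        using im i False
        by (intro bd_add bd_cmult bd_sum bd_var_z bd_mult'[OF bd_var_y[of _ _ _ 1 0] bd_sum[of _ _ _ 1 0]]
            bd_mult'[OF bh(2) bd_var_z[of _ _ 1 _ 0]] bd_mult'[OF bd_var_y[of _ _ _ 1 0] bh(1)[of "i - m" "i - m"]]
            bd_mult'[OF bd_var_y[of _ _ _ 1 0] bd_var_z[of _ _ 1 _ 0]]) (auto simp: n_def)
      then show ?thesis using False i by (simp add: f_def[abs_def])
    qed
    show "bd (2 * m) n 2 2 (f i)" if i: "2 * m \<le> i" "i < n" for i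
    proof -
      consider "i < 2 * m + d" | "2 * m + d \<le> i" "i < 2 * m + 2 * d" | "2 * m + 2 * d \<le> i" by linarith
      then show ?thesis
      proof cases
        case 1
        have "bd (2 * m) n 2 2 (\<lambda>X. eps * X i - h (i - 2 * m) X)"
          using 1 i k by (intro bd_diff bd_cmult bd_var_y bh(3)[of k k]) auto
        then show ?thesis using 1 i by (simp add: f_def[abs_def])
      next
        case 2
        have "bd (2 * m) n 2 2 (\<lambda>X. eps * X i - (\<Sum>j<m. pd j (h (i - (2 * m + d))) X * X (m + j)))"
          using 2 i k
          by (intro bd_diff bd_cmult bd_var_y bd_sum bd_mult'[OF bh(1)[of _ k] bd_var_z[of _ _ 1 _ 0]]) auto
        then show ?thesis using 2 i by (simp add: f_def[abs_def])
      next
        case 3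
        then show ?thesis using i k by (simp add: f_def[abs_def] bd_var_z)
      qed
    qed
    show "bd (2 * m) n 2 2 \<phi>"
      unfolding \<phi>_def[abs_def] using bG
      by (intro bd_add bd_cmult bd_sum bd_power2[of _ _ 1 1] bd_diff bd_var_z bd_power2[OF bd_var_y[of _ _ _ 1 0]])
        (auto simp: n_def)
  qed (auto simp: n_def)
  then obtain \<Gamma> where \<Gamma>: "polyfun n \<Gamma>" "\<exists>w. \<Gamma> w \<noteq> 0"
    "\<And>w. \<Gamma> w \<noteq> 0 \<Longrightarrow> finite {\<phi> x |x. \<forall>j<n. f j x = w j}"
    "\<And>w. \<Gamma> w \<noteq> 0 \<Longrightarrow> card {\<phi> x |x. \<forall>j<n. f j x = w j} \<le> dep_bound (2 * m) (2 * d + 1) 2"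
    by (auto simp: n_def)
  have "{F a \<tau> x |x s. (x, s) \<in> polar a \<tau> \<sigma> w \<and> x k = c} \<subseteq> {\<phi> x |x. \<forall>j<n. f j x = rhs a \<tau> \<sigma> w c j}"
    for a \<tau> \<sigma> w c
  proof safe
    fix x s assume xs: "(x, s) \<in> polar a \<tau> \<sigma> w" and c: "c = x k"
    define \<nu> where "\<nu> l = ((\<Sum>j<m. pd j (h l) x * grad a \<tau> j x) + \<sigma> l) / eps" for l
    define X where "X i = (if i < m then x i else if i < 2 * m then grad a \<tau> (i - m) x
      else if i < 2 * m + d then lam \<tau> (i - 2 * m) x
      else if i < 2 * m + 2 * d then \<nu> (i - (2 * m + d)) else s)" for i
    have X: "\<And>i. i < m \<Longrightarrow> X i = x i" "\<And>i. i < m \<Longrightarrow> X (m + i) = grad a \<tau> i x"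
      "\<And>l. l < d \<Longrightarrow> X (2 * m + l) = lam \<tau> l x" "\<And>l. l < d \<Longrightarrow> X (2 * m + d + l) = \<nu> l"
      "X (2 * m + 2 * d) = s"
      by (auto simp: X_def)
    have hX: "h l X = h l x" "pd i (h l) X = pd i (h l) x" "pd j (pd i (h l)) X = pd j (pd i (h l)) x"
      if "l < d" for l i j
      using X(1) polyfun_cong[OF polyfun_h[OF that], of X x]
        polyfun_cong[OF polyfun_pd[OF polyfun_h[OF that]], of X x i]
        polyfun_cong[OF polyfun_pd[OF polyfun_pd[OF polyfun_h[OF that]]], of X x j i] by simp_all
    have G: "G i X = (\<Sum>l<d. lam \<tau> l x * pd i (h l) x)" for i
      by (simp add: G_def X hX)
    have "f j X = rhs a \<tau> \<sigma> w c j" if j: "j < n" for j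
    proof -
      consider "j < m" | "m \<le> j" "j < 2 * m" | "2 * m \<le> j" "j < 2 * m + d"
        | "2 * m + d \<le> j" "j < 2 * m + 2 * d" | "j = 2 * m + 2 * d"
        using j unfolding n_def by linarith
      then show ?thesis
      proof cases
        case 1
        then have "f j X = grad a \<tau> j x - \<theta> * x j - (\<Sum>l<d. lam \<tau> l x * pd j (h l) x)"
          by (simp add: f_def X G)
        then show ?thesis using 1 by (simp add: rhs_def grad_def right_diff_distrib)
      next
        case 2
        define i where "i = j - m"
        have i: "i < m" "j = m + i" using 2 by (auto simp: i_def)
        have eq: "pd i (E a \<tau> \<sigma>) x + w i + s * grad a \<tau> i x = 0"
          using xs i by (simp add: polar_def)
        \<comment> \<open>Half the gradient of the squared slope is the Hessian of \<open>F\<close>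
          applied to the gradient; it is sorted here by the multiple of the identity, the products
          of first derivatives and the second derivatives of \<open>h\<close>.\<close>
        have "(\<Sum>q<m. grad a \<tau> q x * pd i (grad a \<tau> q) x) =
          (\<Sum>q<m. (if q = i then \<theta> * grad a \<tau> i x else 0) +
             (\<Sum>l<d. pd i (h l) x / eps * (pd q (h l) x * grad a \<tau> q x) +
                     lam \<tau> l x * (pd i (pd q (h l)) x * grad a \<tau> q x)))"
          using i by (intro sum.cong refl)
            (simp add: pd_grad distrib_left sum_distrib_left sum_distrib_right mult_ac)
        also have "\<dots> = \<theta> * grad a \<tau> i x + (\<Sum>l<d. \<Sum>q<m. pd i (h l) x / eps * (pd q (h l) x * grad a \<tau> q x) +
                     lam \<tau> l x * (pd i (pd q (h l)) x * grad a \<tau> q x))"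
          using i by (simp add: sum.distrib) (subst (1 2) sum.swap, simp)
        also have "\<dots> = \<theta> * grad a \<tau> i x + (\<Sum>l<d. pd i (h l) x / eps * (\<Sum>q<m. pd q (h l) x * grad a \<tau> q x)) +
            (\<Sum>l<d. lam \<tau> l x * (\<Sum>q<m. pd i (pd q (h l)) x * grad a \<tau> q x))"
          by (simp add: sum.distrib sum_distrib_left)
        finally have "pd i (E a \<tau> \<sigma>) x = 2 * (\<theta> * grad a \<tau> i x +
            (\<Sum>l<d. lam \<tau> l x * (\<Sum>q<m. pd i (pd q (h l)) x * grad a \<tau> q x)) +
            (\<Sum>l<d. pd i (h l) x / eps * (\<Sum>q<m. pd q (h l) x * grad a \<tau> q x)) + (\<Sum>l<d. \<sigma> l * (pd i (h l) x / eps)))"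
          unfolding pd_E[OF i(1)] by simp
        moreover have "(\<Sum>l<d. pd i (h l) x / eps * (\<Sum>q<m. pd q (h l) x * grad a \<tau> q x)) + (\<Sum>l<d. \<sigma> l * (pd i (h l) x / eps)) =
           (\<Sum>l<d. \<nu> l * pd i (h l) x)"
          unfolding sum.distrib[symmetric] by (intro sum.cong refl) (simp add: \<nu>_def add_divide_distrib algebra_simps)
        ultimately have E: "pd i (E a \<tau> \<sigma>) x = 2 * (\<theta> * grad a \<tau> i x +
            (\<Sum>l<d. lam \<tau> l x * (\<Sum>q<m. pd i (pd q (h l)) x * grad a \<tau> q x)) + (\<Sum>l<d. \<nu> l * pd i (h l) x))"
          by (simp add: algebra_simps)
        have "f j X = 2 * (\<theta> * grad a \<tau> i x +
            (\<Sum>l<d. lam \<tau> l x * (\<Sum>q<m. pd i (pd q (h l)) x * grad a \<tau> q x)) + (\<Sum>l<d. \<nu> l * pd i (h l) x))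
            + s * grad a \<tau> i x"
          using i by (simp add: f_def X hX)
        also have "\<dots> = - w i" using eq unfolding E by linarith
        finally show ?thesis using i by (simp add: rhs_def)
      next
        case 3
        define l where "l = j - 2 * m"
        have "l < d" "j = 2 * m + l" using 3 by (auto simp: l_def)
        then show ?thesis using eps by (simp add: f_def rhs_def X hX) (simp add: lam_def)
      next
        case 4
        define l where "l = j - (2 * m + d)"
        have "l < d" "j = 2 * m + d + l" using 4 by (auto simp: l_def)
        then show ?thesis using eps by (simp add: f_def rhs_def X hX) (simp add: \<nu>_def)
      next
        case 5
        then show ?thesis using k c by (simp add: f_def rhs_def X)
      qed
    qed
    moreover have "\<phi> X = F a \<tau> x"
    proof -
      have "(\<Sum>i<m. (X (m + i) - G i X)\<^sup>2) = (\<Sum>i<m. \<theta>\<^sup>2 * (x i - a i)\<^sup>2)"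
        by (intro sum.cong refl) (simp add: X G grad_def power_mult_distrib)
      then show ?thesis
        using \<theta> by (simp add: \<phi>_def F_def X sum_distrib_left[symmetric] power2_eq_square)
    qed
    ultimately show "\<exists>xa. F a \<tau> x = \<phi> xa \<and> (\<forall>j<n. f j xa = rhs a \<tau> \<sigma> w (x k) j)"
      unfolding c by (intro exI[of _ X]) auto
  qed
  then have "finite {F a \<tau> x |x s. (x, s) \<in> polar a \<tau> \<sigma> w \<and> x k = c} \<and>
      card {F a \<tau> x |x s. (x, s) \<in> polar a \<tau> \<sigma> w \<and> x k = c} \<le> dep_bound (2 * m) (2 * d + 1) 2"
    if "\<Gamma> (rhs a \<tau> \<sigma> w c) \<noteq> 0" for a \<tau> \<sigma> w c
    using \<Gamma>(3,4)[OF that] by (meson card_mono finite_subset order_trans)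
  then show ?thesis
    using \<Gamma>(1,2) unfolding n_def by blast
qed

end

section \<open>Regular levels of the penalty function\<close>

text \<open>Both conditions come from the function t -> f (x + t u). With a negative second
  derivative at 0, its first derivative would be negative just after 0 and the minimum would be
  undercut.\<close>

lemma polyfun_min_line:
  assumes f: "polyfun m f" and min: "\<And>y. (\<And>i. i \<ge> m \<Longrightarrow> y i = 0) \<Longrightarrow> f x \<le> f y"
    and x: "\<And>i. i \<ge> m \<Longrightarrow> x i = 0" and u: "\<And>i. i \<ge> m \<Longrightarrow> u i = 0"
  shows "(\<Sum>i<m. pd i f x * u i) = 0 \<and> (\<Sum>i<m. u i * (\<Sum>j<m. pd j (pd i f) x * u j)) \<ge> 0"
proof -
  let ?y = "\<lambda>t i. x i + t * u i"
  define g1 where "g1 t = (\<Sum>i<m. pd i f (?y t) * u i)" for t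
  define g2 where "g2 t = (\<Sum>i<m. (\<Sum>j<m. pd j (pd i f) (?y t) * u j) * u i)" for t
  have g: "((\<lambda>t. f (?y t)) has_real_derivative g1 t) (at t)" for t
    unfolding g1_def by (rule polyfun_line_deriv[OF f])
  have g': "(g1 has_real_derivative g2 t) (at t)" for t
    unfolding g1_def g2_def
    by (intro DERIV_sum DERIV_cmult_right polyfun_line_deriv polyfun_pd f)
  have le: "f x \<le> f (?y t)" for t
    using x u by (intro min) auto
  have y0: "?y 0 = x" by simp
  have g10: "g1 0 = 0"
    by (rule DERIV_local_min[OF g[of 0], of 1]) (use le y0 in auto)
  have "g2 0 \<ge> 0"
  proof (rule ccontr)
    assume "\<not> g2 0 \<ge> 0"
    then obtain e where e: "e > 0" "\<And>t. t > 0 \<Longrightarrow> t < e \<Longrightarrow> g1 (0 + t) < g1 0"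
      using DERIV_neg_dec_right[OF g'[of 0]] by auto
    obtain t where t: "0 < t" "t < e / 2" "f (?y (e / 2)) - f (?y 0) = (e / 2 - 0) * g1 t"
      using MVT2[of 0 "e / 2" "\<lambda>t. f (?y t)" g1] g e(1) by auto
    then have "g1 t < 0" using e(2)[of t] e(1) g10 by simp
    then have "f (?y (e / 2)) - f (?y 0) < 0"
      unfolding t(3) using e(1) by (simp add: mult_pos_neg)
    then show False using le[of "e / 2"] y0 by simp
  qed
  then show ?thesis
    using g10 y0 by (simp add: g1_def g2_def mult.commute)
qed

text \<open>Without a multiplier the gradient of \<open>f\<close> has a nonzero component tangential
  to the level of \<open>g\<close>. Moving against it gains in first order; a correction along the
  gradient of \<open>g\<close>, found by the intermediate value theorem, returns to the level and
  costs less than the gain.\<close>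

lemma polyfun_lagrange:
  assumes f: "polyfun m f" and g: "polyfun m g"
    and p: "\<And>i. i \<ge> m \<Longrightarrow> p i = 0"
    and min: "\<And>y. (\<And>i. i \<ge> m \<Longrightarrow> y i = 0) \<Longrightarrow> g y = g p \<Longrightarrow> f p \<le> f y"
    and k: "k < m" "pd k g p \<noteq> 0"
  shows "\<exists>s. \<forall>j<m. pd j f p + s * pd j g p = 0"
proof (rule ccontr)
  assume neg: "\<not> ?thesis"
  define v where "v i = (if i < m then pd i g p else 0)" for i
  define w where "w i = (if i < m then pd i f p else 0)" for i
  define V where "V = (\<Sum>i<m. (v i)\<^sup>2)"
  have "(v k)\<^sup>2 \<le> V"
    unfolding V_def using k by (intro member_le_sum) auto
  then have V: "V > 0" using k by (auto simp: v_def intro: less_le_trans[of 0 "(v k)\<^sup>2"])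
  define b where "b = (\<Sum>i<m. w i * v i)"
  \<comment> \<open>This choice makes \<open>u\<close> orthogonal to the gradient \<open>v\<close>
    of \<open>g\<close>: \<open>u\<close> is minus the tangential part of the gradient of
    \<open>f\<close>.\<close>
  define s where "s = - b / V"
  define u where "u i = - (w i + s * v i)" for i
  define U where "U = (\<Sum>i<m. (u i)\<^sup>2)"
  obtain j where j: "j < m" "pd j f p + s * pd j g p \<noteq> 0" using neg by blast
  have "(u j)\<^sup>2 \<le> U"
    unfolding U_def using j by (intro member_le_sum) auto
  moreover have "(u j)\<^sup>2 > 0" using j by (simp add: u_def v_def w_def)
  ultimately have U: "U > 0" by linarith
  have vu: "(\<Sum>i<m. v i * u i) = 0"
  proof -
    have "(\<Sum>i<m. v i * u i) = (\<Sum>i<m. - (w i * v i) - s * (v i)\<^sup>2)"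
      by (intro sum.cong refl) (simp add: u_def algebra_simps power2_eq_square)
    also have "\<dots> = - b - s * V"
      by (simp add: b_def V_def sum_negf sum_subtractf sum_distrib_left)
    finally have "(\<Sum>i<m. v i * u i) = - b - s * V" .
    then show ?thesis using V by (simp add: s_def)
  qed
  have wu: "(\<Sum>i<m. w i * u i) = - U"
  proof -
    have "U = (\<Sum>i<m. - w i * u i - s * (v i * u i))"
      unfolding U_def by (intro sum.cong) (auto simp: u_def algebra_simps power2_eq_square)
    then show ?thesis using vu by (simp add: sum_subtractf sum_negf sum_distrib_left[symmetric])
  qed
  \<comment> \<open>Corrections of size at most \<open>\<kappa> * t\<close> change \<open>f\<close>
    in first order by at most a quarter of the gain \<open>t * U\<close>.\<close>
  define \<kappa> where "\<kappa> = U / (4 * (\<bar>b\<bar> + 1))"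
  have \<kappa>: "\<kappa> > 0" "\<kappa> * \<bar>b\<bar> \<le> U / 4" using U by (auto simp: \<kappa>_def field_simps)
  define S where "S = (\<Sum>i<m. \<bar>u i\<bar> + \<kappa> * \<bar>v i\<bar>)"
  have S: "S \<ge> 0" using \<kappa> by (simp add: S_def sum_nonneg)
  define R where "R = (\<Sum>i<m. \<bar>p i\<bar>) + S"
  obtain C1 where C1: "C1 \<ge> 0" "\<And>x y. (\<forall>i<m. \<bar>x i\<bar> \<le> R) \<Longrightarrow> (\<forall>i<m. \<bar>y i\<bar> \<le> R) \<Longrightarrow>
    \<bar>f x - f y - (\<Sum>i<m. pd i f y * (x i - y i))\<bar> \<le> C1 * (\<Sum>i<m. \<bar>x i - y i\<bar>)\<^sup>2"
    using polyfun_taylor[OF f] by blast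
  obtain C2 where C2: "C2 \<ge> 0" "\<And>x y. (\<forall>i<m. \<bar>x i\<bar> \<le> R) \<Longrightarrow> (\<forall>i<m. \<bar>y i\<bar> \<le> R) \<Longrightarrow>
    \<bar>g x - g y - (\<Sum>i<m. pd i g y * (x i - y i))\<bar> \<le> C2 * (\<Sum>i<m. \<bar>x i - y i\<bar>)\<^sup>2"
    using polyfun_taylor[OF g] by blast
  define C where "C = (C1 + C2) * S\<^sup>2 + 1"
  have C: "C \<ge> 1" "C1 * S\<^sup>2 \<le> C" "C2 * S\<^sup>2 < C"
    using C1(1) C2(1) by (auto simp: C_def distrib_right intro: add_nonneg_pos)
  \<comment> \<open>The quadratic Taylor remainder of \<open>f\<close> then takes at most another
    quarter of the gain, and that of \<open>g\<close> is too small to change the sign of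
    \<open>g (q \<rho>) - g p\<close> at the two ends of the range of \<open>\<rho>\<close>.\<close>
  define t where "t = min 1 (min (\<kappa> * V / C) (U / (4 * C)))"
  have t: "t > 0" "t \<le> 1" using \<kappa> V U C by (auto simp: t_def)
  have "t \<le> \<kappa> * V / C" "t \<le> U / (4 * C)" by (simp_all add: t_def)
  then have tC: "t * C \<le> \<kappa> * V" "t * C \<le> U / 4" using C(1) by (auto simp: field_simps)
  define q where "q \<rho> i = p i + t * u i + \<rho> * v i" for \<rho> i
  have q0: "q \<rho> i = 0" if "i \<ge> m" for \<rho> i
    using that p by (simp add: q_def u_def v_def w_def)
  have dist: "(\<Sum>i<m. \<bar>q \<rho> i - p i\<bar>) \<le> t * S" if \<rho>: "\<bar>\<rho>\<bar> \<le> \<kappa> * t" for \<rho>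
    unfolding S_def sum_distrib_left
  proof (rule sum_mono)
    fix i
    have "\<bar>q \<rho> i - p i\<bar> \<le> \<bar>t * u i\<bar> + \<bar>\<rho> * v i\<bar>" by (simp add: q_def)
    also have "\<dots> \<le> t * \<bar>u i\<bar> + (\<kappa> * t) * \<bar>v i\<bar>"
      using t \<rho> by (simp add: abs_mult mult_right_mono)
    finally show "\<bar>q \<rho> i - p i\<bar> \<le> t * (\<bar>u i\<bar> + \<kappa> * \<bar>v i\<bar>)" by (simp add: algebra_simps)
  qed
  have box: "\<forall>i<m. \<bar>q \<rho> i\<bar> \<le> R" if \<rho>: "\<bar>\<rho>\<bar> \<le> \<kappa> * t" for \<rho>
  proof (intro allI impI)
    fix i assume i: "i < m"
    have "\<bar>q \<rho> i - p i\<bar> \<le> (\<Sum>i<m. \<bar>q \<rho> i - p i\<bar>)"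
      using i by (intro member_le_sum[of i "{..<m}" "\<lambda>i. \<bar>q \<rho> i - p i\<bar>"]) auto
    also have "\<dots> \<le> 1 * S" using dist[OF \<rho>] mult_right_mono[OF t(2) S] by linarith
    finally have "\<bar>q \<rho> i\<bar> \<le> \<bar>p i\<bar> + S" by linarith
    moreover have "\<bar>p i\<bar> \<le> (\<Sum>i<m. \<bar>p i\<bar>)" using i by (intro member_le_sum) auto
    ultimately show "\<bar>q \<rho> i\<bar> \<le> R" by (simp add: R_def)
  qed
  have boxp: "\<forall>i<m. \<bar>p i\<bar> \<le> R"
  proof (intro allI impI)
    fix i assume i: "i < m"
    have "\<bar>p i\<bar> \<le> (\<Sum>i<m. \<bar>p i\<bar>)" using i by (intro member_le_sum) auto
    then show "\<bar>p i\<bar> \<le> R" using S by (simp add: R_def)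
  qed
  have sq: "(\<Sum>i<m. \<bar>q \<rho> i - p i\<bar>)\<^sup>2 \<le> t * (t * S\<^sup>2)" if \<rho>: "\<bar>\<rho>\<bar> \<le> \<kappa> * t" for \<rho>
    using power_mono[OF dist[OF \<rho>], of 2] by (simp add: sum_nonneg power_mult_distrib power2_eq_square mult_ac)
  have gq: "\<bar>g (q \<rho>) - g p - \<rho> * V\<bar> < t * (\<kappa> * V)" if \<rho>: "\<bar>\<rho>\<bar> \<le> \<kappa> * t" for \<rho>
  proof -
    have "(\<Sum>i<m. pd i g p * (q \<rho> i - p i)) = t * (\<Sum>i<m. v i * u i) + \<rho> * V"
      by (simp add: q_def v_def V_def sum_distrib_left sum.distrib[symmetric] algebra_simps power2_eq_square)
    then have "\<bar>g (q \<rho>) - g p - \<rho> * V\<bar> \<le> C2 * (\<Sum>i<m. \<bar>q \<rho> i - p i\<bar>)\<^sup>2"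
      using C2(2)[OF box[OF \<rho>] boxp] vu by simp
    also have "\<dots> \<le> C2 * (t * (t * S\<^sup>2))" using sq[OF \<rho>] C2(1) by (intro mult_left_mono)
    also have "\<dots> = t * (t * (C2 * S\<^sup>2))" by simp
    also have "\<dots> < t * (t * C)" using t C by (intro mult_strict_left_mono) auto
    also have "\<dots> \<le> t * (\<kappa> * V)" using t tC by (intro mult_left_mono) auto
    finally show ?thesis .
  qed
  have fq: "f (q \<rho>) < f p" if \<rho>: "\<bar>\<rho>\<bar> \<le> \<kappa> * t" for \<rho>
  proof -
    have "(\<Sum>i<m. pd i f p * (q \<rho> i - p i)) = t * (\<Sum>i<m. w i * u i) + \<rho> * b"
      by (simp add: q_def w_def b_def sum_distrib_left sum.distrib[symmetric] algebra_simps)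
    then have "f (q \<rho>) - f p + t * U - \<rho> * b \<le> C1 * (\<Sum>i<m. \<bar>q \<rho> i - p i\<bar>)\<^sup>2"
      using C1(2)[OF box[OF \<rho>] boxp] wu by simp
    also have "\<dots> \<le> C1 * (t * (t * S\<^sup>2))" using sq[OF \<rho>] C1(1) by (intro mult_left_mono)
    also have "\<dots> = t * (t * (C1 * S\<^sup>2))" by simp
    also have "\<dots> \<le> t * (t * C)" using t C by (intro mult_left_mono) auto
    also have "\<dots> \<le> t * (U / 4)" using t tC by (intro mult_left_mono) auto
    finally have 1: "f (q \<rho>) - f p + t * U - \<rho> * b \<le> t * (U / 4)" .
    have "\<rho> * b \<le> \<bar>\<rho>\<bar> * \<bar>b\<bar>" by (metis abs_ge_self abs_mult)
    also have "\<dots> \<le> (\<kappa> * t) * \<bar>b\<bar>" using \<rho> by (intro mult_right_mono) auto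
    also have "\<dots> \<le> t * (U / 4)" using mult_left_mono[OF \<kappa>(2), of t] t by (simp add: mult_ac)
    finally have "f (q \<rho>) - f p \<le> - (t * U / 2)" using 1 by (simp add: field_simps)
    then show ?thesis using t U by (smt (verit) divide_pos_pos mult_pos_pos)
  qed
  have "continuous_on {- (\<kappa> * t)..\<kappa> * t} (\<lambda>\<rho>. g (q \<rho>))"
    unfolding q_def by (intro continuous_at_imp_continuous_on ballI DERIV_isCont[OF polyfun_line_deriv[OF g]])
  moreover have "g (q (- (\<kappa> * t))) \<le> g p" "g p \<le> g (q (\<kappa> * t))"
  proof -
    have "\<bar>g (q (\<kappa> * t)) - g p - \<kappa> * t * V\<bar> < t * (\<kappa> * V)"
      "\<bar>g (q (- (\<kappa> * t))) - g p - (- (\<kappa> * t)) * V\<bar> < t * (\<kappa> * V)"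
      using gq[of "\<kappa> * t"] gq[of "- (\<kappa> * t)"] \<kappa> t by auto
    moreover have "\<kappa> * t * V = t * (\<kappa> * V)" "(- (\<kappa> * t)) * V = - (t * (\<kappa> * V))" by simp_all
    ultimately show "g (q (- (\<kappa> * t))) \<le> g p" "g p \<le> g (q (\<kappa> * t))" by linarith+
  qed
  ultimately obtain \<rho> where \<rho>: "- (\<kappa> * t) \<le> \<rho>" "\<rho> \<le> \<kappa> * t" "g (q \<rho>) = g p"
    using IVT'[of "\<lambda>\<rho>. g (q \<rho>)" "- (\<kappa> * t)" "g p" "\<kappa> * t"] \<kappa> t by auto
  then have "f p \<le> f (q \<rho>)" using q0 by (intro min) auto
  moreover have "\<bar>\<rho>\<bar> \<le> \<kappa> * t" using \<rho> by (simp add: abs_le_iff)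
  ultimately show False using fq[of \<rho>] by simp
qed

section \<open>Sublevel sets and regular levels of the penalty\<close>

context penalty
begin

lemma F_ge: "F a \<tau> x \<ge> \<theta> / 2 * (\<Sum>i<m. (x i - a i)\<^sup>2)"
  using eps by (simp add: F_def sum_nonneg)

lemma F_nonneg: "F a \<tau> x \<ge> 0"
  using F_ge[of x a \<tau>] \<theta> sum_nonneg[of "{..<m}" "\<lambda>i. (x i - a i)\<^sup>2"]
  by (meson divide_nonneg_nonneg less_eq_real_def mult_nonneg_nonneg order_trans zero_le_numeral zero_le_power2)

lemma F_coord:
  assumes "i < m" "F a \<tau> x \<le> c"
  shows "(x i - a i)\<^sup>2 \<le> 2 * c / \<theta>"
proof -
  have "(x i - a i)\<^sup>2 \<le> (\<Sum>i<m. (x i - a i)\<^sup>2)"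
    using assms(1) by (intro member_le_sum) auto
  moreover have "\<theta> / 2 * (\<Sum>i<m. (x i - a i)\<^sup>2) \<le> c" using F_ge assms(2) order_trans by blast
  ultimately show ?thesis using \<theta> by (simp add: field_simps) (smt (verit) mult_left_mono)
qed

text \<open>The term with \<open>\<theta>\<close> confines a sublevel set to a box, whatever the
  \<open>h l\<close> are. Hence minima exist and positive functions on sublevel sets are bounded
  away from 0.\<close>

lemma compact_sublevel: "compact {x. (\<forall>i\<ge>m. x i = 0) \<and> F a \<tau> x \<le> c}"
proof -
  define R where "R = (\<Sum>i<m. \<bar>a i\<bar>) + sqrt (2 * c / \<theta>)"
  have "\<bar>x i\<bar> \<le> R" if "F a \<tau> x \<le> c" "i < m" for x i
  proof -
    have "\<bar>x i - a i\<bar> \<le> sqrt (2 * c / \<theta>)"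
      using F_coord[OF that(2,1)] real_sqrt_le_mono by fastforce
    moreover have "\<bar>a i\<bar> \<le> (\<Sum>i<m. \<bar>a i\<bar>)" using that by (intro member_le_sum) auto
    ultimately show ?thesis by (simp add: R_def)
  qed
  then have "{x. (\<forall>i\<ge>m. x i = 0) \<and> F a \<tau> x \<le> c} =
      {x. (\<forall>i<m. \<bar>x i\<bar> \<le> R) \<and> (\<forall>i\<ge>m. x i = 0)} \<inter> {x. F a \<tau> x \<le> c}" by auto
  moreover have "closed {x. F a \<tau> x \<le> c}"
    by (intro closed_Collect_le continuous_on_polyfun[OF polyfun_F] continuous_intros)
  ultimately show ?thesis using compact_Int_closed[OF compact_box[of m R]] by simp
qed

lemma F_min_exists: "\<exists>x. (\<forall>i\<ge>m. x i = 0) \<and> (\<forall>y. (\<forall>i\<ge>m. y i = 0) \<longrightarrow> F a \<tau> x \<le> F a \<tau> y)"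
proof -
  let ?S = "{x. (\<forall>i\<ge>m. x i = 0) \<and> F a \<tau> x \<le> F a \<tau> (\<lambda>_. 0)}"
  have ne: "?S \<noteq> {}" by auto
  have "\<exists>x\<in>?S. \<forall>y\<in>?S. F a \<tau> x \<le> F a \<tau> y"
    by (rule continuous_attains_inf[OF compact_sublevel ne continuous_on_polyfun[OF polyfun_F]])
  then obtain x where x: "x \<in> ?S" "\<forall>y\<in>?S. F a \<tau> x \<le> F a \<tau> y" ..
  then have "F a \<tau> x \<le> F a \<tau> y" if "\<forall>i\<ge>m. y i = 0" for y
    using that x by (cases "F a \<tau> y \<le> F a \<tau> (\<lambda>_. 0)") auto
  then show ?thesis using x(1) by blast
qed

text \<open>
  Minimise the penalty with \<open>\<theta>\<close> halved: there the Hessian of the original penalty is positive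
  definite, and one of two centres \<open>b\<close> makes the gradient nonzero.
\<close>

lemma definite_point:
  assumes m: "0 < m"
  shows "\<exists>x. (\<forall>i\<ge>m. x i = 0) \<and> (\<exists>i<m. grad a \<tau> i x \<noteq> 0) \<and>
    (\<forall>u. (\<Sum>i<m. u i * (\<Sum>j<m. pd j (grad a \<tau> i) x * u j)) \<ge> \<theta> / 2 * (\<Sum>i<m. (u i)\<^sup>2))"
proof -
  interpret half: penalty m d h eps "\<theta> / 2"
    by (rule penalty.intro) (simp_all add: bd_h eps \<theta>)
  define min where "min b x \<longleftrightarrow> (\<forall>i\<ge>m. x i = 0) \<and> (\<forall>y. (\<forall>i\<ge>m. y i = 0) \<longrightarrow> half.F b \<tau> x \<le> half.F b \<tau> y)" for b x
  have ex: "\<exists>x. min b x" for b using half.F_min_exists unfolding min_def .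
  have g0: "half.grad b \<tau> i x = 0" if "min b x" "i < m" for b x i
  proof -
    have "(\<Sum>j<m. pd j (half.F b \<tau>) x * (if j = i then 1 else 0)) = 0"
      using polyfun_min_line[OF half.polyfun_F[of b \<tau>], of x "\<lambda>j. if j = i then 1 else 0"] that
      by (auto simp: min_def)
    then show ?thesis using that half.pd_F by (simp add: if_distrib[of "\<lambda>c. _ * c"] cong: if_cong)
  qed
  have g: "grad a \<tau> i x = \<theta> / 2 * (x i - 2 * a i + b i)" if "min b x" "i < m" for b x i
    using g0[OF that] by (simp add: grad_def half.grad_def field_simps)
  have pdg: "pd j (grad a \<tau> i) x = pd j (half.grad b \<tau> i) x + \<theta> / 2 * (if i = j then 1 else 0)"
    if "i < m" "j < m" for i j b x
    using that by (simp add: pd_grad half.pd_grad)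
  have def: "(\<Sum>i<m. u i * (\<Sum>j<m. pd j (grad a \<tau> i) x * u j)) \<ge> \<theta> / 2 * (\<Sum>i<m. (u i)\<^sup>2)"
    if mb: "min b x" for b x u
  proof -
    define u' where "u' i = (if i < m then u i else 0)" for i
    have "0 \<le> (\<Sum>i<m. u' i * (\<Sum>j<m. pd j (pd i (half.F b \<tau>)) x * u' j))"
      using polyfun_min_line[OF half.polyfun_F[of b \<tau>], of x u'] mb by (auto simp: min_def u'_def)
    also have "\<dots> = (\<Sum>i<m. u i * (\<Sum>j<m. pd j (half.grad b \<tau> i) x * u j))"
    proof (intro sum.cong refl arg_cong2[where f=times])
      fix i j assume ij: "i \<in> {..<m}" "j \<in> {..<m}"
      have "pd i (half.F b \<tau>) = half.grad b \<tau> i" using ij half.pd_F by auto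
      then show "pd j (pd i (half.F b \<tau>)) x = pd j (half.grad b \<tau> i) x" by simp
    qed (auto simp: u'_def)
    finally have "0 \<le> (\<Sum>i<m. u i * (\<Sum>j<m. pd j (half.grad b \<tau> i) x * u j))" .
    moreover have "(\<Sum>i<m. u i * (\<Sum>j<m. pd j (grad a \<tau> i) x * u j)) =
        (\<Sum>i<m. u i * (\<Sum>j<m. pd j (half.grad b \<tau> i) x * u j)) + \<theta> / 2 * (\<Sum>i<m. (u i)\<^sup>2)"
    proof -
      have "(\<Sum>j<m. pd j (grad a \<tau> i) x * u j) = (\<Sum>j<m. pd j (half.grad b \<tau> i) x * u j) + \<theta> / 2 * u i"
        if i: "i < m" for i
      proof -
        have "(\<Sum>j<m. pd j (grad a \<tau> i) x * u j) =
          (\<Sum>j<m. pd j (half.grad b \<tau> i) x * u j + (if j = i then \<theta> / 2 * u i else 0))"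
          using i by (intro sum.cong refl) (auto simp: pdg[of _ _ _ b] algebra_simps)
        then show ?thesis using i by (simp add: sum.distrib)
      qed
      then have "(\<Sum>i<m. u i * (\<Sum>j<m. pd j (grad a \<tau> i) x * u j)) =
          (\<Sum>i<m. u i * ((\<Sum>j<m. pd j (half.grad b \<tau> i) x * u j) + \<theta> / 2 * u i))"
        by (intro sum.cong) auto
      then show ?thesis
        by (simp add: distrib_left sum.distrib sum_distrib_left power2_eq_square mult_ac)
    qed
    ultimately show ?thesis by simp
  qed
  define a0 where "a0 i = (if i < m then a i else 0)" for i
  define b where "b i = (if i = 0 then a0 i + 1 else a0 i)" for i
  \<comment> \<open>The reflection of \<open>b\<close> in \<open>a0\<close>: the only place where
    the gradient with centre \<open>b\<close> and halved \<open>\<theta>\<close> and the original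
    gradient can vanish together.\<close>
  define c where "c i = (if i = 0 then a0 i - 1 else a0 i)" for i
  obtain x where x: "min a0 x" using ex by blast
  obtain y where y: "min b y" using ex by blast
  show ?thesis
  proof (cases "\<exists>i<m. grad a \<tau> i x \<noteq> 0")
    case True
    then show ?thesis using x def[OF x] by (intro exI[of _ x]) (auto simp: min_def)
  next
    case False
    then have xa: "x = a0"
      using g[OF x] \<theta> x by (auto simp: fun_eq_iff a0_def min_def)
    have "\<exists>i<m. grad a \<tau> i y \<noteq> 0"
    proof (rule ccontr)
      assume *: "\<not> ?thesis"
      have yc: "y = c"
      proof
        fix i show "y i = c i"
          using * g[OF y, of i] \<theta> y m by (cases "i < m") (auto simp: c_def b_def a0_def min_def)
      qed
      define Q where "Q z = eps / 2 * (\<Sum>l<d. (lam \<tau> l z)\<^sup>2)" for z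
      have F: "half.F b' \<tau> z = \<theta> / 4 * (\<Sum>i<m. (z i - b' i)\<^sup>2) + Q z" for b' z
        by (simp add: half.F_def Q_def)
      have s: "(\<Sum>i<m. (z i)\<^sup>2) = (z 0)\<^sup>2" if "\<And>i. 0 < i \<Longrightarrow> z i = 0" for z :: "nat \<Rightarrow> real"
      proof -
        have "(\<Sum>i<m. (z i)\<^sup>2) = (\<Sum>i\<in>{0}. (z i)\<^sup>2)"
          using m that by (intro sum.mono_neutral_right) auto
        then show ?thesis by simp
      qed
      \<comment> \<open>The first inequality says Q a0 - Q c \<le> \<theta> / 4, the second Q a0 - Q
        c \<ge> 3 \<theta> / 4.\<close>
      have "half.F a0 \<tau> a0 \<le> half.F a0 \<tau> c" "half.F b \<tau> c \<le> half.F b \<tau> a0"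
        using x y m unfolding xa yc by (auto simp: min_def a0_def c_def)
      moreover have "(\<Sum>i<m. (a0 i - b i)\<^sup>2) = 1" "(\<Sum>i<m. (c i - b i)\<^sup>2) = 4" "(\<Sum>i<m. (c i - a0 i)\<^sup>2) = 1"
        using s[of "\<lambda>i. a0 i - b i"] s[of "\<lambda>i. c i - b i"] s[of "\<lambda>i. c i - a0 i"]
        by (simp_all add: b_def c_def)
      ultimately show False using \<theta> unfolding F by simp
    qed
    then show ?thesis using y def[OF y] by (intro exI[of _ y]) (auto simp: min_def)
  qed
qed

text \<open>Through each polar point on level \<open>c\<close> runs a Lipschitz arc of polar points
  with \<open>F\<close> itself as parameter, so that differences of levels and displacements can be
  compared along it.\<close>

definition regular_level :: "(nat \<Rightarrow> real) \<Rightarrow> (nat \<Rightarrow> real) \<Rightarrow> (nat \<Rightarrow> real) \<Rightarrow> (nat \<Rightarrow> real) \<Rightarrow> real \<Rightarrow> bool" where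
  "regular_level a \<tau> \<sigma> w c \<longleftrightarrow> (\<forall>x s. (x, s) \<in> polar a \<tau> \<sigma> w \<longrightarrow> F a \<tau> x = c \<longrightarrow>
      (\<exists>\<delta>>0. \<exists>K\<ge>0. \<exists>X. X 0 = x \<and>
        (\<forall>t. \<bar>t\<bar> \<le> \<delta> \<longrightarrow> F a \<tau> (X t) = c + t \<and> (\<exists>s'. (X t, s') \<in> polar a \<tau> \<sigma> w)) \<and>
        (\<forall>r t. \<bar>r\<bar> \<le> \<delta> \<longrightarrow> \<bar>t\<bar> \<le> \<delta> \<longrightarrow> (\<Sum>i<m. \<bar>X r i - X t i\<bar>) \<le> K * \<bar>r - t\<bar>)))"

text \<open>Apply \<open>image_of_hypersurface\<close> to the map (x, s) -> (\<nabla>E + s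
  \<nabla>F, F) in m + 1 variables: polar points on level \<open>c\<close> are preimages of (-w, c),
  and at a regular one \<open>regular_branch\<close> moves the value of \<open>F\<close> alone. It
  remains to see that the Jacobian determinant is not identically zero.\<close>

lemma generic_regular:
  assumes m: "0 < m"
  shows "\<exists>\<Gamma>. polyfun (m + 1) \<Gamma> \<and> (\<exists>w. \<Gamma> w \<noteq> 0) \<and>
    (\<forall>w c. \<Gamma> (\<lambda>i. if i < m then - w i else c) \<noteq> 0 \<longrightarrow> regular_level a \<tau> \<sigma> w c)"
proof -
  define n where "n = m + 1"
  define f where "f j Y = (if j < m then pd j (E a \<tau> \<sigma>) Y + Y m * grad a \<tau> j Y else F a \<tau> Y)" for j Y
  have pE: "polyfun n (pd j (E a \<tau> \<sigma>))" for j
    using polyfun_mono[OF polyfun_pd[OF polyfun_E]] by (simp add: n_def)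
  have pg: "polyfun n (grad a \<tau> j)" if "j < m" for j
    using polyfun_mono[OF polyfun_grad[OF that]] by (simp add: n_def)
  have pF: "polyfun n (F a \<tau>)"
    using polyfun_mono[OF polyfun_F] by (simp add: n_def)
  have f1: "f j = (\<lambda>Y. pd j (E a \<tau> \<sigma>) Y + Y m * grad a \<tau> j Y)" if "j < m" for j
    using that by (auto simp: f_def)
  have f2: "f j = F a \<tau>" if "\<not> j < m" for j
    using that by (auto simp: f_def)
  have pf: "polyfun n (f j)" if "j < n" for j
    using that by (cases "j < m") (auto simp: f1 f2 n_def[symmetric] intro!: polyfun_intros pE pg pF, simp add: n_def)
  have pdf1: "pd k (f j) Y = pd k (pd j (E a \<tau> \<sigma>)) Y + ((if k = m then 1 else 0) * grad a \<tau> j Y + Y m * pd k (grad a \<tau> j) Y)"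
    if "j < m" for j k Y
    unfolding f1[OF that] using that
      pd_add[OF pE polyfun_mult[OF polyfun_var pg[OF that]], of m k j Y]
      pd_mult[OF polyfun_var pg[OF that], of m k Y] by (simp add: pd_var n_def)
  obtain h where h: "polyfun n h"
    "\<And>x. h x \<noteq> 0 \<Longrightarrow> (\<exists>B. \<forall>i<n. \<forall>j<n.
       (\<Sum>k<n. B i k * pd j (f k) x) = (if i = j then 1 else 0) \<and>
       (\<Sum>k<n. pd k (f i) x * B k j) = (if i = j then 1 else 0))"
    "\<And>x. h x = 0 \<Longrightarrow> (\<exists>u. (\<exists>i<n. u i \<noteq> 0) \<and> (\<forall>i<n. (\<Sum>j<n. pd j (f i) x * u j) = 0))"
    using polyfun_det[of n n "\<lambda>i j. pd j (f i)"] polyfun_pd[OF pf] by blast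
  have "\<exists>Y. h Y \<noteq> 0"
  proof (rule ccontr)
    assume "\<not> ?thesis"
    then have h0: "\<And>Y. h Y = 0" by blast
    obtain x where x: "\<forall>i\<ge>m. x i = 0" "\<exists>i<m. grad a \<tau> i x \<noteq> 0"
      "\<And>u. (\<Sum>i<m. u i * (\<Sum>j<m. pd j (grad a \<tau> i) x * u j)) \<ge> \<theta> / 2 * (\<Sum>i<m. (u i)\<^sup>2)"
      using definite_point[OF m] by blast
    define A where "A i j = pd j (pd i (E a \<tau> \<sigma>)) x" for i j
    define C where "C = (\<Sum>i<m. \<Sum>j<m. \<bar>A i j\<bar>)"
    \<comment> \<open>For this \<open>s\<close> the Hessian of \<open>F\<close>, positive definite
      at \<open>x\<close>, dominates the second derivatives of \<open>E\<close>. A kernel vector (u,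
      u_m) has u orthogonal to \<nabla>F; pairing the first \<open>m\<close> equations with u
      removes u_m and yields (C + 1) |u|^2 \<le> C |u|^2.\<close>
    define s where "s = 2 * (C + 1) / \<theta>"
    have C: "C \<ge> 0" by (simp add: C_def sum_nonneg)
    have s: "s > 0" using C \<theta> by (simp add: s_def)
    define Y where "Y = x(m := s)"
    obtain u where u: "\<exists>i<n. u i \<noteq> 0" "\<And>i. i < n \<Longrightarrow> (\<Sum>j<n. pd j (f i) Y * u j) = 0"
      using h(3)[OF h0[of Y]] by blast
    have YE: "pd j (pd i (E a \<tau> \<sigma>)) Y = A i j" for i j
      unfolding A_def by (rule polyfun_cong[OF polyfun_pd[OF polyfun_pd[OF polyfun_E]]]) (simp add: Y_def)
    have Yg: "grad a \<tau> i Y = grad a \<tau> i x" "pd j (grad a \<tau> i) Y = pd j (grad a \<tau> i) x" if "i < m" for i j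
      using polyfun_cong[OF polyfun_grad[OF that], of Y x] polyfun_cong[OF polyfun_pd[OF polyfun_grad[OF that]], of Y x]
      by (auto simp: Y_def)
    have eq1: "(\<Sum>j<m. A i j * u j) + s * (\<Sum>j<m. pd j (grad a \<tau> i) x * u j) + grad a \<tau> i x * u m = 0" if i: "i < m" for i
    proof -
      have "0 = (\<Sum>j<n. pd j (f i) Y * u j)" using u(2)[of i] i by (simp add: n_def)
      also have "\<dots> = (\<Sum>j<m. pd j (f i) Y * u j) + pd m (f i) Y * u m" by (simp add: n_def)
      also have "(\<Sum>j<m. pd j (f i) Y * u j) = (\<Sum>j<m. A i j * u j + s * (pd j (grad a \<tau> i) x * u j))"
        using i by (intro sum.cong refl) (simp add: pdf1 YE Yg, simp add: Y_def algebra_simps)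
      also have "pd m (f i) Y = grad a \<tau> i x"
        using i pd_outside[OF polyfun_grad[OF i]] pd_outside[OF polyfun_pd[OF polyfun_E]]
        by (simp add: pdf1 Yg(1))
      finally show ?thesis by (simp add: sum.distrib sum_distrib_left)
    qed
    have eq2: "(\<Sum>j<m. grad a \<tau> j x * u j) = 0"
    proof -
      have "0 = (\<Sum>j<n. pd j (f m) Y * u j)" using u(2)[of m] by (simp add: n_def)
      also have "\<dots> = (\<Sum>j<m. pd j (f m) Y * u j) + pd m (f m) Y * u m" by (simp add: n_def)
      also have "pd m (f m) Y = 0" using pd_outside[OF polyfun_F] by (simp add: f2)
      also have "(\<Sum>j<m. pd j (f m) Y * u j) = (\<Sum>j<m. grad a \<tau> j x * u j)"
        by (intro sum.cong refl) (simp add: f2 pd_F Yg)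
      finally show ?thesis by simp
    qed
    define U where "U = (\<Sum>i<m. (u i)\<^sup>2)"
    have U: "U \<ge> 0" by (simp add: U_def sum_nonneg)
    have uU: "\<bar>u i\<bar> * \<bar>u j\<bar> \<le> U" if "i < m" "j < m" for i j
    proof -
      have "(u i)\<^sup>2 \<le> U" "(u j)\<^sup>2 \<le> U" using that by (auto simp: U_def intro!: member_le_sum)
      moreover have "2 * (\<bar>u i\<bar> * \<bar>u j\<bar>) \<le> (u i)\<^sup>2 + (u j)\<^sup>2"
        using zero_le_power2[of "\<bar>u i\<bar> - \<bar>u j\<bar>"] by (simp add: power2_diff)
      ultimately show ?thesis by linarith
    qed
    have "0 = (\<Sum>i<m. u i * ((\<Sum>j<m. A i j * u j) + s * (\<Sum>j<m. pd j (grad a \<tau> i) x * u j) + grad a \<tau> i x * u m))"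
      using eq1 by simp
    also have "\<dots> = (\<Sum>i<m. u i * (\<Sum>j<m. A i j * u j)) + s * (\<Sum>i<m. u i * (\<Sum>j<m. pd j (grad a \<tau> i) x * u j))
        + u m * (\<Sum>j<m. grad a \<tau> j x * u j)"
      by (simp add: distrib_left sum.distrib sum_distrib_left mult_ac)
    finally have "s * (\<Sum>i<m. u i * (\<Sum>j<m. pd j (grad a \<tau> i) x * u j)) = - (\<Sum>i<m. u i * (\<Sum>j<m. A i j * u j))"
      using eq2 by simp
    also have "\<dots> \<le> (\<Sum>i<m. \<Sum>j<m. \<bar>u i * (A i j * u j)\<bar>)"
      by (simp add: sum_distrib_left sum_negf[symmetric]) (intro sum_mono; auto)
    also have "\<dots> \<le> (\<Sum>i<m. \<Sum>j<m. \<bar>A i j\<bar> * U)"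
    proof (intro sum_mono)
      fix i j assume "i \<in> {..<m}" "j \<in> {..<m}"
      then show "\<bar>u i * (A i j * u j)\<bar> \<le> \<bar>A i j\<bar> * U"
        using mult_left_mono[OF uU[of i j], of "\<bar>A i j\<bar>"] by (simp add: abs_mult mult_ac)
    qed
    also have "\<dots> = C * U" by (simp add: C_def sum_distrib_right)
    finally have "s * (\<Sum>i<m. u i * (\<Sum>j<m. pd j (grad a \<tau> i) x * u j)) \<le> C * U" .
    moreover have "s * (\<theta> / 2 * U) \<le> s * (\<Sum>i<m. u i * (\<Sum>j<m. pd j (grad a \<tau> i) x * u j))"
      unfolding U_def using s x(3) by (intro mult_left_mono) auto
    moreover have "s * (\<theta> / 2 * U) = (C + 1) * U" using \<theta> by (simp add: s_def)
    ultimately have "U \<le> 0" by (simp add: algebra_simps)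
    then have U0: "U = 0" using U by simp
    then have ui: "u i = 0" if "i < m" for i
      using that unfolding U_def by (simp add: sum_nonneg_eq_0_iff)
    then have "grad a \<tau> i x * u m = 0" if "i < m" for i
      using eq1[OF that] by simp
    then have "u m = 0" using x(2) by auto
    then show False using u(1) ui by (auto simp: n_def less_Suc_eq)
  qed
  then obtain Y0 where Y0: "h Y0 \<noteq> 0" by blast
  obtain \<Gamma> where \<Gamma>: "polyfun n \<Gamma>" "\<exists>w. \<Gamma> w \<noteq> 0" "\<And>Y. h Y = 0 \<Longrightarrow> \<Gamma> (\<lambda>j. f j Y) = 0"
    using image_of_hypersurface[where f=f, OF pf h(1) Y0] by blast
  have main: "\<exists>\<delta>>0. \<exists>K\<ge>0. \<exists>X. X 0 = x \<and>
        (\<forall>t. \<bar>t\<bar> \<le> \<delta> \<longrightarrow> F a \<tau> (X t) = c + t \<and> (\<exists>s'. (X t, s') \<in> polar a \<tau> \<sigma> w)) \<and>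
        (\<forall>r t. \<bar>r\<bar> \<le> \<delta> \<longrightarrow> \<bar>t\<bar> \<le> \<delta> \<longrightarrow> (\<Sum>i<m. \<bar>X r i - X t i\<bar>) \<le> K * \<bar>r - t\<bar>)"
    if nz: "\<Gamma> (\<lambda>i. if i < m then - w i else c) \<noteq> 0" and xs: "(x, s) \<in> polar a \<tau> \<sigma> w" and c: "F a \<tau> x = c"
    for w c x s
  proof -
    define Y where "Y = x(m := s)"
    have cg: "G (y(m := q)) = G y" if "polyfun m G" for G y q
      by (rule polyfun_cong[OF that]) simp
    have x0: "\<forall>i\<ge>m. x i = 0" using xs by (simp add: polar_def)
    have fY: "f j Y = (if j < m then - w j else c)" for j
      using xs c cg[OF polyfun_pd[OF polyfun_E]] cg[OF polyfun_grad] cg[OF polyfun_F]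
      by (auto simp: f_def Y_def polar_def algebra_simps)
    then have "\<Gamma> (\<lambda>j. f j Y) \<noteq> 0" using nz by simp
    then have "h Y \<noteq> 0" using \<Gamma>(3) by blast
    then obtain B where B: "\<And>i j. i < n \<Longrightarrow> j < n \<Longrightarrow> (\<Sum>k<n. B i k * pd j (f k) Y) = (if i = j then 1 else 0)"
      "\<And>i j. i < n \<Longrightarrow> j < n \<Longrightarrow> (\<Sum>k<n. pd k (f i) Y * B k j) = (if i = j then 1 else 0)"
      using h(2) by blast
    have Ys: "\<And>i. i \<ge> n \<Longrightarrow> Y i = 0" using x0 by (simp add: Y_def n_def)
    obtain \<delta> K Z where Z: "\<delta> > 0" "K \<ge> 0" "Z 0 = Y"
      "\<And>t. \<bar>t\<bar> \<le> \<delta> \<Longrightarrow> (\<forall>i\<ge>n. Z t i = 0) \<and> (\<forall>i<n. f i (Z t) = f i Y + t * (if i = m then 1 else 0))"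
      "\<And>s t. \<bar>s\<bar> \<le> \<delta> \<Longrightarrow> \<bar>t\<bar> \<le> \<delta> \<Longrightarrow> (\<Sum>i<n. \<bar>Z s i - Z t i\<bar>) \<le> K * \<bar>s - t\<bar>"
      using regular_branch[OF pf B Ys, of "\<lambda>i. if i = m then 1 else 0"] by blast
    \<comment> \<open>The multiplier, which was stored as coordinate \<open>m\<close>, is
      dropped.\<close>
    define X where "X t = (Z t)(m := 0)" for t
    have "X 0 = x" using x0 by (auto simp: X_def Z(3) Y_def)
    moreover have "F a \<tau> (X t) = c + t" if "\<bar>t\<bar> \<le> \<delta>" for t
    proof -
      have "f m (Z t) = f m Y + t" using Z(4)[OF that] by (simp add: n_def)
      then show ?thesis using cg[OF polyfun_F] fY[of m] by (simp add: X_def f2)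
    qed
    moreover have "(X t, Z t m) \<in> polar a \<tau> \<sigma> w" if t: "\<bar>t\<bar> \<le> \<delta>" for t
    proof -
      have "X t i = 0" if "i \<ge> m" for i
        using Z(4)[OF t] that by (cases "i = m") (auto simp: X_def n_def)
      moreover have "pd j (E a \<tau> \<sigma>) (X t) + w j + Z t m * grad a \<tau> j (X t) = 0" if "j < m" for j
      proof -
        have "f j (Z t) = f j Y" using Z(4)[OF t] that by (simp add: n_def)
        then show ?thesis
          using that fY[of j] cg[OF polyfun_pd[OF polyfun_E]] cg[OF polyfun_grad[OF that]]
          by (simp add: X_def f1)
      qed
      ultimately show ?thesis by (simp add: polar_def)
    qed
    moreover have "(\<Sum>i<m. \<bar>X r i - X t i\<bar>) \<le> K * \<bar>r - t\<bar>" if "\<bar>r\<bar> \<le> \<delta>" "\<bar>t\<bar> \<le> \<delta>" for r t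
      using Z(5)[OF that] by (simp add: X_def n_def)
    ultimately show ?thesis using Z(1,2) by blast
  qed
  have "regular_level a \<tau> \<sigma> w c" if "\<Gamma> (\<lambda>i. if i < m then - w i else c) \<noteq> 0" for w c
    unfolding regular_level_def by (intro allI impI) (rule main[OF that])
  then show ?thesis using \<Gamma>(1,2) unfolding n_def by blast
qed

end

section \<open>Curves of bounded length and descent\<close>

definition nd :: "nat \<Rightarrow> (nat \<Rightarrow> real) \<Rightarrow> (nat \<Rightarrow> real) \<Rightarrow> real" where
  "nd n x y = L2_set (\<lambda>i. x i - y i) {..<n}"

lemma nd_nonneg: "nd n x y \<ge> 0" and nd_self: "nd n x x = 0"
  by (simp_all add: nd_def L2_set_0')

lemma abs_le_L2_set: "finite A \<Longrightarrow> i \<in> A \<Longrightarrow> \<bar>f i\<bar> \<le> L2_set f A"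
  using member_le_L2_set[of A i "\<lambda>i. \<bar>f i\<bar>"] by (simp add: L2_set_def)

lemma nd_commute: "nd n x y = nd n y x"
  by (simp add: nd_def L2_set_def power2_commute)

lemma nd_triangle: "nd n x z \<le> nd n x y + nd n y z"
  using L2_set_triangle_ineq[of "\<lambda>i. x i - y i" "\<lambda>i. y i - z i" "{..<n}"] by (simp add: nd_def)

lemma nd_le_sum: "nd n x y \<le> (\<Sum>i<n. \<bar>x i - y i\<bar>)"
  unfolding nd_def by (rule L2_set_le_sum_abs)

lemma abs_le_nd: "i < n \<Longrightarrow> \<bar>x i - y i\<bar> \<le> nd n x y"
  unfolding nd_def by (rule abs_le_L2_set) auto

lemma nd_scale: "nd n (\<lambda>i. z i + s * u i) (\<lambda>i. z i + t * u i) = \<bar>s - t\<bar> * L2_set u {..<n}"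
proof -
  have "L2_set (\<lambda>i. (s - t) * u i) {..<n} = sqrt ((s - t)\<^sup>2 * (\<Sum>i<n. (u i)\<^sup>2))"
    by (simp add: L2_set_def power_mult_distrib sum_distrib_left)
  then show ?thesis
    by (simp add: nd_def L2_set_def real_sqrt_mult left_diff_distrib)
qed

text \<open>A path of length at most \<open>L\<close> is encoded as a 1-Lipschitz map on the fixed
  interval [0, L]. Resting is allowed, so the notion is monotone in \<open>L\<close>; and for closed
  \<open>S\<close> the conditions, each on one or two parameters, survive pointwise limits.\<close>

definition joined :: "nat \<Rightarrow> (nat \<Rightarrow> real) set \<Rightarrow> (nat \<Rightarrow> real) \<Rightarrow> (nat \<Rightarrow> real) \<Rightarrow> real \<Rightarrow> bool" where
  "joined n S x y L \<longleftrightarrow> 0 \<le> L \<and> (\<exists>g. g 0 = x \<and> g L = y \<and> (\<forall>t\<in>{0..L}. g t \<in> S) \<and>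
    (\<forall>s\<in>{0..L}. \<forall>t\<in>{0..L}. nd n (g s) (g t) \<le> \<bar>s - t\<bar>))"

lemma joined_refl: "x \<in> S \<Longrightarrow> 0 \<le> L \<Longrightarrow> joined n S x x L"
  unfolding joined_def by (auto intro!: exI[of _ "\<lambda>_. x"] simp: nd_self)

lemma joined_subset: "joined n S x y L \<Longrightarrow> S \<subseteq> T \<Longrightarrow> joined n T x y L"
  unfolding joined_def by blast

lemma joined_mem: "joined n S x y L \<Longrightarrow> x \<in> S \<and> y \<in> S"
  unfolding joined_def by force

lemma joined_nonneg: "joined n S x y L \<Longrightarrow> 0 \<le> L"
  unfolding joined_def by blast

lemma joined_sym: assumes "joined n S x y L" shows "joined n S y x L"
proof -
  obtain g where g: "0 \<le> L" "g 0 = x" "g L = y" "\<And>t. t \<in> {0..L} \<Longrightarrow> g t \<in> S"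
    "\<And>s t. s \<in> {0..L} \<Longrightarrow> t \<in> {0..L} \<Longrightarrow> nd n (g s) (g t) \<le> \<bar>s - t\<bar>"
    using assms unfolding joined_def by blast
  have "nd n (g (L - s)) (g (L - t)) \<le> \<bar>s - t\<bar>" if "s \<in> {0..L}" "t \<in> {0..L}" for s t
    using g(5)[of "L - s" "L - t"] that by (simp add: abs_minus_commute)
  then show ?thesis
    unfolding joined_def using g by (auto intro!: exI[of _ "\<lambda>t. g (L - t)"])
qed

lemma joined_trans:
  assumes "joined n S x y L" "joined n S y z M"
  shows "joined n S x z (L + M)"
proof -
  obtain g where g: "0 \<le> L" "g 0 = x" "g L = y" "\<And>t. t \<in> {0..L} \<Longrightarrow> g t \<in> S"
    "\<And>s t. s \<in> {0..L} \<Longrightarrow> t \<in> {0..L} \<Longrightarrow> nd n (g s) (g t) \<le> \<bar>s - t\<bar>"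
    using assms(1) unfolding joined_def by blast
  obtain h where h: "0 \<le> M" "h 0 = y" "h M = z" "\<And>t. t \<in> {0..M} \<Longrightarrow> h t \<in> S"
    "\<And>s t. s \<in> {0..M} \<Longrightarrow> t \<in> {0..M} \<Longrightarrow> nd n (h s) (h t) \<le> \<bar>s - t\<bar>"
    using assms(2) unfolding joined_def by blast
  define k where "k t = (if t \<le> L then g t else h (t - L))" for t
  have cross: "nd n (k s) (k t) \<le> \<bar>s - t\<bar>" if "0 \<le> s" "s \<le> L" "L < t" "t \<le> L + M" for s t
  proof -
    have "nd n (k s) (k t) \<le> nd n (g s) y + nd n y (h (t - L))"
      using that nd_triangle[of n "g s" "h (t - L)" y] by (simp add: k_def)
    also have "nd n (g s) y \<le> L - s" using g(5)[of s L] that g by simp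
    also have "nd n y (h (t - L)) \<le> t - L" using h(5)[of 0 "t - L"] that h by simp
    finally show ?thesis using that by simp
  qed
  have "nd n (k s) (k t) \<le> \<bar>s - t\<bar>" if st: "s \<in> {0..L + M}" "t \<in> {0..L + M}" for s t
  proof -
    consider "s \<le> L" "t \<le> L" | "s \<le> L" "L < t" | "L < s" "t \<le> L" | "L < s" "L < t" by linarith
    then show ?thesis
    proof cases
      case 1
      then show ?thesis using g(5)[of s t] st by (simp add: k_def)
    next
      case 2
      then show ?thesis using cross[of s t] st by simp
    next
      case 3
      then show ?thesis using cross[of t s] st by (simp add: nd_commute abs_minus_commute)
    next
      case 4
      then show ?thesis using h(5)[of "s - L" "t - L"] st by (simp add: k_def)
    qed
  qed
  moreover have "k 0 = x" "k (L + M) = z"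
    using g h by (cases "M = 0"; auto simp: k_def)+
  moreover have "k t \<in> S" if "t \<in> {0..L + M}" for t
    using g(4) h(4) that by (auto simp: k_def)
  ultimately show ?thesis
    unfolding joined_def using g(1) h(1) by (intro conjI exI[of _ k]) auto
qed

lemma joined_weaken: "joined n S x y L \<Longrightarrow> L \<le> M \<Longrightarrow> joined n S x y M"
  using joined_trans[of n S x y L y "M - L"] joined_refl[of y S "M - L" n] joined_mem by fastforce

lemma joined_ray:
  assumes "\<And>t. 0 \<le> t \<Longrightarrow> t \<le> L \<Longrightarrow> (\<lambda>i. x i + t * u i) \<in> S" "0 \<le> L" "L2_set u {..<n} \<le> 1"
  shows "joined n S x (\<lambda>i. x i + L * u i) L"
  unfolding joined_def using assms
  by (auto intro!: exI[of _ "\<lambda>t i. x i + t * u i"] simp: nd_scale mult_left_le)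

lemma joined_segment:
  assumes x: "\<And>t. 0 \<le> t \<Longrightarrow> t \<le> 1 \<Longrightarrow> (\<lambda>i. x i + t * (y i - x i)) \<in> S"
    and L: "nd n x y \<le> L" and 0: "\<And>i. i \<ge> n \<Longrightarrow> x i = 0" "\<And>i. i \<ge> n \<Longrightarrow> y i = 0"
  shows "joined n S x y L"
proof (cases "nd n x y = 0")
  case True
  have "x = y"
  proof
    fix i show "x i = y i"
      using abs_le_nd[of i n x y] True 0 by (cases "i < n") auto
  qed
  moreover have "x \<in> S" using x[of 0] by simp
  ultimately show ?thesis using joined_refl True L by simp
next
  case False
  define D where "D = nd n x y"
  have D: "D > 0" using False nd_nonneg[of n x y] by (simp add: D_def)
  define u where "u i = (y i - x i) / D" for i
  have "L2_set u {..<n} = D / D"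
    using D unfolding u_def D_def nd_def L2_set_def power_divide sum_divide_distrib[symmetric] real_sqrt_divide
    by (simp add: power2_commute)
  moreover have "(\<lambda>i. x i + t * u i) \<in> S" if "0 \<le> t" "t \<le> D" for t
    using x[of "t / D"] that D by (simp add: u_def)
  ultimately have "joined n S x (\<lambda>i. x i + D * u i) D"
    using D by (intro joined_ray) auto
  moreover have "(\<lambda>i. x i + D * u i) = y" using D by (auto simp: u_def)
  ultimately show ?thesis using L joined_weaken D_def by metis
qed

context penalty
begin

abbreviation sub :: "(nat \<Rightarrow> real) \<Rightarrow> (nat \<Rightarrow> real) \<Rightarrow> real \<Rightarrow> (nat \<Rightarrow> real) set" where
  "sub a \<tau> c \<equiv> {x. (\<forall>i\<ge>m. x i = 0) \<and> F a \<tau> x \<le> c}"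

abbreviation slope2 :: "(nat \<Rightarrow> real) \<Rightarrow> (nat \<Rightarrow> real) \<Rightarrow> (nat \<Rightarrow> real) \<Rightarrow> real" where
  "slope2 a \<tau> x \<equiv> (\<Sum>i<m. (grad a \<tau> i x)\<^sup>2)"

lemma sub_bounded: "\<exists>R\<ge>0. \<forall>x\<in>sub a \<tau> c. \<forall>i<m. \<bar>x i\<bar> \<le> R"
proof -
  define R where "R = (\<Sum>i<m. \<bar>a i\<bar>) + \<bar>sqrt (2 * c / \<theta>)\<bar>"
  have "\<bar>x i\<bar> \<le> R" if "F a \<tau> x \<le> c" "i < m" for x i
  proof -
    have "\<bar>x i - a i\<bar> \<le> sqrt (2 * c / \<theta>)"
      using F_coord[OF that(2,1)] real_sqrt_le_mono by fastforce
    moreover have "\<bar>a i\<bar> \<le> (\<Sum>i<m. \<bar>a i\<bar>)" using that by (intro member_le_sum) auto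
    ultimately show ?thesis by (simp add: R_def)
  qed
  then show ?thesis by (intro exI[of _ R]) (auto simp: R_def sum_nonneg)
qed

lemma sum_le_L2: "L2_set u {..<m} \<le> 1 \<Longrightarrow> (\<Sum>i<m. \<bar>u i\<bar>) \<le> real m"
proof -
  assume u: "L2_set u {..<m} \<le> 1"
  have "\<bar>u i\<bar> \<le> 1" if "i < m" for i
    using abs_le_L2_set[of "{..<m}" i u] that u by simp
  then have "(\<Sum>i<m. \<bar>u i\<bar>) \<le> (\<Sum>i<m. 1)" by (intro sum_mono) auto
  then show ?thesis by simp
qed

text \<open>Steepest descent along a polygon. While the slope is at least \<open>\<mu>\<close>, a
  move of length t \<le> t0 lowers \<open>F\<close> by at least t \<mu> / 2, with t0 uniform on the
  sublevel set by Taylor's formula; so the length is at most 2 / \<mu> times the loss of level. In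
  \<open>B\<close> no slope is assumed, and the descent stops there.\<close>

lemma descent:
  assumes \<mu>: "\<mu> > 0" and slope: "\<And>x. \<forall>i\<ge>m. x i = 0 \<Longrightarrow> \<alpha> < F a \<tau> x \<Longrightarrow> F a \<tau> x \<le> \<beta> \<Longrightarrow> x \<notin> B \<Longrightarrow> slope2 a \<tau> x \<ge> \<mu>\<^sup>2"
    and \<alpha>\<beta>: "\<alpha> \<le> \<beta>" and x: "x \<in> sub a \<tau> \<beta>"
  shows "\<exists>y. joined m (sub a \<tau> \<beta>) x y (2 * (\<beta> - \<alpha>) / \<mu>) \<and> (F a \<tau> y \<le> \<alpha> \<or> y \<in> B)"
proof -
  obtain R where R: "R \<ge> 0" "\<And>x i. x \<in> sub a \<tau> \<beta> \<Longrightarrow> i < m \<Longrightarrow> \<bar>x i\<bar> \<le> R"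
    using sub_bounded by blast
  obtain C where C: "C \<ge> 0" "\<And>x y. (\<forall>i<m. \<bar>x i\<bar> \<le> R + 1) \<Longrightarrow> (\<forall>i<m. \<bar>y i\<bar> \<le> R + 1) \<Longrightarrow>
    \<bar>F a \<tau> x - F a \<tau> y - (\<Sum>i<m. pd i (F a \<tau>) y * (x i - y i))\<bar> \<le> C * (\<Sum>i<m. \<bar>x i - y i\<bar>)\<^sup>2"
    using polyfun_taylor[OF polyfun_F] by blast
  define K where "K = C * (real m)\<^sup>2 + 1"
  have K: "K \<ge> 1" using C by (simp add: K_def)
  \<comment> \<open>The second order term, at most \<open>K * t\<^sup>2\<close>, then takes at most
    half of the first order gain \<open>t * \<mu>\<close>.\<close>
  define t0 where "t0 = min 1 (\<mu> / (2 * K))"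
  have t0: "t0 > 0" "t0 \<le> 1" "t0 * K \<le> \<mu> / 2" using \<mu> K by (auto simp: t0_def field_simps min_def)
  have step: "\<exists>u. L2_set u {..<m} \<le> 1 \<and> (\<forall>i\<ge>m. u i = 0) \<and>
      (\<forall>t. 0 \<le> t \<longrightarrow> t \<le> t0 \<longrightarrow> F a \<tau> (\<lambda>i. x i + t * u i) \<le> F a \<tau> x - t * \<mu> / 2)"
    if x: "x \<in> sub a \<tau> \<beta>" "\<alpha> < F a \<tau> x" "x \<notin> B" for x
  proof -
    define V where "V = sqrt (slope2 a \<tau> x)"
    have "\<mu>\<^sup>2 \<le> slope2 a \<tau> x" using slope x by auto
    then have V: "V \<ge> \<mu>" unfolding V_def using \<mu> real_le_rsqrt by blast
    have V2: "V * V = slope2 a \<tau> x" by (simp add: V_def sum_nonneg)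
    define u where "u i = (if i < m then - grad a \<tau> i x / V else 0)" for i
    have "L2_set u {..<m} = L2_set (\<lambda>i. - grad a \<tau> i x / V) {..<m}"
      by (rule L2_set_cong) (auto simp: u_def)
    also have "\<dots> = sqrt (slope2 a \<tau> x / V\<^sup>2)"
      by (simp add: L2_set_def power_divide sum_divide_distrib[symmetric])
    also have "\<dots> = 1" unfolding V2[symmetric] using V \<mu> by (simp add: power2_eq_square)
    finally have u1: "L2_set u {..<m} \<le> 1" by simp
    have ui: "\<bar>u i\<bar> \<le> 1" if "i < m" for i
      using abs_le_L2_set[of "{..<m}" i u] that u1 by simp
    have "F a \<tau> (\<lambda>i. x i + t * u i) \<le> F a \<tau> x - t * \<mu> / 2" if t: "0 \<le> t" "t \<le> t0" for t
    proof -
      let ?y = "\<lambda>i. x i + t * u i"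
      have "(\<Sum>i<m. pd i (F a \<tau>) x * (?y i - x i)) = (\<Sum>i<m. - t / V * (grad a \<tau> i x)\<^sup>2)"
        by (intro sum.cong refl) (simp add: pd_F u_def power2_eq_square)
      also have "\<dots> = - t / V * (V * V)" by (simp add: V2 sum_distrib_left)
      also have "\<dots> = - t * V" using V \<mu> by simp
      finally have lin: "(\<Sum>i<m. pd i (F a \<tau>) x * (?y i - x i)) = - t * V" .
      have xb: "\<forall>i<m. \<bar>x i\<bar> \<le> R + 1" by (auto intro!: add_increasing2 R(2)[OF x(1)])
      have yb: "\<forall>i<m. \<bar>?y i\<bar> \<le> R + 1"
      proof (intro allI impI)
        fix i assume i: "i < m"
        have "\<bar>t * u i\<bar> \<le> 1 * 1" unfolding abs_mult using t t0 ui[OF i] by (intro mult_mono) auto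
        then show "\<bar>?y i\<bar> \<le> R + 1" using R(2)[OF x(1) i] by linarith
      qed
      have "(\<Sum>i<m. \<bar>?y i - x i\<bar>) = t * (\<Sum>i<m. \<bar>u i\<bar>)"
        using t by (simp add: abs_mult sum_distrib_left)
      also have "\<dots> \<le> t * real m" using t sum_le_L2[OF u1] by (intro mult_left_mono)
      finally have "(\<Sum>i<m. \<bar>?y i - x i\<bar>)\<^sup>2 \<le> (t * real m)\<^sup>2" by (intro power_mono) (auto intro: sum_nonneg)
      then have "C * (\<Sum>i<m. \<bar>?y i - x i\<bar>)\<^sup>2 \<le> C * (t * real m)\<^sup>2" using C(1) by (rule mult_left_mono)
      also have "\<dots> \<le> t * (t * K)" by (simp add: K_def power2_eq_square algebra_simps)
      also have "\<dots> \<le> t * (t0 * K)" using t K by (intro mult_left_mono mult_right_mono) auto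
      also have "\<dots> \<le> t * (\<mu> / 2)" using t t0 by (intro mult_left_mono) auto
      finally have "F a \<tau> ?y - F a \<tau> x - (- t * V) \<le> t * (\<mu> / 2)"
        using C(2)[OF yb xb] unfolding lin by linarith
      moreover have "t * \<mu> \<le> t * V" using t V by (intro mult_left_mono) auto
      ultimately show ?thesis by (simp add: field_simps)
    qed
    then show ?thesis using u1 by (intro exI[of _ u]) (auto simp: u_def)
  qed
  have claim: "\<exists>y. joined m (sub a \<tau> \<beta>) x y (2 * (F a \<tau> x - \<alpha>) / \<mu>) \<and> (F a \<tau> y \<le> \<alpha> \<or> y \<in> B)"
    if "x \<in> sub a \<tau> \<beta>" "\<alpha> < F a \<tau> x" "F a \<tau> x \<le> \<alpha> + real N * (t0 * \<mu> / 2)" for x N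
    using that
  proof (induction N arbitrary: x)
    case 0
    then show ?case by simp
  next
    case (Suc N)
    show ?case
    proof (cases "x \<in> B")
      case True
      then show ?thesis using Suc.prems \<mu> by (intro exI[of _ x]) (auto intro!: joined_refl)
    next
      case False
      obtain u where u: "L2_set u {..<m} \<le> 1" "\<forall>i\<ge>m. u i = 0"
        "\<And>t. 0 \<le> t \<Longrightarrow> t \<le> t0 \<Longrightarrow> F a \<tau> (\<lambda>i. x i + t * u i) \<le> F a \<tau> x - t * \<mu> / 2"
        using step[OF Suc.prems(1,2) False] by blast
      let ?y = "\<lambda>t i. x i + t * u i"
      have mem: "?y t \<in> sub a \<tau> \<beta>" if t: "0 \<le> t" "t \<le> t0" for t
      proof -
        have "t * \<mu> / 2 \<ge> 0" using t \<mu> by simp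
        then have "F a \<tau> (?y t) \<le> \<beta>" using u(3)[OF t] Suc.prems(1) by auto
        then show ?thesis using u(2) Suc.prems(1) by auto
      qed
      have ray: "joined m (sub a \<tau> \<beta>) x (?y t) (2 * (F a \<tau> x - F a \<tau> (?y t)) / \<mu>)" if t: "0 \<le> t" "t \<le> t0" for t
      proof -
        have "joined m (sub a \<tau> \<beta>) x (?y t) t"
          using t mem u(1) by (intro joined_ray) auto
        moreover have "t \<le> 2 * (F a \<tau> x - F a \<tau> (?y t)) / \<mu>"
          using u(3)[OF t] \<mu> by (simp add: field_simps)
        ultimately show ?thesis by (rule joined_weaken)
      qed
      show ?thesis
      proof (cases "F a \<tau> (?y t0) \<le> \<alpha>")
        case True
        \<comment> \<open>The last step is shortened so as to end exactly on level
          \<open>\<alpha>\<close>; a full step could be longer than the claimed bound.\<close>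
        have "continuous_on {0..t0} (\<lambda>t. F a \<tau> (?y t))"
          by (intro continuous_at_imp_continuous_on ballI DERIV_isCont[OF polyfun_line_deriv[OF polyfun_F]])
        then obtain t where t: "0 \<le> t" "t \<le> t0" "F a \<tau> (?y t) = \<alpha>"
          using IVT2'[of "\<lambda>t. F a \<tau> (?y t)" t0 \<alpha> 0] True Suc.prems(2) t0(1) by auto
        then show ?thesis using ray[OF t(1,2)] by (intro exI[of _ "?y t"]) auto
      next
        case F: False
        have "F a \<tau> (?y t0) \<le> F a \<tau> x - t0 * \<mu> / 2" using u(3)[of t0] t0 by simp
        moreover have "real (Suc N) * (t0 * \<mu> / 2) = t0 * \<mu> / 2 + real N * (t0 * \<mu> / 2)"
          unfolding of_nat_Suc distrib_right by simp
        ultimately have le: "F a \<tau> (?y t0) \<le> \<alpha> + real N * (t0 * \<mu> / 2)"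
          using Suc.prems(3) by linarith
        obtain y where y: "joined m (sub a \<tau> \<beta>) (?y t0) y (2 * (F a \<tau> (?y t0) - \<alpha>) / \<mu>)" "F a \<tau> y \<le> \<alpha> \<or> y \<in> B"
          using Suc.IH[OF mem[of t0] _ le] t0 F by auto
        have "2 * (F a \<tau> x - F a \<tau> (?y t0)) / \<mu> + 2 * (F a \<tau> (?y t0) - \<alpha>) / \<mu> = 2 * (F a \<tau> x - \<alpha>) / \<mu>"
          by (simp add: add_divide_distrib[symmetric] algebra_simps)
        then have "joined m (sub a \<tau> \<beta>) x y (2 * (F a \<tau> x - \<alpha>) / \<mu>)"
          using joined_trans[OF ray[of t0] y(1)] t0 by simp
        then show ?thesis using y(2) by blast
      qed
    qed
  qed
  show ?thesis
  proof (cases "F a \<tau> x \<le> \<alpha>")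
    case True
    then show ?thesis using x \<alpha>\<beta> \<mu> by (intro exI[of _ x]) (auto intro!: joined_refl)
  next
    case False
    obtain N where "(F a \<tau> x - \<alpha>) / (t0 * \<mu> / 2) \<le> real N" using real_arch_simple by blast
    then have "F a \<tau> x \<le> \<alpha> + real N * (t0 * \<mu> / 2)" using t0 \<mu> by (simp add: field_simps)
    then obtain y where y: "joined m (sub a \<tau> \<beta>) x y (2 * (F a \<tau> x - \<alpha>) / \<mu>)" "F a \<tau> y \<le> \<alpha> \<or> y \<in> B"
      using claim[OF x] False by auto
    have "2 * (F a \<tau> x - \<alpha>) / \<mu> \<le> 2 * (\<beta> - \<alpha>) / \<mu>"
      using x \<mu> by (intro divide_right_mono) auto
    then show ?thesis using y joined_weaken by blast
  qed
qed

end

section \<open>The cost of descending through a level\<close>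

lemma polyfun_near:
  assumes f: "polyfun m f" and \<epsilon>: "\<epsilon> > 0"
  shows "\<exists>r>0. \<forall>x. (\<Sum>i<m. \<bar>x i - p i\<bar>) \<le> r \<longrightarrow> \<bar>f x - f p\<bar> < \<epsilon>"
proof -
  define R where "R = (\<Sum>i<m. \<bar>p i\<bar>) + 1"
  have p: "\<bar>p i\<bar> \<le> R - 1" if "i < m" for i
    unfolding R_def using that by (auto intro: member_le_sum)
  obtain C where C: "C \<ge> 0" "\<And>x y. (\<forall>i<m. \<bar>x i\<bar> \<le> R) \<Longrightarrow> (\<forall>i<m. \<bar>y i\<bar> \<le> R) \<Longrightarrow>
    \<bar>f x - f y\<bar> \<le> C * (\<Sum>i<m. \<bar>x i - y i\<bar>)"
    using polyfun_lipschitz[OF f] by blast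
  define r where "r = min 1 (\<epsilon> / (2 * (C + 1)))"
  have r: "r > 0" "r \<le> 1" "C * r < \<epsilon>"
  proof -
    show "r > 0" "r \<le> 1" using \<epsilon> C(1) by (auto simp: r_def)
    have "C * r \<le> C * (\<epsilon> / (2 * (C + 1)))" using C(1) by (intro mult_left_mono) (auto simp: r_def)
    also have "\<dots> < \<epsilon>" using \<epsilon> C(1) by (simp add: field_simps) (smt (verit) mult_nonneg_nonneg)
    finally show "C * r < \<epsilon>" .
  qed
  have "\<bar>f x - f p\<bar> < \<epsilon>" if x: "(\<Sum>i<m. \<bar>x i - p i\<bar>) \<le> r" for x
  proof -
    have xR: "\<bar>x i\<bar> \<le> R" if "i < m" for i
    proof -
      have "\<bar>x i - p i\<bar> \<le> (\<Sum>i<m. \<bar>x i - p i\<bar>)" using that by (intro member_le_sum[of i "{..<m}" "\<lambda>i. \<bar>x i - p i\<bar>"]) auto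
      then show ?thesis using p[OF that] x r by linarith
    qed
    have "\<bar>f x - f p\<bar> \<le> C * (\<Sum>i<m. \<bar>x i - p i\<bar>)"
      using xR p by (intro C(2)) fastforce+
    also have "\<dots> \<le> C * r" using x C(1) by (intro mult_left_mono)
    finally show ?thesis using r by simp
  qed
  then show ?thesis using r by blast
qed

lemma compact_gap:
  fixes f :: "(nat \<Rightarrow> real) \<Rightarrow> real"
  assumes "compact S" "continuous_on S f" "\<And>x. x \<in> S \<Longrightarrow> f x > 0"
  shows "\<exists>\<delta>>0. \<forall>x\<in>S. f x \<ge> \<delta>"
proof (cases "S = {}")
  case True
  then show ?thesis by (auto intro: exI[of _ 1])
next
  case False
  have "\<exists>x\<in>S. \<forall>y\<in>S. f x \<le> f y" by (rule continuous_attains_inf[OF assms(1) False assms(2)])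
  then obtain x where "x \<in> S" "\<forall>y\<in>S. f x \<le> f y" ..
  then show ?thesis using assms(3) by blast
qed

text \<open>The increment of \<open>clamp1 l u\<close> over an interval is the length of the part
  inside [l, u]. Sums of such functions serve as additive accounts of the range of levels spent near
  exceptional ones.\<close>

definition clamp1 :: "real \<Rightarrow> real \<Rightarrow> real \<Rightarrow> real" where
  "clamp1 l u t = max l (min u t)"

lemma clamp1_mono: "s \<le> t \<Longrightarrow> clamp1 l u s \<le> clamp1 l u t"
  and clamp1_range: "l \<le> u \<Longrightarrow> clamp1 l u t - clamp1 l u s \<le> u - l"
  and clamp1_inside: "l \<le> t \<Longrightarrow> t \<le> u \<Longrightarrow> clamp1 l u t = t"
  by (auto simp: clamp1_def)

text \<open>A displacement of a coordinate becomes an integral over the values passed, as in the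
  Cauchy-Crofton formula; a bound on how often a value is taken then bounds the sum of all
  displacements.\<close>

lemma has_integral_indicator_between:
  fixes u v R :: real
  assumes "\<bar>u\<bar> \<le> R" "\<bar>v\<bar> \<le> R"
  shows "((\<lambda>x. if min u v < x \<and> x < max u v then 1 else 0) has_integral \<bar>u - v\<bar>) {-R..R}"
proof -
  have "((\<lambda>x. 1::real) has_integral (max u v - min u v)) {min u v..max u v}"
    using has_integral_const_real[of "1::real" "min u v" "max u v"] by (simp add: min_def max_def split: if_splits)
  then have "((\<lambda>x. 1::real) has_integral (max u v - min u v)) {min u v<..<max u v}"
    using has_integral_Icc_iff_Ioo by blast
  then have "((\<lambda>x. if x \<in> {min u v<..<max u v} then 1 else (0::real)) has_integral (max u v - min u v)) {-R..R}"
    using assms by (subst has_integral_restrict) auto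
  moreover have "max u v - min u v = \<bar>u - v\<bar>" by auto
  ultimately show ?thesis by (simp add: greaterThanLessThan_iff)
qed

context penalty
begin

definition levels :: "(nat \<Rightarrow> real) \<Rightarrow> (nat \<Rightarrow> real) \<Rightarrow> (nat \<Rightarrow> real) \<Rightarrow> (nat \<Rightarrow> real) \<Rightarrow> nat \<Rightarrow> real \<Rightarrow> real set" where
  "levels a \<tau> \<sigma> w k v = {F a \<tau> x |x s. (x, s) \<in> polar a \<tau> \<sigma> w \<and> x k = v}"

lemma polyfun_slope2: "polyfun m (slope2 a \<tau>)"
  by (intro polyfun_sum polyfun_power polyfun_grad) auto

text \<open>The passage from level \<open>\<beta>\<close> to level \<open>\<alpha>\<close> is paid
  for by the displacement from \<open>u\<close> to \<open>v\<close>: every coordinate value in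
  between is taken by the polar curve on a level strictly between \<open>\<alpha>\<close> and
  \<open>\<beta>\<close>. Strictness keeps the charges of adjacent intervals disjoint.\<close>

definition charged :: "(nat \<Rightarrow> real) \<Rightarrow> (nat \<Rightarrow> real) \<Rightarrow> (nat \<Rightarrow> real) \<Rightarrow> (nat \<Rightarrow> real) \<Rightarrow> real \<Rightarrow> real \<Rightarrow>
    (nat \<Rightarrow> real) \<Rightarrow> (nat \<Rightarrow> real) \<Rightarrow> bool" where
  "charged a \<tau> \<sigma> w \<alpha> \<beta> u v \<longleftrightarrow>
    (\<forall>k<m. \<forall>y. min (u k) (v k) < y \<longrightarrow> y < max (u k) (v k) \<longrightarrow> (\<exists>c'\<in>levels a \<tau> \<sigma> w k y. \<alpha> < c' \<and> c' < \<beta>)) \<and>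
    (\<forall>x\<in>sub a \<tau> \<beta>. \<exists>y. joined m (sub a \<tau> \<beta>) x y (8 * (\<Sum>k<m. \<bar>u k - v k\<bar>)) \<and> F a \<tau> y \<le> \<alpha>)"

text \<open>
  Near a regular level the descent is charged to the displacement of the minimiser \<open>p\<close> of the
  perturbed slope along the polar curve through it.
\<close>

lemma regular_level_cost:
  assumes reg: "regular_level a \<tau> \<sigma> w c" and x0: "\<forall>i\<ge>m. x0 i = 0" "F a \<tau> x0 = c" and c: "c \<le> 1"
    and e0: "e0 > 0" and slope: "\<And>x. \<forall>i\<ge>m. x i = 0 \<Longrightarrow> F a \<tau> x = c \<Longrightarrow> slope2 a \<tau> x \<ge> e0"
    and pert: "\<And>x. x \<in> sub a \<tau> 1 \<Longrightarrow> \<bar>2 * (\<Sum>l<d. \<sigma> l * lam \<tau> l x) + (\<Sum>j<m. w j * x j)\<bar> \<le> e0 / 8"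
  shows "\<exists>\<delta>>0. \<forall>\<alpha> \<beta>. \<alpha> \<le> c \<longrightarrow> c \<le> \<beta> \<longrightarrow> \<beta> - \<alpha> < \<delta> \<longrightarrow> \<beta> \<le> 1 \<longrightarrow>
    (\<exists>u\<in>sub a \<tau> 1. \<exists>v\<in>sub a \<tau> 1. charged a \<tau> \<sigma> w \<alpha> \<beta> u v)"
proof -
  define P where "P x = 2 * (\<Sum>l<d. \<sigma> l * lam \<tau> l x) + (\<Sum>j<m. w j * x j)" for x
  define Ew where "Ew x = E a \<tau> \<sigma> x + (\<Sum>j<m. w j * x j)" for x
  have Ew: "Ew x = slope2 a \<tau> x + P x" for x by (simp add: Ew_def E_def P_def)
  have pW: "polyfun m (\<lambda>x. \<Sum>j<m. w j * x j)" by (intro polyfun_intros) auto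
  have pEw: "polyfun m Ew" unfolding Ew_def[abs_def] by (intro polyfun_add polyfun_E pW)
  have pdEw: "pd j Ew x = pd j (E a \<tau> \<sigma>) x + w j" if j: "j < m" for j x
  proof -
    have "pd j (\<lambda>x. \<Sum>i<m. w i * x i) x = (\<Sum>i<m. pd j (\<lambda>x. w i * x i) x)"
      by (intro pd_sum[where n=m] polyfun_intros) auto
    also have "\<dots> = (\<Sum>i<m. w i * (if j = i then 1 else 0))"
      by (intro sum.cong refl) (simp add: pd_cmult[OF polyfun_var] pd_var)
    also have "\<dots> = w j" using j by (simp add: if_distrib[of "\<lambda>c. _ * c"] cong: if_cong)
    finally show ?thesis unfolding Ew_def[abs_def] using pd_add[OF polyfun_E pW] by simp
  qed
  let ?L = "{x. (\<forall>i\<ge>m. x i = 0) \<and> F a \<tau> x = c}"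
  have "?L = sub a \<tau> c \<inter> {x. F a \<tau> x = c}" by auto
  moreover have "compact (sub a \<tau> c \<inter> {x. F a \<tau> x = c})"
    by (intro compact_Int_closed compact_sublevel closed_Collect_eq continuous_on_polyfun[OF polyfun_F] continuous_intros)
  ultimately have compL: "compact ?L" by (simp only:)
  have "\<exists>x\<in>?L. \<forall>y\<in>?L. Ew x \<le> Ew y"
    by (rule continuous_attains_inf[OF compL _ continuous_on_polyfun[OF pEw]]) (use x0 in auto)
  then obtain p where p: "\<forall>i\<ge>m. p i = 0" "F a \<tau> p = c" "\<And>y. \<forall>i\<ge>m. y i = 0 \<Longrightarrow> F a \<tau> y = c \<Longrightarrow> Ew p \<le> Ew y"
    by blast
  define e1 where "e1 = slope2 a \<tau> p"
  have e1: "e1 \<ge> e0" "e1 > 0" using slope[OF p(1,2)] e0 by (auto simp: e1_def)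
  \<comment> \<open>\<open>p\<close> minimises the perturbed slope; two perturbations of at most
    \<open>e0 / 8\<close> lose at most \<open>e1 / 4\<close> against the true squared slope.\<close>
  have low: "slope2 a \<tau> q \<ge> 3 / 4 * e1" if q: "\<forall>i\<ge>m. q i = 0" "F a \<tau> q = c" for q
  proof -
    have "\<bar>P q\<bar> \<le> e0 / 8" "\<bar>P p\<bar> \<le> e0 / 8"
      unfolding P_def using pert[of q] pert[of p] q p(1,2) c by simp_all
    then show ?thesis using p(3)[OF q] e1 unfolding Ew e1_def[symmetric] by linarith
  qed
  \<comment> \<open>On level \<open>c\<close> the squared slope exceeds \<open>e1 / 4\<close>, hence
    by compactness also on all levels closer than some \<open>\<delta>1\<close>. There the descent
    can use the slope \<open>q1 / 2\<close>.\<close>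
  let ?T = "sub a \<tau> 1 \<inter> {q. slope2 a \<tau> q \<le> e1 / 4}"
  have "compact ?T"
    by (intro compact_Int_closed compact_sublevel closed_Collect_le continuous_on_polyfun[OF polyfun_slope2] continuous_intros)
  moreover have "continuous_on ?T (\<lambda>q. \<bar>F a \<tau> q - c\<bar>)"
    by (intro continuous_intros continuous_on_polyfun[OF polyfun_F])
  moreover have "\<bar>F a \<tau> q - c\<bar> > 0" if q: "q \<in> ?T" for q
  proof -
    have "F a \<tau> q \<noteq> c" using low[of q] q e1 by auto
    then show ?thesis by simp
  qed
  ultimately obtain \<delta>1 where \<delta>1: "\<delta>1 > 0" "\<And>q. q \<in> ?T \<Longrightarrow> \<bar>F a \<tau> q - c\<bar> \<ge> \<delta>1"
    using compact_gap[of ?T "\<lambda>q. \<bar>F a \<tau> q - c\<bar>"] by blast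
  have "\<exists>k<m. grad a \<tau> k p \<noteq> 0"
  proof (rule ccontr)
    assume "\<not> ?thesis"
    then have "e1 = 0" by (simp add: e1_def)
    then show False using e1 by simp
  qed
  then obtain k where k: "k < m" "grad a \<tau> k p \<noteq> 0" by blast
  have "\<exists>s. \<forall>j<m. pd j Ew p + s * pd j (F a \<tau>) p = 0"
    by (rule polyfun_lagrange[OF pEw polyfun_F _ _ k(1)]) (use p k in \<open>auto simp: pd_F\<close>)
  then obtain s where "\<forall>j<m. pd j Ew p + s * pd j (F a \<tau>) p = 0" ..
  then have ps: "(p, s) \<in> polar a \<tau> \<sigma> w"
    using p(1) by (simp add: polar_def pdEw pd_F)
  obtain \<delta>0 K X where X: "\<delta>0 > 0" "K \<ge> 0" "X 0 = p"
    "\<And>t. \<bar>t\<bar> \<le> \<delta>0 \<Longrightarrow> F a \<tau> (X t) = c + t \<and> (\<exists>s'. (X t, s') \<in> polar a \<tau> \<sigma> w)"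
    "\<And>r t. \<bar>r\<bar> \<le> \<delta>0 \<Longrightarrow> \<bar>t\<bar> \<le> \<delta>0 \<Longrightarrow> (\<Sum>i<m. \<bar>X r i - X t i\<bar>) \<le> K * \<bar>r - t\<bar>"
    using reg ps p(2) unfolding regular_level_def by blast
  define q1 where "q1 = sqrt e1"
  have q1: "q1 > 0" "q1 * q1 = e1" using e1 by (auto simp: q1_def)
  have "\<forall>i. \<exists>r>0. i < m \<longrightarrow> (\<forall>x. (\<Sum>i<m. \<bar>x i - p i\<bar>) \<le> r \<longrightarrow> \<bar>grad a \<tau> i x - grad a \<tau> i p\<bar> < q1)"
  proof
    fix i show "\<exists>r>0. i < m \<longrightarrow> (\<forall>x. (\<Sum>i<m. \<bar>x i - p i\<bar>) \<le> r \<longrightarrow> \<bar>grad a \<tau> i x - grad a \<tau> i p\<bar> < q1)"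
      using polyfun_near[OF polyfun_grad[of i] q1(1), of p a \<tau>] by (cases "i < m") (auto intro: exI[of _ 1])
  qed
  then obtain r where r: "\<And>i. r i > 0"
    "\<And>i x. i < m \<Longrightarrow> (\<Sum>i<m. \<bar>x i - p i\<bar>) \<le> r i \<Longrightarrow> \<bar>grad a \<tau> i x - grad a \<tau> i p\<bar> < q1"
    by metis
  define r0 where "r0 = Min (r ` {..<m})"
  have r0: "r0 > 0" "\<And>i. i < m \<Longrightarrow> r0 \<le> r i"
  proof -
    have "r ` {..<m} \<noteq> {}" using k(1) by auto
    then show "r0 > 0" "\<And>i. i < m \<Longrightarrow> r0 \<le> r i" using r(1) by (auto simp: r0_def)
  qed
  have gp: "\<bar>grad a \<tau> i p\<bar> \<le> q1" if "i < m" for i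
  proof -
    have "(grad a \<tau> i p)\<^sup>2 \<le> e1" unfolding e1_def using that by (intro member_le_sum) auto
    then show ?thesis unfolding q1_def using real_le_rsqrt[of "\<bar>grad a \<tau> i p\<bar>" e1] by simp
  qed
  have gx: "\<bar>grad a \<tau> i x\<bar> \<le> 2 * q1" if "i < m" "(\<Sum>i<m. \<bar>x i - p i\<bar>) \<le> r0" for i x
    using r(2)[OF that(1), of x] that r0(2)[OF that(1)] gp[OF that(1)] by linarith
  define \<delta>2 where "\<delta>2 = min \<delta>0 (r0 / (K + 1))"
  have \<delta>2: "\<delta>2 > 0" "\<delta>2 \<le> \<delta>0" using X(1,2) r0 by (auto simp: \<delta>2_def)
  have Xp: "(\<Sum>i<m. \<bar>X t i - p i\<bar>) \<le> r0" if t: "\<bar>t\<bar> \<le> \<delta>2" for t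
  proof -
    have "(\<Sum>i<m. \<bar>X t i - p i\<bar>) \<le> K * \<bar>t\<bar>"
      using X(5)[of t 0] t \<delta>2 X(1,3) by simp
    also have "\<dots> \<le> K * (r0 / (K + 1))" using t X(2) by (intro mult_left_mono) (auto simp: \<delta>2_def)
    also have "\<dots> \<le> r0" using X(2) r0(1) by (simp add: field_simps)
    finally show ?thesis .
  qed
  \<comment> \<open>Conversely the partial derivatives near \<open>p\<close> are at most
    \<open>2 * q1\<close>, so along the arc a difference of levels forces a displacement.\<close>
  have disp: "t - r \<le> 2 * q1 * (\<Sum>i<m. \<bar>X r i - X t i\<bar>)" if rt: "\<bar>r\<bar> \<le> \<delta>2" "\<bar>t\<bar> \<le> \<delta>2" for r t
  proof -
    obtain \<xi> where \<xi>: "0 < \<xi>" "\<xi> < 1" "F a \<tau> (X t) - F a \<tau> (X r) =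
        (\<Sum>i<m. pd i (F a \<tau>) (\<lambda>i. X r i + \<xi> * (X t i - X r i)) * (X t i - X r i))"
      using polyfun_mvt[OF polyfun_F] by blast
    let ?z = "\<lambda>i. X r i + \<xi> * (X t i - X r i)"
    have "(\<Sum>i<m. \<bar>?z i - p i\<bar>) \<le> (\<Sum>i<m. (1 - \<xi>) * \<bar>X r i - p i\<bar> + \<xi> * \<bar>X t i - p i\<bar>)"
    proof (rule sum_mono)
      fix i
      have "?z i - p i = (1 - \<xi>) * (X r i - p i) + \<xi> * (X t i - p i)" by (simp add: algebra_simps)
      then have "\<bar>?z i - p i\<bar> \<le> \<bar>(1 - \<xi>) * (X r i - p i)\<bar> + \<bar>\<xi> * (X t i - p i)\<bar>"
        using abs_triangle_ineq by metis
      then show "\<bar>?z i - p i\<bar> \<le> (1 - \<xi>) * \<bar>X r i - p i\<bar> + \<xi> * \<bar>X t i - p i\<bar>"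
        using \<xi> by (simp add: abs_mult)
    qed
    also have "\<dots> = (1 - \<xi>) * (\<Sum>i<m. \<bar>X r i - p i\<bar>) + \<xi> * (\<Sum>i<m. \<bar>X t i - p i\<bar>)"
      by (simp add: sum.distrib sum_distrib_left)
    also have "\<dots> \<le> (1 - \<xi>) * r0 + \<xi> * r0"
      using \<xi> Xp rt by (intro add_mono mult_left_mono) auto
    finally have z: "(\<Sum>i<m. \<bar>?z i - p i\<bar>) \<le> r0" by (simp add: algebra_simps)
    have "t - r = F a \<tau> (X t) - F a \<tau> (X r)" using X(4) rt \<delta>2 by simp
    also have "\<dots> \<le> (\<Sum>i<m. 2 * q1 * \<bar>X r i - X t i\<bar>)"
      unfolding \<xi>(3)
    proof (rule sum_mono)
      fix i assume i: "i \<in> {..<m}"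
      have "pd i (F a \<tau>) ?z * (X t i - X r i) \<le> \<bar>pd i (F a \<tau>) ?z\<bar> * \<bar>X r i - X t i\<bar>"
        using abs_ge_self[of "pd i (F a \<tau>) ?z * (X t i - X r i)"] by (simp only: abs_mult abs_minus_commute[of "X t i"])
      also have "\<dots> \<le> 2 * q1 * \<bar>X r i - X t i\<bar>"
        using gx[OF _ z, of i] i by (intro mult_right_mono) (auto simp: pd_F)
      finally show "pd i (F a \<tau>) ?z * (X t i - X r i) \<le> 2 * q1 * \<bar>X r i - X t i\<bar>" .
    qed
    finally show ?thesis by (simp add: sum_distrib_left)
  qed
  have main: "\<exists>u\<in>sub a \<tau> 1. \<exists>v\<in>sub a \<tau> 1. charged a \<tau> \<sigma> w \<alpha> \<beta> u v"
    if ab: "\<alpha> \<le> c" "c \<le> \<beta>" "\<beta> - \<alpha> < min \<delta>1 \<delta>2" "\<beta> \<le> 1" for \<alpha> \<beta>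
  proof -
    have small: "\<bar>\<alpha> - c\<bar> \<le> \<delta>2" "\<bar>\<beta> - c\<bar> \<le> \<delta>2" "\<alpha> \<le> 1" using ab by auto
    have mem: "X t \<in> sub a \<tau> 1" if "\<bar>t\<bar> \<le> \<delta>2" "c + t \<le> 1" for t
      using X(4)[of t] that \<delta>2 by (auto simp: polar_def)
    let ?u = "X (\<alpha> - c)" and ?v = "X (\<beta> - c)"
    have uv: "?u \<in> sub a \<tau> 1" "?v \<in> sub a \<tau> 1"
      using mem[of "\<alpha> - c"] mem[of "\<beta> - c"] small ab by simp_all
    have lev: "\<exists>c'\<in>levels a \<tau> \<sigma> w k y. \<alpha> < c' \<and> c' < \<beta>"
      if k: "k < m" and y: "min (?u k) (?v k) < y" "y < max (?u k) (?v k)" for k y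
    proof -
      have "K-lipschitz_on {\<alpha> - c..\<beta> - c} (\<lambda>t. X t k)"
      proof (rule lipschitz_onI)
        fix r t assume "r \<in> {\<alpha> - c..\<beta> - c}" "t \<in> {\<alpha> - c..\<beta> - c}"
        then have rt: "\<bar>r\<bar> \<le> \<delta>0" "\<bar>t\<bar> \<le> \<delta>0" using ab \<delta>2 by auto
        have "\<bar>X r k - X t k\<bar> \<le> (\<Sum>i<m. \<bar>X r i - X t i\<bar>)"
          using k by (intro member_le_sum[of k "{..<m}" "\<lambda>i. \<bar>X r i - X t i\<bar>"]) auto
        then show "dist (X r k) (X t k) \<le> K * dist r t"
          using X(5)[OF rt] by (simp add: dist_real_def)
      qed (rule X(2))
      then have cont: "continuous_on {\<alpha> - c..\<beta> - c} (\<lambda>t. X t k)"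
        by (rule lipschitz_on_continuous_on)
      have le: "\<alpha> - c \<le> \<beta> - c" using ab by simp
      have "\<exists>t. \<alpha> - c \<le> t \<and> t \<le> \<beta> - c \<and> X t k = y"
      proof (cases "?u k \<le> ?v k")
        case True
        then show ?thesis using IVT'[of "\<lambda>t. X t k" "\<alpha> - c" y "\<beta> - c"] y cont le by auto
      next
        case False
        then show ?thesis using IVT2'[of "\<lambda>t. X t k" "\<beta> - c" y "\<alpha> - c"] y cont le by auto
      qed
      then obtain t where t: "\<alpha> - c \<le> t" "t \<le> \<beta> - c" "X t k = y" by blast
      have "t \<noteq> \<alpha> - c" "t \<noteq> \<beta> - c" using t(3) y by (auto simp: min_def max_def split: if_splits)
      then have "\<alpha> < c + t" "c + t < \<beta>" using t by auto
      moreover have "c + t \<in> levels a \<tau> \<sigma> w k y"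
        using X(4)[of t] t ab \<delta>2 unfolding levels_def by force
      ultimately show ?thesis by blast
    qed
    have desc: "\<exists>y. joined m (sub a \<tau> \<beta>) x y (8 * (\<Sum>k<m. \<bar>?u k - ?v k\<bar>)) \<and> F a \<tau> y \<le> \<alpha>"
      if x: "x \<in> sub a \<tau> \<beta>" for x
    proof -
      have "\<exists>y. joined m (sub a \<tau> \<beta>) x y (2 * (\<beta> - \<alpha>) / (q1 / 2)) \<and> (F a \<tau> y \<le> \<alpha> \<or> y \<in> {})"
      proof (rule descent)
        fix z assume z: "\<forall>i\<ge>m. z i = 0" "\<alpha> < F a \<tau> z" "F a \<tau> z \<le> \<beta>"
        have "z \<notin> ?T" using \<delta>1(2)[of z] z ab by auto
        then have "e1 / 4 \<le> slope2 a \<tau> z" using z ab by auto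
        then show "(q1 / 2)\<^sup>2 \<le> slope2 a \<tau> z" using q1 by (simp add: power2_eq_square)
      qed (use q1 ab x in auto)
      then obtain y where y: "joined m (sub a \<tau> \<beta>) x y (2 * (\<beta> - \<alpha>) / (q1 / 2))" "F a \<tau> y \<le> \<alpha>" by blast
      have "\<beta> - \<alpha> \<le> 2 * q1 * (\<Sum>i<m. \<bar>?u i - ?v i\<bar>)"
        using disp[of "\<alpha> - c" "\<beta> - c"] small by simp
      \<comment> \<open>Origin of the 8: a length of 4 (\<beta> - \<alpha>) / q1, where \<beta> -
        \<alpha> is at most 2 q1 times the displacement.\<close>
      then have "2 * (\<beta> - \<alpha>) / (q1 / 2) \<le> 8 * (\<Sum>i<m. \<bar>?u i - ?v i\<bar>)"
        using q1 by (simp add: field_simps)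
      then show ?thesis using y joined_weaken by blast
    qed
    have "charged a \<tau> \<sigma> w \<alpha> \<beta> ?u ?v" unfolding charged_def using lev desc by blast
    then show ?thesis using uv by blast
  qed
  show ?thesis using main \<delta>1(1) \<delta>2(1) by (intro exI[of _ "min \<delta>1 \<delta>2"]) auto
qed

end

context penalty
begin

text \<open>
  Kurdyka's bound: the descent is charged to the variation of the coordinates along the polar curve
  of a small perturbation of the slope, and each coordinate takes a value on few levels only. Short
  intervals of levels around the exceptional ones are paid for with the slope bound away from the
  critical points.
\<close>

lemma descent_total:
  assumes fin: "finite (crit a \<tau>)"
    and gen: "\<And>\<epsilon>. \<epsilon> > 0 \<Longrightarrow> \<exists>\<sigma> w. (\<forall>l. \<bar>\<sigma> l\<bar> < \<epsilon>) \<and> (\<forall>j. \<bar>w j\<bar> < \<epsilon>) \<and>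
      (\<forall>k<m. \<exists>Z. finite Z \<and> (\<forall>v. v \<notin> Z \<longrightarrow> finite (levels a \<tau> \<sigma> w k v) \<and> card (levels a \<tau> \<sigma> w k v) \<le> N)) \<and>
      (\<exists>Z. finite Z \<and> (\<forall>c. c \<notin> Z \<longrightarrow> regular_level a \<tau> \<sigma> w c))"
    and R: "R \<ge> 0" "\<And>x i. x \<in> sub a \<tau> 1 \<Longrightarrow> i < m \<Longrightarrow> \<bar>x i\<bar> \<le> R"
    and x: "x \<in> sub a \<tau> 1"
  shows "\<exists>p\<in>crit a \<tau>. joined m (sub a \<tau> 2) x p (16 * real m * R * real N + 2)"
proof -
  let ?G = "slope2 a \<tau>"
  define Cr where "Cr = crit a \<tau>"
  define V where "V = F a \<tau> ` Cr"
  have finV: "finite V" using fin by (simp add: V_def Cr_def)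
  have G_pos: "?G x > 0" if xC: "\<forall>i\<ge>m. x i = 0" "x \<notin> Cr" for x
  proof -
    obtain i where "i < m" "grad a \<tau> i x \<noteq> 0" using xC by (auto simp: Cr_def crit_def)
    then show ?thesis by (intro sum_pos2[of _ i]) auto
  qed
  have "\<forall>p. \<exists>r>0. \<forall>q. (\<Sum>i<m. \<bar>q i - p i\<bar>) \<le> r \<longrightarrow> \<bar>F a \<tau> q - F a \<tau> p\<bar> < 1 / 2"
    using polyfun_near[OF polyfun_F, of "1/2"] by simp
  then obtain r where r: "\<And>p. r p > 0"
    "\<And>p q. (\<Sum>i<m. \<bar>q i - p i\<bar>) \<le> r p \<Longrightarrow> \<bar>F a \<tau> q - F a \<tau> p\<bar> < 1 / 2"
    by metis
  \<comment> \<open>From within this distance the critical point is reached by a segment of length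
    at most 1 on which \<open>F\<close> is at most 2.\<close>
  define \<rho> where "\<rho> p = min 1 (r p)" for p
  have \<rho>: "\<rho> p > 0" "\<rho> p \<le> 1" "\<rho> p \<le> r p" for p using r(1)[of p] by (auto simp: \<rho>_def)
  define Bl where "Bl = {q. \<exists>p\<in>Cr. (\<Sum>i<m. \<bar>q i - p i\<bar>) < \<rho> p}"
  have "\<exists>\<mu>>0. \<forall>x\<in>sub a \<tau> 1. x \<notin> Bl \<longrightarrow> ?G x \<ge> \<mu>"
  proof -
    let ?S = "sub a \<tau> 1 \<inter> (\<Inter>p\<in>Cr. {q. \<rho> p \<le> (\<Sum>i<m. \<bar>q i - p i\<bar>)})"
    have "compact ?S"
      by (intro compact_Int_closed compact_sublevel closed_INT ballI closed_Collect_le continuous_intros continuous_on_coord)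
    moreover have "?G x > 0" if "x \<in> ?S" for x
      using that \<rho>(1)[of x] by (intro G_pos) auto
    ultimately have "\<exists>\<delta>>0. \<forall>x\<in>?S. ?G x \<ge> \<delta>"
      by (intro compact_gap continuous_on_polyfun[OF polyfun_slope2])
    then obtain \<mu> where "\<mu> > 0" "\<forall>x\<in>?S. ?G x \<ge> \<mu>" by blast
    then show ?thesis by (intro exI[of _ \<mu>]) (auto simp: Bl_def not_less)
  qed
  then obtain \<mu>2 where \<mu>2: "\<mu>2 > 0" "\<And>x. x \<in> sub a \<tau> 1 \<Longrightarrow> x \<notin> Bl \<Longrightarrow> ?G x \<ge> \<mu>2" by blast
  define \<mu> where "\<mu> = sqrt \<mu>2"
  have \<mu>: "\<mu> > 0" "\<mu>\<^sup>2 = \<mu>2" using \<mu>2 by (auto simp: \<mu>_def)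
  \<comment> \<open>The intervals of radius \<open>2 * \<kappa>\<close> around the critical values
    have total length at most \<mu> / 4. Outside \<open>Bl\<close> the slope is at least
    \<open>\<mu>\<close>, so descending through them costs at most 1/2.\<close>
  define \<kappa> where "\<kappa> = \<mu> / (16 * (real (card V) + 1))"
  have \<kappa>: "\<kappa> > 0" using \<mu> by (simp add: \<kappa>_def)
  have "\<exists>e0>0. \<forall>x\<in>sub a \<tau> 1. (\<forall>v\<in>V. \<kappa> \<le> \<bar>F a \<tau> x - v\<bar>) \<longrightarrow> ?G x \<ge> e0"
  proof -
    let ?S = "sub a \<tau> 1 \<inter> (\<Inter>v\<in>V. {q. \<kappa> \<le> \<bar>F a \<tau> q - v\<bar>})"
    have "compact ?S"
      by (intro compact_Int_closed compact_sublevel closed_INT ballI closed_Collect_le continuous_intros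
          continuous_on_polyfun[OF polyfun_F])
    moreover have "?G x > 0" if "x \<in> ?S" for x
      using that \<kappa> by (intro G_pos) (auto simp: V_def)
    ultimately have "\<exists>\<delta>>0. \<forall>x\<in>?S. ?G x \<ge> \<delta>"
      by (intro compact_gap continuous_on_polyfun[OF polyfun_slope2])
    then obtain e0 where "e0 > 0" "\<forall>x\<in>?S. ?G x \<ge> e0" by blast
    then show ?thesis by (intro exI[of _ e0]) auto
  qed
  then obtain e0 where e0: "e0 > 0" "\<And>x. x \<in> sub a \<tau> 1 \<Longrightarrow> (\<And>v. v \<in> V \<Longrightarrow> \<kappa> \<le> \<bar>F a \<tau> x - v\<bar>) \<Longrightarrow> ?G x \<ge> e0"
    by blast
  have "\<forall>l. \<exists>C\<ge>0. l < d \<longrightarrow> (\<forall>x. (\<forall>i<m. \<bar>x i\<bar> \<le> R) \<longrightarrow> \<bar>lam \<tau> l x\<bar> \<le> C)"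
  proof
    fix l show "\<exists>C\<ge>0. l < d \<longrightarrow> (\<forall>x. (\<forall>i<m. \<bar>x i\<bar> \<le> R) \<longrightarrow> \<bar>lam \<tau> l x\<bar> \<le> C)"
    proof (cases "l < d")
      case True
      then show ?thesis using polyfun_bounded[OF polyfun_lam[OF True], of R] by simp
    qed auto
  qed
  then obtain \<Lambda> where \<Lambda>: "\<And>l. \<Lambda> l \<ge> 0" "\<And>l x. l < d \<Longrightarrow> \<forall>i<m. \<bar>x i\<bar> \<le> R \<Longrightarrow> \<bar>lam \<tau> l x\<bar> \<le> \<Lambda> l"
    by metis
  define Q where "Q = 2 * (\<Sum>l<d. \<Lambda> l) + real m * R"
  have Q: "Q \<ge> 0" using \<Lambda>(1) R by (simp add: Q_def sum_nonneg)
  define \<epsilon> where "\<epsilon> = e0 / (8 * (Q + 1))"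
  have \<epsilon>: "\<epsilon> > 0" "\<epsilon> * Q \<le> e0 / 8" using e0(1) Q by (auto simp: \<epsilon>_def field_simps)
  obtain \<sigma> w where sw: "\<forall>l. \<bar>\<sigma> l\<bar> < \<epsilon>" "\<forall>j. \<bar>w j\<bar> < \<epsilon>"
    "\<forall>k<m. \<exists>Z. finite Z \<and> (\<forall>v. v \<notin> Z \<longrightarrow> finite (levels a \<tau> \<sigma> w k v) \<and> card (levels a \<tau> \<sigma> w k v) \<le> N)"
    "\<exists>Z. finite Z \<and> (\<forall>c. c \<notin> Z \<longrightarrow> regular_level a \<tau> \<sigma> w c)"
    using gen[OF \<epsilon>(1)] by blast
  obtain Z where Z: "\<And>k. k < m \<Longrightarrow> finite (Z k)"
    "\<And>k v. k < m \<Longrightarrow> v \<notin> Z k \<Longrightarrow> finite (levels a \<tau> \<sigma> w k v)"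
    "\<And>k v. k < m \<Longrightarrow> v \<notin> Z k \<Longrightarrow> card (levels a \<tau> \<sigma> w k v) \<le> N"
    using sw(3) by metis
  obtain Y where Y: "finite Y" "\<And>c. c \<notin> Y \<Longrightarrow> regular_level a \<tau> \<sigma> w c" using sw(4) by blast
  have pert: "\<bar>2 * (\<Sum>l<d. \<sigma> l * lam \<tau> l x) + (\<Sum>j<m. w j * x j)\<bar> \<le> e0 / 8" if x: "x \<in> sub a \<tau> 1" for x
  proof -
    have le: "\<bar>\<sigma> l\<bar> \<le> \<epsilon>" "\<bar>w l\<bar> \<le> \<epsilon>" for l using sw(1,2) less_imp_le by blast+
    have "\<bar>\<Sum>l<d. \<sigma> l * lam \<tau> l x\<bar> \<le> (\<Sum>l<d. \<epsilon> * \<Lambda> l)"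
      using le(1) \<Lambda>(2)[of _ x] R(2)[OF x] \<epsilon>(1)
      by (intro order_trans[OF sum_abs] sum_mono) (auto simp: abs_mult intro!: mult_mono)
    moreover have "\<bar>\<Sum>j<m. w j * x j\<bar> \<le> (\<Sum>j<m. \<epsilon> * R)"
      using le(2) R(2)[OF x] \<epsilon>(1)
      by (intro order_trans[OF sum_abs] sum_mono) (auto simp: abs_mult intro!: mult_mono)
    ultimately have "\<bar>2 * (\<Sum>l<d. \<sigma> l * lam \<tau> l x) + (\<Sum>j<m. w j * x j)\<bar> \<le> 2 * (\<Sum>l<d. \<epsilon> * \<Lambda> l) + (\<Sum>j<m. \<epsilon> * R)"
      by linarith
    also have "\<dots> = \<epsilon> * Q" by (simp add: Q_def sum_distrib_left[symmetric] algebra_simps)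
    finally show ?thesis using \<epsilon>(2) by linarith
  qed
  \<comment> \<open>The exceptional set \<open>Y\<close> depends on the perturbation, which had to
    be small relative to \<open>e0\<close>. But \<open>\<mu>\<close> depends on neither, so
    \<open>\<kappa>'\<close> can be chosen last.\<close>
  define \<kappa>' where "\<kappa>' = \<mu> / (8 * (real (card Y) + 1))"
  have \<kappa>': "\<kappa>' > 0" using \<mu> by (simp add: \<kappa>'_def)
  \<comment> \<open>The account of the levels near \<open>V\<close> and \<open>Y\<close>: 2 / \<mu>
    times its increment is the price of an interval there. It is additive over adjacent intervals,
    and the total price is at most 1.\<close>
  define b where "b t = (\<Sum>c\<in>V. clamp1 (c - 2 * \<kappa>) (c + 2 * \<kappa>) t) + (\<Sum>c\<in>Y. clamp1 (c - \<kappa>') (c + \<kappa>') t)" for t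
  have b_mono: "b s \<le> b t" if "s \<le> t" for s t
    unfolding b_def using that by (intro add_mono sum_mono clamp1_mono)
  have b_total: "2 / \<mu> * (b t - b s) \<le> 1" for s t
  proof -
    have "b t - b s = (\<Sum>c\<in>V. clamp1 (c - 2 * \<kappa>) (c + 2 * \<kappa>) t - clamp1 (c - 2 * \<kappa>) (c + 2 * \<kappa>) s) +
        (\<Sum>c\<in>Y. clamp1 (c - \<kappa>') (c + \<kappa>') t - clamp1 (c - \<kappa>') (c + \<kappa>') s)"
      by (simp add: b_def sum_subtractf)
    also have "\<dots> \<le> (\<Sum>c\<in>V. 4 * \<kappa>) + (\<Sum>c\<in>Y. 2 * \<kappa>')"
      using \<kappa> \<kappa>' by (intro add_mono sum_mono order_trans[OF clamp1_range]) auto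
    also have "\<dots> = real (card V) * (4 * \<kappa>) + real (card Y) * (2 * \<kappa>')" by simp
    also have "\<dots> \<le> \<mu> / 4 + \<mu> / 4"
      using \<mu>(1) by (intro add_mono) (auto simp: \<kappa>_def \<kappa>'_def field_simps)
    finally show ?thesis using \<mu>(1) by (simp add: field_simps)
  qed
  have bV: "\<beta> - \<alpha> \<le> b \<beta> - b \<alpha>" if "v \<in> V" "v - 2 * \<kappa> \<le> \<alpha>" "\<alpha> \<le> \<beta>" "\<beta> \<le> v + 2 * \<kappa>" for v \<alpha> \<beta>
  proof -
    let ?h = "\<lambda>c. clamp1 (c - 2 * \<kappa>) (c + 2 * \<kappa>) \<beta> - clamp1 (c - 2 * \<kappa>) (c + 2 * \<kappa>) \<alpha>"
    have "\<beta> - \<alpha> = ?h v" using that by (simp add: clamp1_inside)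
    also have "\<dots> \<le> (\<Sum>c\<in>V. ?h c)"
      using that finV by (intro member_le_sum) (auto simp: clamp1_mono)
    also have "\<dots> \<le> b \<beta> - b \<alpha>"
      unfolding b_def sum_subtractf using that sum_mono[of Y "\<lambda>c. clamp1 (c - \<kappa>') (c + \<kappa>') \<alpha>" "\<lambda>c. clamp1 (c - \<kappa>') (c + \<kappa>') \<beta>"]
      by (simp add: clamp1_mono)
    finally show ?thesis .
  qed
  have bY: "\<beta> - \<alpha> \<le> b \<beta> - b \<alpha>" if "v \<in> Y" "v - \<kappa>' \<le> \<alpha>" "\<alpha> \<le> \<beta>" "\<beta> \<le> v + \<kappa>'" for v \<alpha> \<beta>
  proof -
    let ?h = "\<lambda>c. clamp1 (c - \<kappa>') (c + \<kappa>') \<beta> - clamp1 (c - \<kappa>') (c + \<kappa>') \<alpha>"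
    have "\<beta> - \<alpha> = ?h v" using that by (simp add: clamp1_inside)
    also have "\<dots> \<le> (\<Sum>c\<in>Y. ?h c)"
      using that Y(1) by (intro member_le_sum) (auto simp: clamp1_mono)
    also have "\<dots> \<le> b \<beta> - b \<alpha>"
      unfolding b_def sum_subtractf using that sum_mono[of V "\<lambda>c. clamp1 (c - 2 * \<kappa>) (c + 2 * \<kappa>) \<alpha>" "\<lambda>c. clamp1 (c - 2 * \<kappa>) (c + 2 * \<kappa>) \<beta>"]
      by (simp add: clamp1_mono)
    finally show ?thesis .
  qed
  define L where "L k v \<alpha> \<beta> = {c \<in> levels a \<tau> \<sigma> w k v. \<alpha> < c \<and> c < \<beta>}" for k v \<alpha> \<beta>
  \<comment> \<open>\<open>f k v\<close> records how often the value \<open>v\<close> of coordinate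
    \<open>k\<close> has been charged, with at most one charge per level on which the polar curve
    takes it; the integral \<open>\<iota> k\<close> is the displacement charged.\<close>
  define charge where "charge \<alpha> \<beta> f \<iota> \<longleftrightarrow> (\<forall>k<m. (f k has_integral \<iota> k) {-R..R} \<and>
      (\<forall>v. 0 \<le> f k v \<and> (v \<notin> Z k \<longrightarrow> f k v \<le> real (card (L k v \<alpha> \<beta>)))))"
    for \<alpha> \<beta> and f :: "nat \<Rightarrow> real \<Rightarrow> real" and \<iota>
  define cost where "cost \<alpha> \<beta> \<iota> = 8 * (\<Sum>k<m. \<iota> k) + 2 / \<mu> * (b \<beta> - b \<alpha>)" for \<alpha> \<beta> and \<iota> :: "nat \<Rightarrow> real"
  define P where "P \<alpha> \<beta> \<longleftrightarrow> (\<beta> \<le> 1 \<longrightarrow> (\<exists>f \<iota>. charge \<alpha> \<beta> f \<iota> \<and>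
      (\<forall>x\<in>sub a \<tau> \<beta>. \<exists>y. joined m (sub a \<tau> 1) x y (cost \<alpha> \<beta> \<iota>) \<and> (F a \<tau> y \<le> \<alpha> \<or> y \<in> Bl))))" for \<alpha> \<beta>
  have charge0: "charge \<alpha> \<beta> (\<lambda>_ _. 0) (\<lambda>_. 0)" for \<alpha> \<beta>
    by (simp add: charge_def)
  have charge_nonneg: "\<iota> k \<ge> 0" if "charge \<alpha> \<beta> f \<iota>" "k < m" for \<alpha> \<beta> f \<iota> k
    using that has_integral_nonneg[of "f k" "\<iota> k" "{-R..R}"] by (simp add: charge_def)
  have cost_nonneg: "cost \<alpha> \<beta> \<iota> \<ge> 0" if "charge \<alpha> \<beta> f \<iota>" "\<alpha> \<le> \<beta>" for \<alpha> \<beta> f \<iota>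
    using charge_nonneg[OF that(1)] b_mono[OF that(2)] \<mu>(1) unfolding cost_def
    by (intro add_nonneg_nonneg mult_nonneg_nonneg sum_nonneg) auto
  \<comment> \<open>Subdivision of the range of levels: \<open>P\<close> passes from two adjacent
    intervals to their union and holds for short intervals around each level. The range starts below
    0, the least conceivable value of \<open>F\<close>, so the descent can end only in
    \<open>Bl\<close>.\<close>
  have "P (-1) 1"
  proof (rule Bolzano)
    show "(-1::real) \<le> 1" by simp
  next
    fix \<alpha> \<beta> \<gamma> assume P1: "P \<alpha> \<beta>" and P2: "P \<beta> \<gamma>" and le: "\<alpha> \<le> \<beta>" "\<beta> \<le> \<gamma>"
    show "P \<alpha> \<gamma>"
      unfolding P_def
    proof
      assume \<gamma>: "\<gamma> \<le> 1"
      obtain f \<iota> where f: "charge \<alpha> \<beta> f \<iota>"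
        "\<And>x. x \<in> sub a \<tau> \<beta> \<Longrightarrow> \<exists>y. joined m (sub a \<tau> 1) x y (cost \<alpha> \<beta> \<iota>) \<and> (F a \<tau> y \<le> \<alpha> \<or> y \<in> Bl)"
        using P1 \<gamma> le unfolding P_def by auto
      obtain g \<eta> where g: "charge \<beta> \<gamma> g \<eta>"
        "\<And>x. x \<in> sub a \<tau> \<gamma> \<Longrightarrow> \<exists>y. joined m (sub a \<tau> 1) x y (cost \<beta> \<gamma> \<eta>) \<and> (F a \<tau> y \<le> \<beta> \<or> y \<in> Bl)"
        using P2 \<gamma> unfolding P_def by auto
      define f' where "f' k v = f k v + g k v" for k v
      define \<iota>' where "\<iota>' k = \<iota> k + \<eta> k" for k
      have "f' k v \<le> real (card (L k v \<alpha> \<gamma>))" if k: "k < m" and v: "v \<notin> Z k" for k v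
      proof -
        have fl: "finite (levels a \<tau> \<sigma> w k v)" using Z(2) k v by blast
        then have fL: "finite (L k v \<alpha> \<beta>)" "finite (L k v \<beta> \<gamma>)" "finite (L k v \<alpha> \<gamma>)" by (auto simp: L_def)
        have "f' k v \<le> real (card (L k v \<alpha> \<beta>) + card (L k v \<beta> \<gamma>))"
          using f(1) g(1) k v by (auto simp: charge_def f'_def intro: add_mono)
        also have "card (L k v \<alpha> \<beta>) + card (L k v \<beta> \<gamma>) = card (L k v \<alpha> \<beta> \<union> L k v \<beta> \<gamma>)"
          using fL by (intro card_Un_disjoint[symmetric]) (auto simp: L_def)
        also have "\<dots> \<le> card (L k v \<alpha> \<gamma>)"
          using fL(3) le by (intro card_mono) (auto simp: L_def)
        finally show ?thesis by simp
      qed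
      then have ch: "charge \<alpha> \<gamma> f' \<iota>'"
        using f(1) g(1) unfolding charge_def f'_def \<iota>'_def by (auto intro: has_integral_add)
      have costs: "cost \<alpha> \<gamma> \<iota>' = cost \<beta> \<gamma> \<eta> + cost \<alpha> \<beta> \<iota>"
        by (simp add: cost_def \<iota>'_def sum.distrib algebra_simps diff_divide_distrib)
      have "\<exists>y. joined m (sub a \<tau> 1) x y (cost \<alpha> \<gamma> \<iota>') \<and> (F a \<tau> y \<le> \<alpha> \<or> y \<in> Bl)" if x: "x \<in> sub a \<tau> \<gamma>" for x
      proof -
        obtain y where y: "joined m (sub a \<tau> 1) x y (cost \<beta> \<gamma> \<eta>)" "F a \<tau> y \<le> \<beta> \<or> y \<in> Bl"
          using g(2)[OF x] by blast
        show ?thesis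
        proof (cases "y \<in> Bl")
          case True
          have "cost \<beta> \<gamma> \<eta> \<le> cost \<alpha> \<gamma> \<iota>'" using cost_nonneg[OF f(1) le(1)] by (simp add: costs)
          then show ?thesis using True y(1) joined_weaken by blast
        next
          case False
          then have "y \<in> sub a \<tau> \<beta>" using y joined_mem[OF y(1)] by auto
          then obtain z where z: "joined m (sub a \<tau> 1) y z (cost \<alpha> \<beta> \<iota>)" "F a \<tau> z \<le> \<alpha> \<or> z \<in> Bl"
            using f(2) by blast
          then show ?thesis using joined_trans[OF y(1) z(1)] by (auto simp: costs)
        qed
      qed
      then show "\<exists>f \<iota>. charge \<alpha> \<gamma> f \<iota> \<and>
          (\<forall>x\<in>sub a \<tau> \<gamma>. \<exists>y. joined m (sub a \<tau> 1) x y (cost \<alpha> \<gamma> \<iota>) \<and> (F a \<tau> y \<le> \<alpha> \<or> y \<in> Bl))"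
        using ch by blast
    qed
  next
    fix c :: real assume c: "-1 \<le> c" "c \<le> 1"
    have uncharged: "P \<alpha> \<beta>" if ab: "\<alpha> \<le> \<beta>" "\<beta> - \<alpha> \<le> b \<beta> - b \<alpha>" for \<alpha> \<beta>
      unfolding P_def
    proof
      assume \<beta>: "\<beta> \<le> 1"
      have "\<exists>y. joined m (sub a \<tau> 1) x y (cost \<alpha> \<beta> (\<lambda>_. 0)) \<and> (F a \<tau> y \<le> \<alpha> \<or> y \<in> Bl)" if x: "x \<in> sub a \<tau> \<beta>" for x
      proof -
        have "\<exists>y. joined m (sub a \<tau> \<beta>) x y (2 * (\<beta> - \<alpha>) / \<mu>) \<and> (F a \<tau> y \<le> \<alpha> \<or> y \<in> Bl)"
          using \<mu> \<mu>2 \<beta> ab x by (intro descent) auto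
        then obtain y where y: "joined m (sub a \<tau> \<beta>) x y (2 * (\<beta> - \<alpha>) / \<mu>)" "F a \<tau> y \<le> \<alpha> \<or> y \<in> Bl" by blast
        have "2 * (\<beta> - \<alpha>) / \<mu> \<le> 2 / \<mu> * (b \<beta> - b \<alpha>)"
          using mult_left_mono[OF ab(2), of "2 / \<mu>"] \<mu>(1) by simp
        then have "joined m (sub a \<tau> \<beta>) x y (cost \<alpha> \<beta> (\<lambda>_. 0))"
          using joined_weaken[OF y(1)] by (simp add: cost_def)
        moreover have "sub a \<tau> \<beta> \<subseteq> sub a \<tau> 1" using \<beta> by auto
        ultimately show ?thesis using y(2) joined_subset by blast
      qed
      then show "\<exists>f \<iota>. charge \<alpha> \<beta> f \<iota> \<and>
          (\<forall>x\<in>sub a \<tau> \<beta>. \<exists>y. joined m (sub a \<tau> 1) x y (cost \<alpha> \<beta> \<iota>) \<and> (F a \<tau> y \<le> \<alpha> \<or> y \<in> Bl))"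
        using charge0 by blast
    qed
    \<comment> \<open>Levels without points cost nothing; those close to critical values or in
      \<open>Y\<close> are booked on \<open>b\<close>; the others are charged to the polar curve,
      where the distance \<open>\<kappa>\<close> from the critical values supplies the slope
      \<open>e0\<close>.\<close>
    consider (empty) "\<forall>x\<in>sub a \<tau> 1. F a \<tau> x \<noteq> c" | (crit) v where "v \<in> V" "\<bar>c - v\<bar> < \<kappa>" | (exc) "c \<in> Y"
      | (reg) x0 where "x0 \<in> sub a \<tau> 1" "F a \<tau> x0 = c" "\<And>v. v \<in> V \<Longrightarrow> \<kappa> \<le> \<bar>c - v\<bar>" "c \<notin> Y"
      by (meson not_le)
    then show "\<exists>d>0. \<forall>\<alpha> \<beta>. \<alpha> \<le> c \<and> c \<le> \<beta> \<and> \<beta> - \<alpha> < d \<longrightarrow> P \<alpha> \<beta>"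
    proof cases
      case empty
      then have "\<bar>F a \<tau> x - c\<bar> > 0" if "x \<in> sub a \<tau> 1" for x using that by auto
      moreover have "continuous_on (sub a \<tau> 1) (\<lambda>x. \<bar>F a \<tau> x - c\<bar>)"
        by (intro continuous_intros continuous_on_polyfun[OF polyfun_F])
      ultimately obtain d where d: "d > 0" "\<And>x. x \<in> sub a \<tau> 1 \<Longrightarrow> d \<le> \<bar>F a \<tau> x - c\<bar>"
        using compact_gap[OF compact_sublevel, of a \<tau> 1 "\<lambda>x. \<bar>F a \<tau> x - c\<bar>"] by blast
      have "P \<alpha> \<beta>" if ab: "\<alpha> \<le> c" "c \<le> \<beta>" "\<beta> - \<alpha> < d" for \<alpha> \<beta>
        unfolding P_def
      proof
        assume \<beta>: "\<beta> \<le> 1"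
        have "joined m (sub a \<tau> 1) x x (cost \<alpha> \<beta> (\<lambda>_. 0)) \<and> F a \<tau> x \<le> \<alpha>" if x: "x \<in> sub a \<tau> \<beta>" for x
        proof -
          have x1: "x \<in> sub a \<tau> 1" using x \<beta> by auto
          then have "F a \<tau> x \<le> \<alpha>" using d(2)[OF x1] x ab by auto
          then show ?thesis using x1 ab cost_nonneg[OF charge0] by (auto intro: joined_refl)
        qed
        then show "\<exists>f \<iota>. charge \<alpha> \<beta> f \<iota> \<and>
          (\<forall>x\<in>sub a \<tau> \<beta>. \<exists>y. joined m (sub a \<tau> 1) x y (cost \<alpha> \<beta> \<iota>) \<and> (F a \<tau> y \<le> \<alpha> \<or> y \<in> Bl))"
          using charge0 by blast
      qed
      then show ?thesis using d(1) by blast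
    next
      case (crit v)
      have "P \<alpha> \<beta>" if "\<alpha> \<le> c" "c \<le> \<beta>" "\<beta> - \<alpha> < \<kappa>" for \<alpha> \<beta>
        using that crit by (intro uncharged bV[of v]) auto
      then show ?thesis using \<kappa> by blast
    next
      case exc
      have "P \<alpha> \<beta>" if "\<alpha> \<le> c" "c \<le> \<beta>" "\<beta> - \<alpha> < \<kappa>'" for \<alpha> \<beta>
        using that exc by (intro uncharged bY[of c]) auto
      then show ?thesis using \<kappa>' by blast
    next
      case (reg x0)
      have slope: "?G z \<ge> e0" if "\<forall>i\<ge>m. z i = 0" "F a \<tau> z = c" for z
        using that reg(3) c by (intro e0(2)) auto
      obtain d where d: "d > 0" "\<And>\<alpha> \<beta>. \<alpha> \<le> c \<Longrightarrow> c \<le> \<beta> \<Longrightarrow> \<beta> - \<alpha> < d \<Longrightarrow> \<beta> \<le> 1 \<Longrightarrow>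
        (\<exists>u\<in>sub a \<tau> 1. \<exists>v\<in>sub a \<tau> 1. charged a \<tau> \<sigma> w \<alpha> \<beta> u v)"
        using regular_level_cost[OF Y(2)[OF reg(4)] _ reg(2) c(2) e0(1) slope pert] reg(1) by blast
      have "P \<alpha> \<beta>" if ab: "\<alpha> \<le> c" "c \<le> \<beta>" "\<beta> - \<alpha> < d" for \<alpha> \<beta>
        unfolding P_def
      proof
        assume \<beta>: "\<beta> \<le> 1"
        obtain u v where uv0: "u \<in> sub a \<tau> 1" "v \<in> sub a \<tau> 1" "charged a \<tau> \<sigma> w \<alpha> \<beta> u v"
          using d(2)[OF ab \<beta>] by blast
        then have uv: "u \<in> sub a \<tau> 1" "v \<in> sub a \<tau> 1"
          "\<And>k y. k < m \<Longrightarrow> min (u k) (v k) < y \<Longrightarrow> y < max (u k) (v k) \<Longrightarrow> (\<exists>c'\<in>levels a \<tau> \<sigma> w k y. \<alpha> < c' \<and> c' < \<beta>)"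
          "\<And>x. x \<in> sub a \<tau> \<beta> \<Longrightarrow> \<exists>y. joined m (sub a \<tau> \<beta>) x y (8 * (\<Sum>k<m. \<bar>u k - v k\<bar>)) \<and> F a \<tau> y \<le> \<alpha>"
          unfolding charged_def by simp_all
        define f where "f k y = (if min (u k) (v k) < y \<and> y < max (u k) (v k) then 1 else 0::real)" for k y
        have "(f k has_integral \<bar>u k - v k\<bar>) {-R..R}" if "k < m" for k
          unfolding f_def[abs_def] using uv R(2) that by (intro has_integral_indicator_between) auto
        moreover have "f k y \<le> real (card (L k y \<alpha> \<beta>))" if "k < m" "y \<notin> Z k" for k y
        proof (cases "min (u k) (v k) < y \<and> y < max (u k) (v k)")
          case True
          then have "L k y \<alpha> \<beta> \<noteq> {}" using uv(3)[OF that(1)] by (auto simp: L_def)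
          moreover have "finite (L k y \<alpha> \<beta>)" using Z(2)[OF that] by (simp add: L_def)
          ultimately have "card (L k y \<alpha> \<beta>) > 0" by (simp add: card_gt_0_iff)
          then show ?thesis by (simp add: f_def)
        qed (auto simp: f_def)
        ultimately have ch: "charge \<alpha> \<beta> f (\<lambda>k. \<bar>u k - v k\<bar>)"
          by (auto simp: charge_def f_def)
        have "\<exists>y. joined m (sub a \<tau> 1) x y (cost \<alpha> \<beta> (\<lambda>k. \<bar>u k - v k\<bar>)) \<and> (F a \<tau> y \<le> \<alpha> \<or> y \<in> Bl)" if x: "x \<in> sub a \<tau> \<beta>" for x
        proof -
          obtain y where y: "joined m (sub a \<tau> \<beta>) x y (8 * (\<Sum>k<m. \<bar>u k - v k\<bar>))" "F a \<tau> y \<le> \<alpha>"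
            using uv(4)[OF x] by blast
          have "8 * (\<Sum>k<m. \<bar>u k - v k\<bar>) \<le> cost \<alpha> \<beta> (\<lambda>k. \<bar>u k - v k\<bar>)"
            using b_mono[of \<alpha> \<beta>] ab \<mu>(1) by (simp add: cost_def)
          then have "joined m (sub a \<tau> \<beta>) x y (cost \<alpha> \<beta> (\<lambda>k. \<bar>u k - v k\<bar>))"
            using y(1) joined_weaken by blast
          moreover have "sub a \<tau> \<beta> \<subseteq> sub a \<tau> 1" using \<beta> by auto
          ultimately show ?thesis using y(2) joined_subset by blast
        qed
        then show "\<exists>f \<iota>. charge \<alpha> \<beta> f \<iota> \<and>
          (\<forall>x\<in>sub a \<tau> \<beta>. \<exists>y. joined m (sub a \<tau> 1) x y (cost \<alpha> \<beta> \<iota>) \<and> (F a \<tau> y \<le> \<alpha> \<or> y \<in> Bl))"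
          using ch by blast
      qed
      then show ?thesis using d(1) by blast
    qed
  qed
  then obtain f \<iota> where f: "charge (-1) 1 f \<iota>"
    "\<And>x. x \<in> sub a \<tau> 1 \<Longrightarrow> \<exists>y. joined m (sub a \<tau> 1) x y (cost (-1) 1 \<iota>) \<and> (F a \<tau> y \<le> -1 \<or> y \<in> Bl)"
    unfolding P_def by auto
  have "\<iota> k \<le> real N * (2 * R)" if k: "k < m" for k
  proof -
    \<comment> \<open>Outside the finite set \<open>Z k\<close> a value is charged at most
      \<open>N\<close> times, and only values in [-R, R] are charged.\<close>
    have "norm (\<iota> k) \<le> real N * measure lborel (cbox (-R) R)"
    proof (rule has_integral_bound_spike_finite)
      show "finite (Z k)" using Z(1) k .
      show "(f k has_integral \<iota> k) (cbox (-R) R)" using f(1) k by (simp add: charge_def)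
      fix v assume "v \<in> cbox (-R) R - Z k"
      then have v: "v \<notin> Z k" by simp
      then have fv: "0 \<le> f k v" "f k v \<le> real (card (L k v (-1) 1))" using f(1) k by (auto simp: charge_def)
      have "card (L k v (-1) 1) \<le> card (levels a \<tau> \<sigma> w k v)"
        using Z(2)[OF k v] by (intro card_mono) (auto simp: L_def)
      also have "\<dots> \<le> N" using Z(3)[OF k v] .
      finally show "norm (f k v) \<le> real N" using fv by simp
    qed simp
    then show ?thesis using R(1) by simp
  qed
  then have "8 * (\<Sum>k<m. \<iota> k) \<le> 8 * (\<Sum>k<m. real N * (2 * R))" by (intro mult_left_mono sum_mono) auto
  also have "\<dots> = 16 * real m * R * real N" by simp
  finally have "8 * (\<Sum>k<m. \<iota> k) \<le> 16 * real m * R * real N" .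
  then have cost: "cost (-1) 1 \<iota> \<le> 16 * real m * R * real N + 1"
    using b_total[of 1 "-1"] unfolding cost_def by linarith
  obtain y where y: "joined m (sub a \<tau> 1) x y (cost (-1) 1 \<iota>)" "F a \<tau> y \<le> -1 \<or> y \<in> Bl"
    using f(2)[OF x] by blast
  then have "y \<in> Bl" using F_nonneg[of a \<tau> y] by auto
  then obtain p where p: "p \<in> Cr" "(\<Sum>i<m. \<bar>y i - p i\<bar>) < \<rho> p" by (auto simp: Bl_def)
  have y1: "y \<in> sub a \<tau> 1" using joined_mem[OF y(1)] by blast
  have ps: "\<forall>i\<ge>m. p i = 0" using p(1) by (simp add: Cr_def crit_def)
  have Fp: "F a \<tau> p \<le> 3 / 2"
    using r(2)[of y p] p \<rho>(3)[of p] y1 by (auto simp: abs_if split: if_splits)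
  have "joined m (sub a \<tau> 2) y p 1"
  proof (rule joined_segment)
    fix t :: real assume t: "0 \<le> t" "t \<le> 1"
    have "(\<Sum>i<m. \<bar>y i + t * (p i - y i) - p i\<bar>) = (1 - t) * (\<Sum>i<m. \<bar>y i - p i\<bar>)"
    proof -
      have "y i + t * (p i - y i) - p i = (1 - t) * (y i - p i)" for i by (simp add: algebra_simps)
      then show ?thesis using t by (simp add: abs_mult sum_distrib_left)
    qed
    also have "\<dots> \<le> (\<Sum>i<m. \<bar>y i - p i\<bar>)"
      using t by (intro mult_left_le_one_le) (auto intro: sum_nonneg)
    finally have "(\<Sum>i<m. \<bar>y i + t * (p i - y i) - p i\<bar>) \<le> r p" using p(2) \<rho>(3)[of p] by linarith
    from r(2)[OF this] have "F a \<tau> (\<lambda>i. y i + t * (p i - y i)) \<le> 2" using Fp by linarith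
    then show "(\<lambda>i. y i + t * (p i - y i)) \<in> sub a \<tau> 2" using ps y1 by auto
  next
    show "nd m y p \<le> 1" using nd_le_sum[of m y p] p(2) \<rho>(2)[of p] by linarith
  qed (use ps y1 in auto)
  moreover have "joined m (sub a \<tau> 2) x y (16 * real m * R * real N + 1)"
    by (rule joined_subset[OF joined_weaken[OF y(1) cost]]) auto
  \<comment> \<open>Of the final summand 2, one unit pays for the levels booked on \<open>b\<close>
    and one for the last segment.\<close>
  ultimately have "joined m (sub a \<tau> 2) x p (16 * real m * R * real N + 1 + 1)"
    using joined_trans by blast
  then have "joined m (sub a \<tau> 2) x p (16 * real m * R * real N + 2)" by (simp add: add.commute)
  then show ?thesis using p(1) unfolding Cr_def by blast
qed

end

section \<open>Simultaneous choice of the parameters\<close>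

lemma polyfun_finite_zeros:
  assumes "polyfun n f" "f x \<noteq> 0"
  shows "finite {t. f (x(i := t)) = 0}"
proof -
  obtain p :: "real poly" where p: "\<And>t. f (\<lambda>j. (x(i := 0)) j + t * (if j = i then 1 else 0)) = poly p t"
    using polyfun_line_poly[OF assms(1)] by meson
  have "(\<lambda>j. (x(i := 0)) j + t * (if j = i then 1 else 0)) = x(i := t)" for t by auto
  then have p: "f (x(i := t)) = poly p t" for t using p by simp
  have "poly p (x i) \<noteq> 0" using p[of "x i"] assms(2) by simp
  then have "p \<noteq> 0" by auto
  then show ?thesis using poly_roots_finite[of p] by (simp add: p)
qed

lemma polyfun_if: "(P \<Longrightarrow> polyfun n f) \<Longrightarrow> (\<not> P \<Longrightarrow> polyfun n g) \<Longrightarrow> polyfun n (\<lambda>x. if P then f x else g x)"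
  by (cases P) simp_all

context penalty
begin

text \<open>A point where the product of all polynomials is nonzero fixes \<open>a\<close> and
  \<open>\<tau>\<close>; with these frozen the polynomial of the polar curve is still not
  identically zero, which leaves room for a small \<open>\<sigma>\<close> and then for a small
  \<open>w\<close>. The order is forced: \<open>\<epsilon>\<close> is given after \<open>a\<close>
  and \<open>\<tau>\<close>, and the polynomial of \<open>generic_regular\<close> depends on
  \<open>\<sigma>\<close>. For the last coordinate, a value or a level, only finitely many choices
  are excluded.\<close>

lemma generic_parameters:
  assumes m: "0 < m" and \<kappa>: "\<kappa> > 0"
  shows "\<exists>a \<tau>. (\<forall>i. \<bar>a i\<bar> \<le> \<kappa>) \<and> (\<forall>l. \<bar>\<tau> l\<bar> \<le> \<kappa>) \<and>
    finite (crit a \<tau>) \<and> card (crit a \<tau>) \<le> dep_bound m d 2 \<and>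
    (\<forall>\<epsilon>>0. \<exists>\<sigma> w. (\<forall>l. \<bar>\<sigma> l\<bar> < \<epsilon>) \<and> (\<forall>j. \<bar>w j\<bar> < \<epsilon>) \<and>
      (\<forall>k<m. \<exists>Z. finite Z \<and> (\<forall>v. v \<notin> Z \<longrightarrow> finite (levels a \<tau> \<sigma> w k v) \<and>
         card (levels a \<tau> \<sigma> w k v) \<le> dep_bound (2 * m) (2 * d + 1) 2)) \<and>
      (\<exists>Z. finite Z \<and> (\<forall>c. c \<notin> Z \<longrightarrow> regular_level a \<tau> \<sigma> w c)))"
proof -
  define n where "n = 2 * m + 2 * d + 1"
  define N where "N = dep_bound (2 * m) (2 * d + 1) 2"
  obtain \<Gamma>A where \<Gamma>A: "polyfun (m + d) \<Gamma>A" "\<exists>w. \<Gamma>A w \<noteq> 0"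
    "\<And>a \<tau>. \<Gamma>A (\<lambda>i. if i < m then \<theta> * a i else - \<tau> (i - m)) \<noteq> 0 \<Longrightarrow>
      finite (crit a \<tau>) \<and> card (crit a \<tau>) \<le> dep_bound m d 2"
    using generic_crit by blast
  have "\<forall>k. \<exists>\<Gamma>. k < m \<longrightarrow> polyfun n \<Gamma> \<and> (\<exists>w. \<Gamma> w \<noteq> 0) \<and>
    (\<forall>a \<tau> \<sigma> w v. \<Gamma> (rhs a \<tau> \<sigma> w v) \<noteq> 0 \<longrightarrow>
      finite (levels a \<tau> \<sigma> w k v) \<and> card (levels a \<tau> \<sigma> w k v) \<le> N)"
    using generic_polar unfolding levels_def n_def N_def by blast
  from choice[OF this] obtain \<Gamma> where "\<forall>k. k < m \<longrightarrow> polyfun n (\<Gamma> k) \<and> (\<exists>w. \<Gamma> k w \<noteq> 0) \<and>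
    (\<forall>a \<tau> \<sigma> w v. \<Gamma> k (rhs a \<tau> \<sigma> w v) \<noteq> 0 \<longrightarrow>
      finite (levels a \<tau> \<sigma> w k v) \<and> card (levels a \<tau> \<sigma> w k v) \<le> N)" ..
  then have \<Gamma>: "\<And>k. k < m \<Longrightarrow> polyfun n (\<Gamma> k)" "\<And>k. k < m \<Longrightarrow> \<exists>w. \<Gamma> k w \<noteq> 0"
    "\<And>k a \<tau> \<sigma> w v. k < m \<Longrightarrow> \<Gamma> k (rhs a \<tau> \<sigma> w v) \<noteq> 0 \<Longrightarrow>
      finite (levels a \<tau> \<sigma> w k v) \<and> card (levels a \<tau> \<sigma> w k v) \<le> N"
    by simp_all
  define \<Gamma>B where "\<Gamma>B W = (\<Prod>k<m. \<Gamma> k W)" for W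
  have pB: "polyfun n \<Gamma>B" unfolding \<Gamma>B_def[abs_def] by (intro polyfun_prod \<Gamma>) auto
  have nB: "\<exists>W. \<Gamma>B W \<noteq> 0"
    unfolding \<Gamma>B_def by (rule polyfun_nonzero_prod[where n=n]) (use \<Gamma> in auto)
  define H0 where "H0 W = \<Gamma>A (\<lambda>i. if i < m then - W i else W (2 * m + (i - m)))" for W
  have pH0: "polyfun n H0"
    unfolding H0_def[abs_def]
  proof (rule polyfun_compose[OF \<Gamma>A(1)])
    fix i assume "i < m + d"
    then show "polyfun n (\<lambda>W. if i < m then - W i else W (2 * m + (i - m)))"
      by (cases "i < m") (auto simp: n_def intro!: polyfun_intros)
  qed
  have nH0: "\<exists>W. H0 W \<noteq> 0"
  proof -
    obtain w where w: "\<Gamma>A w \<noteq> 0" using \<Gamma>A(2) ..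
    define W where "W i = (if i < m then - w i else w (m + (i - 2 * m)))" for i
    have "H0 W = \<Gamma>A w"
      unfolding H0_def by (rule polyfun_cong[OF \<Gamma>A(1)]) (use m in \<open>auto simp: W_def\<close>)
    then show ?thesis using w by (intro exI[of _ W]) simp
  qed
  obtain W' where "H0 W' * \<Gamma>B W' \<noteq> 0"
    using polyfun_nonzero_mult[OF pH0 pB] nH0 nB by blast
  \<comment> \<open>Since \<open>a\<close> will be \<open>- W0 / \<theta>\<close> and
    \<open>\<tau>\<close> will be \<open>- W0\<close>, both bounds follow from the factor
    \<open>min 1 \<theta>\<close>.\<close>
  then obtain W0 where W0: "\<And>i. \<bar>W0 i\<bar> < \<kappa> * min 1 \<theta>" "H0 W0 * \<Gamma>B W0 \<noteq> 0"
    using polyfun_nonzero_small[OF polyfun_mult[OF pH0 pB], of W' "\<kappa> * min 1 \<theta>"] \<kappa> \<theta> by auto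
  define a where "a i = - W0 i / \<theta>" for i
  define \<tau> where "\<tau> l = - W0 (2 * m + l)" for l
  have a: "\<bar>a i\<bar> \<le> \<kappa>" for i
  proof -
    have "\<bar>W0 i\<bar> \<le> \<kappa> * \<theta>"
      using W0(1)[of i] \<kappa> mult_left_mono[of "min 1 \<theta>" \<theta> \<kappa>] by linarith
    then show ?thesis using \<theta> by (simp add: a_def field_simps)
  qed
  have \<tau>: "\<bar>\<tau> l\<bar> \<le> \<kappa>" for l
    using W0(1)[of "2 * m + l"] \<kappa> mult_left_mono[of "min 1 \<theta>" 1 \<kappa>] unfolding \<tau>_def abs_minus_cancel by linarith
  have "H0 W0 = \<Gamma>A (\<lambda>i. if i < m then \<theta> * a i else - \<tau> (i - m))"
    unfolding H0_def using \<theta> by (intro arg_cong[where f=\<Gamma>A]) (auto simp: a_def \<tau>_def)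
  then have crit: "finite (crit a \<tau>) \<and> card (crit a \<tau>) \<le> dep_bound m d 2"
    using \<Gamma>A(3)[of a \<tau>] W0(2) by simp
  have gen: "\<exists>\<sigma> w. (\<forall>l. \<bar>\<sigma> l\<bar> < \<epsilon>) \<and> (\<forall>j. \<bar>w j\<bar> < \<epsilon>) \<and>
      (\<forall>k<m. \<exists>Z. finite Z \<and> (\<forall>v. v \<notin> Z \<longrightarrow> finite (levels a \<tau> \<sigma> w k v) \<and> card (levels a \<tau> \<sigma> w k v) \<le> N)) \<and>
      (\<exists>Z. finite Z \<and> (\<forall>c. c \<notin> Z \<longrightarrow> regular_level a \<tau> \<sigma> w c))" if \<epsilon>: "\<epsilon> > 0" for \<epsilon>
  proof -
    define H1 where "H1 W = \<Gamma>B (\<lambda>i. if i < m \<or> 2 * m \<le> i \<and> i < 2 * m + d then W0 i else W i)" for W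
    have pH1: "polyfun n H1"
      unfolding H1_def[abs_def]
    proof (rule polyfun_compose[OF pB])
      fix i assume "i < n"
      then show "polyfun n (\<lambda>W. if i < m \<or> 2 * m \<le> i \<and> i < 2 * m + d then W0 i else W i)"
        by (intro polyfun_if polyfun_const polyfun_var)
    qed
    have "H1 W0 \<noteq> 0" using W0(2) by (simp add: H1_def)
    then obtain W1 where W1: "\<And>i. \<bar>W1 i\<bar> < \<epsilon>" "H1 W1 \<noteq> 0"
      using polyfun_nonzero_small[OF pH1, of W0 \<epsilon>] \<epsilon> by blast
    define \<sigma> where "\<sigma> l = W1 (2 * m + d + l)" for l
    obtain \<Gamma>C where \<Gamma>C: "polyfun (m + 1) \<Gamma>C" "\<exists>w. \<Gamma>C w \<noteq> 0"
      "\<And>w c. \<Gamma>C (\<lambda>i. if i < m then - w i else c) \<noteq> 0 \<Longrightarrow> regular_level a \<tau> \<sigma> w c"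
      using generic_regular[OF m, of a \<tau> \<sigma>] by blast
    define H2 where "H2 W = \<Gamma>B (\<lambda>i. if i < m \<or> 2 * m \<le> i \<and> i < 2 * m + d then W0 i
      else if 2 * m + d \<le> i \<and> i < 2 * m + 2 * d then W1 i else W i)" for W
    define H3 where "H3 W = \<Gamma>C (\<lambda>i. if i < m then W (m + i) else W n)" for W
    have pH2: "polyfun (Suc n) H2"
      unfolding H2_def[abs_def]
    proof (rule polyfun_compose[OF pB])
      fix i assume "i < n"
      then show "polyfun (Suc n) (\<lambda>W. if i < m \<or> 2 * m \<le> i \<and> i < 2 * m + d then W0 i
          else if 2 * m + d \<le> i \<and> i < 2 * m + 2 * d then W1 i else W i)"
        by (intro polyfun_if polyfun_const polyfun_var) auto
    qed
    have pH3: "polyfun (Suc n) H3"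
      unfolding H3_def[abs_def]
    proof (rule polyfun_compose[OF \<Gamma>C(1)])
      fix i assume "i < m + 1"
      show "polyfun (Suc n) (\<lambda>W. if i < m then W (m + i) else W n)"
        by (cases "i < m") (auto simp: n_def intro!: polyfun_var)
    qed
    have "H2 W1 = H1 W1" unfolding H2_def H1_def by (intro arg_cong[where f=\<Gamma>B]) auto
    then have nH2: "H2 W1 \<noteq> 0" using W1 by simp
    have nH3: "\<exists>W. H3 W \<noteq> 0"
    proof -
      obtain w where w: "\<Gamma>C w \<noteq> 0" using \<Gamma>C(2) ..
      define W where "W i = (if i = n then w m else w (i - m))" for i
      have "H3 W = \<Gamma>C w"
        unfolding H3_def by (rule polyfun_cong[OF \<Gamma>C(1)]) (auto simp: W_def n_def less_Suc_eq)
      then show ?thesis using w by (intro exI[of _ W]) simp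
    qed
    obtain W' where "H2 W' * H3 W' \<noteq> 0"
      using polyfun_nonzero_mult[OF pH2 pH3] nH2 nH3 by blast
    then obtain W2 where W2: "\<And>i. \<bar>W2 i\<bar> < \<epsilon>" "H2 W2 * H3 W2 \<noteq> 0"
      using polyfun_nonzero_small[OF polyfun_mult[OF pH2 pH3], of W' \<epsilon>] \<epsilon> by blast
    define w where "w j = - W2 (m + j)" for j
    have rhs: "\<Gamma>B ((rhs a \<tau> \<sigma> w (W2 (2 * m + 2 * d)))(2 * m + 2 * d := v)) = \<Gamma>B (rhs a \<tau> \<sigma> w v)" for v
      by (rule polyfun_cong[OF pB]) (auto simp: rhs_def n_def)
    have "\<Gamma>B (rhs a \<tau> \<sigma> w (W2 (2 * m + 2 * d))) = H2 W2"
      unfolding H2_def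
    proof (rule polyfun_cong[OF pB])
      fix i assume "i < n"
      then consider "i < m" | "m \<le> i" "i < 2 * m" | "2 * m \<le> i" "i < 2 * m + d"
        | "2 * m + d \<le> i" "i < 2 * m + 2 * d" | "i = 2 * m + 2 * d"
        unfolding n_def by linarith
      then show "rhs a \<tau> \<sigma> w (W2 (2 * m + 2 * d)) i = (if i < m \<or> 2 * m \<le> i \<and> i < 2 * m + d then W0 i
          else if 2 * m + d \<le> i \<and> i < 2 * m + 2 * d then W1 i else W2 i)"
        using \<theta> by cases (auto simp: rhs_def a_def \<tau>_def \<sigma>_def w_def)
    qed
    then have nz: "\<Gamma>B (rhs a \<tau> \<sigma> w (W2 (2 * m + 2 * d))) \<noteq> 0" using W2(2) by simp
    define Z where "Z = {v. \<Gamma>B (rhs a \<tau> \<sigma> w v) = 0}"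
    have finZ: "finite Z"
      using polyfun_finite_zeros[OF pB nz, of "2 * m + 2 * d"] unfolding Z_def rhs .
    have levs: "finite (levels a \<tau> \<sigma> w k v) \<and> card (levels a \<tau> \<sigma> w k v) \<le> N" if "k < m" "v \<notin> Z" for k v
      using that by (intro \<Gamma>(3)) (auto simp: Z_def \<Gamma>B_def)
    let ?q = "\<lambda>c i. if i < m then - w i else c"
    have q: "\<Gamma>C ((?q (W2 n))(m := c)) = \<Gamma>C (?q c)" for c
      by (rule polyfun_cong[OF \<Gamma>C(1)]) auto
    have "\<Gamma>C (?q (W2 n)) = H3 W2"
      unfolding H3_def by (intro arg_cong[where f=\<Gamma>C]) (auto simp: w_def)
    then have "\<Gamma>C (?q (W2 n)) \<noteq> 0" using W2(2) by simp
    then have "finite {c. \<Gamma>C (?q c) = 0}"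
      using polyfun_finite_zeros[OF \<Gamma>C(1), of "?q (W2 n)" m] unfolding q by blast
    moreover have "regular_level a \<tau> \<sigma> w c" if "c \<notin> {c. \<Gamma>C (?q c) = 0}" for c
      using that by (intro \<Gamma>C(3)) auto
    ultimately have reg: "\<exists>Z. finite Z \<and> (\<forall>c. c \<notin> Z \<longrightarrow> regular_level a \<tau> \<sigma> w c)" by blast
    have "(\<forall>l. \<bar>\<sigma> l\<bar> < \<epsilon>) \<and> (\<forall>j. \<bar>w j\<bar> < \<epsilon>)" using W1(1) W2(1) by (simp add: \<sigma>_def w_def)
    moreover have "\<forall>k<m. \<exists>Z. finite Z \<and> (\<forall>v. v \<notin> Z \<longrightarrow> finite (levels a \<tau> \<sigma> w k v) \<and> card (levels a \<tau> \<sigma> w k v) \<le> N)"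
      using finZ levs by blast
    ultimately show ?thesis using reg by blast
  qed
  show ?thesis
    using a \<tau> crit gen unfolding N_def by (intro exI[of _ a] exI[of _ \<tau>]) simp
qed

end

text \<open>The scales are fitted so that on the variety in the unit box each of the two summands of
  \<open>F\<close> is at most 1/2, whereas \<open>F\<close> at most 2 forces |h_l| \<le> \<epsilon>
  and |x_i| \<le> 5 m. A descent that starts on the variety thus stays near it.\<close>

lemma paths_near_variety:
  assumes m: "0 < m" and h: "\<And>l. l < d \<Longrightarrow> bd m m 2 0 (h l)" and \<epsilon>: "\<epsilon> > 0"
  shows "\<exists>P. finite P \<and> card P \<le> dep_bound m d 2 \<and>
    (\<forall>x. (\<forall>i\<ge>m. x i = 0) \<longrightarrow> (\<forall>i<m. \<bar>x i\<bar> \<le> 1) \<longrightarrow> (\<forall>l<d. h l x = 0) \<longrightarrow>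
      (\<exists>p\<in>P. joined m {y. (\<forall>i\<ge>m. y i = 0) \<and> (\<forall>i<m. \<bar>y i\<bar> \<le> 5 * real m) \<and> (\<forall>l<d. \<bar>h l y\<bar> \<le> \<epsilon>)} x p
        (64 * (real m)\<^sup>2 * real (dep_bound (2 * m) (2 * d + 1) 2) + 2)))"
proof -
  \<comment> \<open>On the sublevel set of 2 the square of h_l - \<tau>_l is at most 4 eps, the
    square of \<epsilon> / 2.\<close>
  define eps where "eps = (\<epsilon> / 4)\<^sup>2"
  define \<theta> where "\<theta> = 1 / (4 * real m)"
  have pos: "eps > 0" "\<theta> > 0" using m \<epsilon> by (auto simp: eps_def \<theta>_def)
  interpret penalty m d h eps \<theta>
    by (rule penalty.intro) (simp_all add: h pos)
  define \<kappa> where "\<kappa> = min 1 (\<epsilon> / (4 * (real d + 1)))"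
  have \<kappa>: "\<kappa> > 0" "\<kappa> \<le> 1" "\<kappa> \<le> \<epsilon> / (4 * (real d + 1))" using \<epsilon> by (auto simp: \<kappa>_def)
  have "\<epsilon> / (4 * (real d + 1)) \<le> \<epsilon> / 2" using \<epsilon> by (simp add: field_simps)
  then have \<kappa>2: "\<kappa> \<le> \<epsilon> / 2" using \<kappa> by linarith
  have dk: "real d * \<kappa>\<^sup>2 \<le> eps"
  proof -
    have "real d * \<kappa>\<^sup>2 \<le> (real d + 1)\<^sup>2 * (\<epsilon> / (4 * (real d + 1)))\<^sup>2"
      using \<kappa> by (intro mult_mono power_mono) (auto simp: power2_eq_square algebra_simps)
    also have "\<dots> = ((real d + 1) * (\<epsilon> / (4 * (real d + 1))))\<^sup>2" by (rule power_mult_distrib[symmetric])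
    also have "(real d + 1) * (\<epsilon> / (4 * (real d + 1))) = \<epsilon> / 4" by (simp add: field_simps)
    also have "(\<epsilon> / 4)\<^sup>2 = eps" by (simp add: eps_def)
    finally show ?thesis .
  qed
  obtain a \<tau> where at: "\<And>i. \<bar>a i\<bar> \<le> \<kappa>" "\<And>l. \<bar>\<tau> l\<bar> \<le> \<kappa>" "finite (crit a \<tau>)" "card (crit a \<tau>) \<le> dep_bound m d 2"
    and gen: "\<And>\<epsilon>. \<epsilon> > 0 \<Longrightarrow> \<exists>\<sigma> w. (\<forall>l. \<bar>\<sigma> l\<bar> < \<epsilon>) \<and> (\<forall>j. \<bar>w j\<bar> < \<epsilon>) \<and>
      (\<forall>k<m. \<exists>Z. finite Z \<and> (\<forall>v. v \<notin> Z \<longrightarrow> finite (levels a \<tau> \<sigma> w k v) \<and>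
         card (levels a \<tau> \<sigma> w k v) \<le> dep_bound (2 * m) (2 * d + 1) 2)) \<and>
      (\<exists>Z. finite Z \<and> (\<forall>c. c \<notin> Z \<longrightarrow> regular_level a \<tau> \<sigma> w c))"
    using generic_parameters[OF m \<kappa>(1)] by blast
  have m1: "real m \<ge> 1" using m by simp
  have coord: "\<bar>x i\<bar> \<le> 1 + B" if "F a \<tau> x \<le> c" "i < m" "8 * real m * c \<le> B\<^sup>2" "B \<ge> 0" for x i c B
  proof -
    have "(x i - a i)\<^sup>2 \<le> 8 * real m * c" using F_coord[OF that(2,1)] by (simp add: \<theta>_def mult_ac)
    then have "(x i - a i)\<^sup>2 \<le> B\<^sup>2" using that by linarith
    then have "\<bar>x i - a i\<bar> \<le> B" using that(4) using abs_le_square_iff[of "x i - a i" B] by simp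
    then show ?thesis using at(1)[of i] \<kappa>(2) by linarith
  qed
  \<comment> \<open>This is the \<open>R\<close> of \<open>descent_total\<close>, which makes its 16
    m R equal to 64 m^2.\<close>
  have c1: "\<bar>x i\<bar> \<le> 4 * real m" if "x \<in> sub a \<tau> 1" "i < m" for x i
  proof -
    have "\<bar>x i\<bar> \<le> 1 + 3 * real m"
      using that m1 by (intro coord[of x 1]) (auto simp: power_mult_distrib power2_eq_square intro: mult_mono)
    then show ?thesis using m1 by linarith
  qed
  have c2: "\<bar>x i\<bar> \<le> 5 * real m" if "x \<in> sub a \<tau> 2" "i < m" for x i
  proof -
    have "\<bar>x i\<bar> \<le> 1 + 4 * real m"
      using that m1 by (intro coord[of x 2]) (auto simp: power_mult_distrib power2_eq_square)
    then show ?thesis using m1 by linarith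
  qed
  have h2: "\<bar>h l x\<bar> \<le> \<epsilon>" if "x \<in> sub a \<tau> 2" "l < d" for x l
  proof -
    have "(lam \<tau> l x)\<^sup>2 \<le> (\<Sum>l<d. (lam \<tau> l x)\<^sup>2)" using that by (intro member_le_sum) auto
    moreover have "eps / 2 * (\<Sum>l<d. (lam \<tau> l x)\<^sup>2) \<le> 2"
    proof -
      have "\<theta> / 2 * (\<Sum>i<m. (x i - a i)\<^sup>2) \<ge> 0" using pos by (simp add: sum_nonneg)
      then show ?thesis using that(1) unfolding F_def by auto
    qed
    ultimately have "eps / 2 * (lam \<tau> l x)\<^sup>2 \<le> 2"
      using mult_left_mono[of "(lam \<tau> l x)\<^sup>2" _ "eps / 2"] pos by (smt (verit) divide_nonneg_nonneg)
    then have "eps * (lam \<tau> l x)\<^sup>2 \<le> 4" by simp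
    then have "eps * (eps * (lam \<tau> l x)\<^sup>2) \<le> eps * 4" using pos by (intro mult_left_mono) auto
    moreover have "h l x - \<tau> l = eps * lam \<tau> l x" using pos by (simp add: lam_def)
    ultimately have "(h l x - \<tau> l)\<^sup>2 \<le> 4 * eps" by (simp add: power2_eq_square mult_ac)
    also have "\<dots> = (\<epsilon> / 2)\<^sup>2" by (simp add: eps_def power_divide)
    finally have "\<bar>h l x - \<tau> l\<bar> \<le> \<epsilon> / 2"
      using abs_le_square_iff[of "h l x - \<tau> l" "\<epsilon> / 2"] \<epsilon> by simp
    then show ?thesis using at(2)[of l] \<kappa>2 by linarith
  qed
  have F1: "F a \<tau> x \<le> 1" if x: "\<forall>i<m. \<bar>x i\<bar> \<le> 1" "\<forall>l<d. h l x = 0" for x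
  proof -
    have "(x i - a i)\<^sup>2 \<le> 2\<^sup>2" if "i < m" for i
    proof -
      have "\<bar>x i - a i\<bar> \<le> 2" using x(1) that at(1)[of i] \<kappa>(2) by (smt (verit))
      then show ?thesis using abs_le_square_iff[of "x i - a i" 2] by simp
    qed
    then have "(\<Sum>i<m. (x i - a i)\<^sup>2) \<le> (\<Sum>i<m. 2\<^sup>2)" by (intro sum_mono) auto
    then have "\<theta> / 2 * (\<Sum>i<m. (x i - a i)\<^sup>2) \<le> \<theta> / 2 * (real m * 4)"
      using pos by (intro mult_left_mono) auto
    also have "\<dots> = 1 / 2" using m by (simp add: \<theta>_def)
    finally have 1: "\<theta> / 2 * (\<Sum>i<m. (x i - a i)\<^sup>2) \<le> 1 / 2" .
    have "(lam \<tau> l x)\<^sup>2 \<le> (\<kappa> / eps)\<^sup>2" if "l < d" for l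
    proof -
      have "\<bar>lam \<tau> l x\<bar> \<le> \<kappa> / eps"
        using x(2) that at(2)[of l] pos by (simp add: lam_def divide_right_mono)
      then show ?thesis using abs_le_square_iff[of "lam \<tau> l x" "\<kappa> / eps"] \<kappa> pos by simp
    qed
    then have "(\<Sum>l<d. (lam \<tau> l x)\<^sup>2) \<le> (\<Sum>l<d. (\<kappa> / eps)\<^sup>2)" by (intro sum_mono) auto
    then have "eps / 2 * (\<Sum>l<d. (lam \<tau> l x)\<^sup>2) \<le> eps / 2 * (real d * (\<kappa> / eps)\<^sup>2)"
      using pos by (intro mult_left_mono) auto
    also have "\<dots> = (real d * \<kappa>\<^sup>2) / (2 * eps)" using pos by (simp add: power2_eq_square field_simps)
    also have "\<dots> \<le> 1 / 2" using dk pos by (simp add: field_simps)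
    finally show ?thesis using 1 by (simp add: F_def)
  qed
  let ?T = "{y. (\<forall>i\<ge>m. y i = 0) \<and> (\<forall>i<m. \<bar>y i\<bar> \<le> 5 * real m) \<and> (\<forall>l<d. \<bar>h l y\<bar> \<le> \<epsilon>)}"
  have sub: "sub a \<tau> 2 \<subseteq> ?T" using c2 h2 by auto
  have "\<exists>p\<in>crit a \<tau>. joined m ?T x p (64 * (real m)\<^sup>2 * real (dep_bound (2 * m) (2 * d + 1) 2) + 2)"
    if x: "\<forall>i\<ge>m. x i = 0" "\<forall>i<m. \<bar>x i\<bar> \<le> 1" "\<forall>l<d. h l x = 0" for x
  proof -
    have "x \<in> sub a \<tau> 1" using x F1 by auto
    then have "\<exists>p\<in>crit a \<tau>. joined m (sub a \<tau> 2) x p (16 * real m * (4 * real m) * real (dep_bound (2 * m) (2 * d + 1) 2) + 2)"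
      using gen c1 by (intro descent_total at(3)) auto
    then obtain p where p: "p \<in> crit a \<tau>"
      "joined m (sub a \<tau> 2) x p (16 * real m * (4 * real m) * real (dep_bound (2 * m) (2 * d + 1) 2) + 2)" by blast
    have eq: "16 * real m * (4 * real m) * real (dep_bound (2 * m) (2 * d + 1) 2) + 2 =
      64 * (real m)\<^sup>2 * real (dep_bound (2 * m) (2 * d + 1) 2) + 2" by (simp add: power2_eq_square)
    show ?thesis by (rule bexI[OF _ p(1)]) (rule joined_subset[OF p(2)[unfolded eq] sub])
  qed
  then show ?thesis using at(3,4) by (intro exI[of _ "crit a \<tau>"]) simp
qed

section \<open>Components and exhaustions\<close>

lemma compact_pointwise:
  fixes K :: "'b::topological_space set"
  assumes "compact K"
  shows "compact {f :: 'a \<Rightarrow> 'b. \<forall>x. f x \<in> K}"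
proof -
  have "compactin (product_topology (\<lambda>_. euclidean) UNIV) (PiE UNIV (\<lambda>_::'a. K))"
    using assms by (subst compactin_PiE) (auto simp: compactin_euclidean_iff)
  then have "compact (PiE UNIV (\<lambda>_::'a. K))"
    by (simp add: euclidean_product_topology compactin_euclidean_iff)
  then show ?thesis by (simp add: PiE_UNIV_domain Pi_def)
qed

lemma continuous_on_eval:
  fixes f :: "'c::topological_space \<Rightarrow> 'a \<Rightarrow> 'b::topological_space"
  assumes "continuous_on S f"
  shows "continuous_on S (\<lambda>z. f z x)"
  by (rule continuous_on_compose2[OF continuous_on_product_coordinates assms]) simp

lemma continuous_on_nd:
  assumes "continuous_on S f" "continuous_on S g"
  shows "continuous_on S (\<lambda>z. nd n (f z) (g z))"
proof -
  have "continuous_on S (\<lambda>z. f z i)" "continuous_on S (\<lambda>z. g z i)" for i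
    by (rule continuous_on_eval[OF assms(1)], rule continuous_on_eval[OF assms(2)])
  then show ?thesis unfolding nd_def L2_set_def by (intro continuous_intros)
qed

lemma joined_connected:
  assumes Z: "\<And>x i. x \<in> Z \<Longrightarrow> i \<ge> n \<Longrightarrow> x i = 0" and j: "joined n Z x y L"
  shows "\<exists>S. connected S \<and> S \<subseteq> Z \<and> x \<in> S \<and> y \<in> S"
proof -
  obtain g where g: "0 \<le> L" "g 0 = x" "g L = y" "\<And>t. t \<in> {0..L} \<Longrightarrow> g t \<in> Z"
    "\<And>s t. s \<in> {0..L} \<Longrightarrow> t \<in> {0..L} \<Longrightarrow> nd n (g s) (g t) \<le> \<bar>s - t\<bar>"
    using j unfolding joined_def by blast
  have "continuous_on {0..L} g"
  proof (rule continuous_on_coordinatewise_then_product)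
    fix i
    have "1-lipschitz_on {0..L} (\<lambda>t. g t i)"
    proof (rule lipschitz_onI)
      fix s t assume st: "s \<in> {0..L}" "t \<in> {0..L}"
      show "dist (g s i) (g t i) \<le> 1 * dist s t"
      proof (cases "i < n")
        case True
        then show ?thesis using abs_le_nd[OF True, of "g s" "g t"] g(5)[OF st] by (simp add: dist_real_def)
      next
        case False
        then have "g s i = 0" "g t i = 0" using Z g(4) st by auto
        then show ?thesis by simp
      qed
    qed simp
    then show "continuous_on {0..L} (\<lambda>t. g t i)" by (rule lipschitz_on_continuous_on)
  qed
  then have "connected (g ` {0..L})" by (intro connected_continuous_image) auto
  then show ?thesis using g by (intro exI[of _ "g ` {0..L}"]) auto
qed

text \<open>
  By Tychonoff's theorem a choice of end points together with all the paths survives the passage to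
  a decreasing intersection.
\<close>

lemma joined_limit:
  fixes K :: "nat \<Rightarrow> (nat \<Rightarrow> real) set"
  assumes K0: "compact (K 0)" and closed: "\<And>j. closed (K j)" and dec: "\<And>j. K (Suc j) \<subseteq> K j"
    and L: "L \<ge> 0"
    and P: "\<And>j. \<exists>P. finite P \<and> card P \<le> N \<and> (\<forall>x\<in>Z. \<exists>p\<in>P. joined n (K j) x p L)"
  shows "\<exists>P. finite P \<and> card P \<le> N \<and> (\<forall>x\<in>Z. \<exists>p\<in>P. joined n (\<Inter>j. K j) x p L)"
proof (cases "Z = {}")
  case True
  then show ?thesis by (intro exI[of _ "{}"]) auto
next
  case False
  then obtain z0 where z0: "z0 \<in> Z" by blast
  \<comment> \<open>A point of the product space is a list \<open>q\<close> of end points together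
    with a path \<open>g x\<close> for every \<open>x\<close>. Each condition is closed and looks at
    a path at no more than two parameters; the disjunction over \<open>i < N\<close> is finite and
    stays closed.\<close>
  define \<Phi> where "\<Phi> j = {(q, g). \<forall>x\<in>Z. g x 0 = x \<and> (\<exists>i<N. g x L = q i) \<and>
    (\<forall>t\<in>{0..L}. g x t \<in> K j) \<and> (\<forall>s\<in>{0..L}. \<forall>t\<in>{0..L}. nd n (g x s) (g x t) \<le> \<bar>s - t\<bar>)}"
    for j and q :: "nat \<Rightarrow> nat \<Rightarrow> real" and g :: "(nat \<Rightarrow> real) \<Rightarrow> real \<Rightarrow> nat \<Rightarrow> real"
  define C where "C = {q :: nat \<Rightarrow> nat \<Rightarrow> real. \<forall>i. q i \<in> K 0} \<times>
    {g :: (nat \<Rightarrow> real) \<Rightarrow> real \<Rightarrow> nat \<Rightarrow> real. \<forall>x. g x \<in> {f. \<forall>t. f t \<in> K 0}}"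
  have compC: "compact C"
    unfolding C_def by (intro compact_Times compact_pointwise K0)
  have dec': "K j \<subseteq> K i" if "i \<le> j" for i j
    using that by (induction rule: dec_induct) (use dec in auto)
  have \<Phi>dec: "\<Phi> j \<subseteq> \<Phi> i" if "i \<le> j" for i j
    using dec'[OF that] unfolding \<Phi>_def by blast
  have ev: "continuous_on UNIV (\<lambda>z :: (nat \<Rightarrow> nat \<Rightarrow> real) \<times> ((nat \<Rightarrow> real) \<Rightarrow> real \<Rightarrow> nat \<Rightarrow> real). snd z x t)"
    "continuous_on UNIV (\<lambda>z :: (nat \<Rightarrow> nat \<Rightarrow> real) \<times> ((nat \<Rightarrow> real) \<Rightarrow> real \<Rightarrow> nat \<Rightarrow> real). fst z i)" for x t i
    by (rule continuous_on_eval[OF continuous_on_eval[OF continuous_on_snd[OF continuous_on_id]]],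
        rule continuous_on_eval[OF continuous_on_fst[OF continuous_on_id]])
  have \<Phi>closed: "closed (\<Phi> j)" for j
  proof -
    have "\<Phi> j = (\<Inter>x\<in>Z. {z. snd z x 0 = x} \<inter> (\<Union>i\<in>{..<N}. {z. snd z x L = fst z i}) \<inter>
       (\<Inter>t\<in>{0..L}. {z. snd z x t \<in> K j}) \<inter> (\<Inter>s\<in>{0..L}. \<Inter>t\<in>{0..L}. {z. nd n (snd z x s) (snd z x t) \<le> \<bar>s - t\<bar>}))"
      unfolding \<Phi>_def by (auto simp: Bex_def split: prod.splits)
    moreover have "closed {z :: (nat \<Rightarrow> nat \<Rightarrow> real) \<times> ((nat \<Rightarrow> real) \<Rightarrow> real \<Rightarrow> nat \<Rightarrow> real). snd z x t \<in> K j}" for x t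
      using closed_vimage[OF closed ev(1)] by (simp add: vimage_def)
    ultimately show ?thesis
      by (auto intro!: closed_INT closed_Int closed_UN closed_Collect_eq closed_Collect_le ev
          continuous_on_const continuous_on_nd)
  qed
  have \<Phi>ne: "C \<inter> \<Phi> j \<noteq> {}" for j
  proof -
    obtain P where P': "finite P" "card P \<le> N" "\<forall>x\<in>Z. \<exists>p\<in>P. joined n (K j) x p L"
      using P[of j] by blast
    then obtain p0 where p0: "p0 \<in> P" "joined n (K j) z0 p0 L" using z0 by blast
    have z0K: "z0 \<in> K 0" using joined_mem[OF p0(2)] dec'[of 0 j] by auto
    \<comment> \<open>Points of \<open>P\<close> outside \<open>K j\<close> are end points of no
      path, and \<open>q\<close> has to take its values in the compact set
      \<open>K 0\<close>.\<close>
    define Q where "Q = P \<inter> K j"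
    have Q: "finite Q" "card Q \<le> N" using P' card_mono[of P Q] by (auto simp: Q_def)
    have p0Q: "p0 \<in> Q" using p0 joined_mem[OF p0(2)] by (simp add: Q_def)
    obtain e where e: "bij_betw e {0..<card Q} Q" using ex_bij_betw_nat_finite[OF Q(1)] by blast
    define q where "q i = (if i < card Q then e i else p0)" for i
    have qQ: "q i \<in> Q" for i
      using e p0Q by (auto simp: q_def bij_betw_def)
    have qsur: "\<exists>i<N. p = q i" if "p \<in> Q" for p
    proof -
      have "p \<in> e ` {0..<card Q}" using e that by (simp add: bij_betw_def)
      then obtain i where "i < card Q" "p = e i" by auto
      then show ?thesis using Q(2) by (intro exI[of _ i]) (auto simp: q_def)
    qed
    have "\<forall>x\<in>Z. \<exists>g. g 0 = x \<and> g L \<in> Q \<and> (\<forall>t\<in>{0..L}. g t \<in> K j) \<and>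
       (\<forall>s\<in>{0..L}. \<forall>t\<in>{0..L}. nd n (g s) (g t) \<le> \<bar>s - t\<bar>)"
    proof
      fix x assume "x \<in> Z"
      then obtain p where p: "p \<in> P" "joined n (K j) x p L" using P' by blast
      then have "p \<in> Q" using joined_mem by (auto simp: Q_def)
      then show "\<exists>g. g 0 = x \<and> g L \<in> Q \<and> (\<forall>t\<in>{0..L}. g t \<in> K j) \<and>
       (\<forall>s\<in>{0..L}. \<forall>t\<in>{0..L}. nd n (g s) (g t) \<le> \<bar>s - t\<bar>)"
        using p(2) unfolding joined_def by blast
    qed
    then obtain G where G: "\<And>x. x \<in> Z \<Longrightarrow> G x 0 = x \<and> G x L \<in> Q \<and> (\<forall>t\<in>{0..L}. G x t \<in> K j) \<and>
       (\<forall>s\<in>{0..L}. \<forall>t\<in>{0..L}. nd n (G x s) (G x t) \<le> \<bar>s - t\<bar>)"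
      by metis
    define g where "g x t = (if x \<in> Z \<and> t \<in> {0..L} then G x t else z0)" for x t
    have "(q, g) \<in> C"
      using qQ G z0K dec'[of 0 j] unfolding C_def by (auto simp: g_def Q_def)
    moreover have "(q, g) \<in> \<Phi> j"
      unfolding \<Phi>_def using G L qsur by (auto simp: g_def)
    ultimately show ?thesis by blast
  qed
  have "C \<inter> (\<Inter>j\<in>UNIV. \<Phi> j) \<noteq> {}"
  proof (rule compact_imp_fip_image[OF compC])
    fix I :: "nat set" assume I: "finite I"
    have "\<Phi> (Max (insert 0 I)) \<subseteq> (\<Inter>j\<in>I. \<Phi> j)"
    proof (rule INT_greatest)
      fix j assume "j \<in> I"
      then show "\<Phi> (Max (insert 0 I)) \<subseteq> \<Phi> j" using I by (intro \<Phi>dec Max_ge) simp_all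
    qed
    then show "C \<inter> (\<Inter>j\<in>I. \<Phi> j) \<noteq> {}" using \<Phi>ne[of "Max (insert 0 I)"] by blast
  qed (rule \<Phi>closed)
  then obtain q g where qg: "\<And>j. (q, g) \<in> \<Phi> j" by auto
  have "\<exists>p\<in>q ` {..<N}. joined n (\<Inter>j. K j) x p L" if x: "x \<in> Z" for x
  proof -
    obtain i where i: "i < N" "g x L = q i" using qg[of 0] x by (auto simp: \<Phi>_def)
    have "joined n (\<Inter>j. K j) x (q i) L"
      unfolding joined_def using qg x i L by (auto simp: \<Phi>_def intro!: exI[of _ "g x"])
    then show ?thesis using i by blast
  qed
  moreover have "finite (q ` {..<N})" "card (q ` {..<N}) \<le> N"
    using card_image_le[of "{..<N}" q] by auto
  ultimately show ?thesis by blast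
qed

text \<open>The ball is the image, under evaluation at 0, of a compact set of paths that end in
  \<open>p\<close>.\<close>

lemma closed_geodesic_ball:
  assumes Z: "compact Z"
  shows "closed {x. joined n Z x p L}"
proof (cases "0 \<le> L \<and> p \<in> Z")
  case False
  then have "{x. joined n Z x p L} = {}" using joined_nonneg joined_mem by blast
  then show ?thesis by simp
next
  case True
  define G where "G = {g :: real \<Rightarrow> nat \<Rightarrow> real. \<forall>t. g t \<in> Z} \<inter> ({g. g L = p} \<inter>
    (\<Inter>s\<in>{0..L}. \<Inter>t\<in>{0..L}. {g. nd n (g s) (g t) \<le> \<bar>s - t\<bar>}))"
  have ev: "continuous_on UNIV (\<lambda>g :: real \<Rightarrow> nat \<Rightarrow> real. g t)" for t
    by (intro continuous_on_product_coordinates)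
  have "compact G"
    unfolding G_def
    by (intro compact_Int_closed compact_pointwise Z closed_Int closed_INT ballI closed_Collect_eq closed_Collect_le
        ev continuous_on_const continuous_on_nd)
  then have "compact ((\<lambda>g. g 0) ` G)"
    by (intro compact_continuous_image continuous_on_subset[OF ev]) auto
  moreover have "(\<lambda>g. g 0) ` G = {x. joined n Z x p L}"
  proof
    show "(\<lambda>g. g 0) ` G \<subseteq> {x. joined n Z x p L}"
      using True by (auto simp: G_def joined_def)
    show "{x. joined n Z x p L} \<subseteq> (\<lambda>g. g 0) ` G"
    proof
      fix x assume "x \<in> {x. joined n Z x p L}"
      then obtain g where g: "g 0 = x" "g L = p" "\<And>t. t \<in> {0..L} \<Longrightarrow> g t \<in> Z"
        "\<And>s t. s \<in> {0..L} \<Longrightarrow> t \<in> {0..L} \<Longrightarrow> nd n (g s) (g t) \<le> \<bar>s - t\<bar>"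
        unfolding joined_def by blast
      define g' where "g' t = (if t \<in> {0..L} then g t else p)" for t
      have "g' \<in> G" using g True by (auto simp: G_def g'_def)
      moreover have "g' 0 = x" using g True by (simp add: g'_def)
      ultimately show "x \<in> (\<lambda>g. g 0) ` G" by blast
    qed
  qed
  ultimately show ?thesis using compact_imp_closed by metis
qed

section \<open>Finite nets and clusters of geodesic balls\<close>

locale net =
  fixes n :: nat and Z P :: "(nat \<Rightarrow> real) set" and N :: nat and L :: real
  assumes Z: "compact Z" and Z0: "\<And>x i. x \<in> Z \<Longrightarrow> i \<ge> n \<Longrightarrow> x i = 0"
    and P: "finite P" "card P \<le> N" and L: "L \<ge> 0"
    and P_near: "\<And>x. x \<in> Z \<Longrightarrow> \<exists>p\<in>P. joined n Z x p L"
begin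

definition gball :: "(nat \<Rightarrow> real) \<Rightarrow> (nat \<Rightarrow> real) set" where
  "gball p = {x. joined n Z x p L}"

definition link :: "((nat \<Rightarrow> real) \<times> (nat \<Rightarrow> real)) set" where
  "link = {(p, q) \<in> P \<times> P. gball p \<inter> gball q \<noteq> {}}"

text \<open>A chain uses at most N^2 links of length 2 L each, with one more L at either
  end.\<close>

abbreviation D :: real where
  "D \<equiv> 2 * L * (real N ^ 2 + 1)"

lemma link_joined: "(p, q) \<in> link ^^ k \<Longrightarrow> p \<in> Z \<Longrightarrow> joined n Z p q (2 * L * real k)"
proof (induction k arbitrary: q)
  case 0
  then show ?case by (auto intro: joined_refl)
next
  case (Suc k)
  then obtain r where r: "(p, r) \<in> link ^^ k" "(r, q) \<in> link" by auto
  then obtain z where "joined n Z z r L" "joined n Z z q L" by (auto simp: link_def gball_def)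
  then have "joined n Z r q (L + L)" using joined_trans joined_sym by blast
  then have "joined n Z p q (2 * L * real k + (L + L))" using joined_trans Suc r by blast
  then show ?case by (simp add: algebra_simps)
qed

definition cluster :: "(nat \<Rightarrow> real) \<Rightarrow> (nat \<Rightarrow> real) set" where
  "cluster x = (\<Union>p\<in>{p\<in>P. x \<in> gball p}. \<Union>q\<in>link\<^sup>* `` {p}. gball q)"

lemma cluster_joined:
  assumes "y \<in> cluster x"
  shows "joined n Z x y D"
proof -
  obtain p q where pq: "p \<in> P" "x \<in> gball p" "(p, q) \<in> link\<^sup>*" "y \<in> gball q"
    using assms by (auto simp: cluster_def)
  have "finite link" using P(1) by (auto simp: link_def intro: finite_subset[of _ "P \<times> P"])
  have "card link \<le> card (P \<times> P)"
    using P(1) by (intro card_mono) (auto simp: link_def)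
  also have "\<dots> \<le> N ^ 2" using P(2) by (simp add: card_cartesian_product power2_eq_square mult_mono)
  finally have cl: "card link \<le> N ^ 2" .
  obtain k where k: "k \<le> card link" "(p, q) \<in> link ^^ k"
    using pq(3) unfolding rtrancl_finite_eq_relpow[OF \<open>finite link\<close>] by auto
  have "p \<in> Z" using pq(2) joined_mem by (auto simp: gball_def)
  then have pq': "joined n Z p q (2 * L * real k)" using link_joined k by blast
  have xp: "joined n Z x p L" and qy: "joined n Z q y L"
    using pq joined_sym unfolding gball_def by auto
  have "joined n Z x y (L + 2 * L * real k + L)"
    using joined_trans[OF joined_trans[OF xp pq'] qy] .
  moreover have "real k \<le> real N ^ 2" using k cl by (metis of_nat_le_iff of_nat_power order_trans)
  then have "2 * L * real k \<le> 2 * L * real N ^ 2" using L by (intro mult_left_mono) auto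
  then have "L + 2 * L * real k + L \<le> D" by (simp add: algebra_simps)
  ultimately show ?thesis using joined_weaken by blast
qed

text \<open>The complement in \<open>Z\<close> is again a finite union of geodesic balls, those
  whose centres are not linked to \<open>x\<close>. So a cluster is open and closed in
  \<open>Z\<close>, and a connected set cannot leave it.\<close>

lemma cluster_closed: "closed (cluster x)" "closed (Z - cluster x)"
proof -
  have fin: "finite (link\<^sup>* `` {p})" if "p \<in> P" for p
  proof -
    have "link\<^sup>* `` {p} \<subseteq> insert p P"
      using that by (auto elim: rtranclE simp: link_def)
    then show ?thesis using P(1) finite_subset by blast
  qed
  have cb: "closed (gball q)" for q unfolding gball_def by (rule closed_geodesic_ball[OF Z])
  show "closed (cluster x)"
    unfolding cluster_def using P(1) fin cb by (intro closed_UN) auto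
  define R where "R = {q\<in>P. \<exists>p\<in>P. x \<in> gball p \<and> (p, q) \<in> link\<^sup>*}"
  have "Z - cluster x = (\<Union>q\<in>P - R. gball q)"
  proof (intro subset_antisym subsetI)
    fix z assume z: "z \<in> Z - cluster x"
    then obtain q where q: "q \<in> P" "z \<in> gball q" using P_near by (auto simp: gball_def)
    then have "q \<notin> R" using z by (auto simp: R_def cluster_def)
    then show "z \<in> (\<Union>q\<in>P - R. gball q)" using q by blast
  next
    fix z assume "z \<in> (\<Union>q\<in>P - R. gball q)"
    then obtain q where q: "q \<in> P" "q \<notin> R" "z \<in> gball q" by blast
    have "z \<notin> cluster x"
    proof
      assume "z \<in> cluster x"
      then obtain p r where pr: "p \<in> P" "x \<in> gball p" "(p, r) \<in> link\<^sup>*" "z \<in> gball r"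
        by (auto simp: cluster_def)
      have "r \<in> P" using pr(3,1) by (induction rule: rtrancl_induct) (auto simp: link_def)
      then have "(r, q) \<in> link" using q pr by (auto simp: link_def)
      then have "(p, q) \<in> link\<^sup>*" using pr(3) by auto
      then show False using q pr by (auto simp: R_def)
    qed
    moreover have "z \<in> Z" using q(3) joined_mem by (auto simp: gball_def)
    ultimately show "z \<in> Z - cluster x" by blast
  qed
  then show "closed (Z - cluster x)" using P(1) cb by (auto intro: closed_UN)
qed

lemma self_cluster: "x \<in> Z \<Longrightarrow> x \<in> cluster x"
  using P_near[of x] by (auto simp: cluster_def gball_def)

lemma connected_cluster:
  assumes "connected S" "S \<subseteq> Z" "x \<in> S"
  shows "S \<subseteq> cluster x"
proof -
  have "cluster x \<inter> S = {} \<or> (Z - cluster x) \<inter> S = {}"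
    using assms(1,2) cluster_closed[of x] by (intro connected_closedD) auto
  moreover have "x \<in> cluster x" using self_cluster assms by auto
  ultimately show ?thesis using assms by blast
qed

lemma joined_imp_cluster:
  assumes "joined n Z x y M"
  shows "y \<in> cluster x"
proof -
  obtain S where "connected S" "S \<subseteq> Z" "x \<in> S" "y \<in> S"
    using joined_connected[of Z n x y M] assms Z0 by blast
  then show ?thesis using connected_cluster by blast
qed

text \<open>A path of any length can be exchanged for one of length \<open>D\<close>; this makes
  being joined by \<open>D\<close> a transitive relation.\<close>

lemma joined_D: "joined n Z x y M \<Longrightarrow> joined n Z x y D"
  using joined_imp_cluster cluster_joined by blast

lemma cluster_neighbourhood:
  assumes "x \<in> Z"
  shows "\<exists>V. open V \<and> x \<in> V \<and> (\<forall>y\<in>V \<inter> Z. joined n Z x y D)"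
proof -
  have "open (- (Z - cluster x))" using cluster_closed by blast
  moreover have "x \<in> - (Z - cluster x)" using self_cluster assms by auto
  ultimately show ?thesis using cluster_joined by (intro exI[of _ "- (Z - cluster x)"]) auto
qed

end

text \<open>The union need not be compact, so it is compared with the relation of being joined by a
  path of the stated length in some \<open>A j\<close>, transitive by \<open>net.joined_D\<close>.
  Its classes are open because the union agrees locally with one \<open>A j\<close>; so a connected
  set lies in a single class.\<close>

lemma exhaustion_joined:
  fixes A :: "nat \<Rightarrow> (nat \<Rightarrow> real) set"
  assumes comp: "\<And>j. compact (A j)" and A0: "\<And>j x i. x \<in> A j \<Longrightarrow> i \<ge> n \<Longrightarrow> x i = 0"
    and inc: "\<And>j. A j \<subseteq> A (Suc j)" and L: "L \<ge> 0"
    and near: "\<And>j. \<exists>P. finite P \<and> card P \<le> N \<and> (\<forall>x\<in>A j. \<exists>p\<in>P. joined n (A j) x p L)"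
    and local: "\<And>x. x \<in> (\<Union>j. A j) \<Longrightarrow> \<exists>j U. open U \<and> x \<in> U \<and> U \<inter> (\<Union>j. A j) \<subseteq> A j"
    and S: "connected S" "S \<subseteq> (\<Union>j. A j)" "x \<in> S" "y \<in> S"
  shows "joined n (\<Union>j. A j) x y (2 * L * (real N ^ 2 + 1))"
proof -
  define D where "D = 2 * L * (real N ^ 2 + 1)"
  define P where "P j = (SOME P. finite P \<and> card P \<le> N \<and> (\<forall>x\<in>A j. \<exists>p\<in>P. joined n (A j) x p L))" for j
  have P: "finite (P j)" "card (P j) \<le> N" "\<forall>x\<in>A j. \<exists>p\<in>P j. joined n (A j) x p L" for j
    using someI_ex[OF near[of j]] unfolding P_def by simp_all
  have net: "net n (A j) (P j) N L" for j
  proof (rule net.intro)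
    show "finite (P j)" "card (P j) \<le> N" using P by simp_all
    show "\<exists>p\<in>P j. joined n (A j) x p L" if "x \<in> A j" for x using P that by simp
    show "compact (A j)" by (rule comp)
    show "L \<ge> 0" by (rule L)
    show "x i = 0" if "x \<in> A j" "n \<le> i" for x i using that by (rule A0)
  qed
  have mono: "A i \<subseteq> A j" if "i \<le> j" for i j
    using lift_Suc_mono_le[of A, OF inc that] .
  define rel where "rel x y \<longleftrightarrow> (\<exists>j. joined n (A j) x y D)" for x y
  have rel_trans: "rel x z" if xy: "rel x y" "rel y z" for x y z
  proof -
    obtain i j where ij: "joined n (A i) x y D" "joined n (A j) y z D" using xy by (auto simp: rel_def)
    have "joined n (A (max i j)) x y D" "joined n (A (max i j)) y z D"
      using joined_subset[OF ij(1) mono] joined_subset[OF ij(2) mono] by auto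
    then have "joined n (A (max i j)) x z (D + D)" by (rule joined_trans)
    then show ?thesis using net.joined_D[OF net] unfolding rel_def D_def by blast
  qed
  have rel_sym: "rel x y \<Longrightarrow> rel y x" for x y using joined_sym unfolding rel_def by blast
  have nbhd: "\<exists>V. open V \<and> y \<in> V \<and> (\<forall>z\<in>V \<inter> (\<Union>j. A j). rel y z)" if y: "y \<in> (\<Union>j. A j)" for y
  proof -
    obtain j U where U: "open U" "y \<in> U" "U \<inter> (\<Union>j. A j) \<subseteq> A j" using local[OF y] by blast
    then have "y \<in> A j" using y by blast
    then obtain V where V: "open V" "y \<in> V" "\<forall>z\<in>V \<inter> A j. joined n (A j) y z D"
      using net.cluster_neighbourhood[OF net] unfolding D_def by blast
    have "rel y z" if "z \<in> (U \<inter> V) \<inter> (\<Union>j. A j)" for z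
      using that U(3) V(3) unfolding rel_def by blast
    then show ?thesis using U V by (intro exI[of _ "U \<inter> V"]) (simp add: open_Int)
  qed
  define V where "V y = (SOME V. open V \<and> y \<in> V \<and> (\<forall>z\<in>V \<inter> (\<Union>j. A j). rel y z))" for y
  have V: "open (V y)" "y \<in> V y" "\<forall>z\<in>V y \<inter> (\<Union>j. A j). rel y z" if "y \<in> (\<Union>j. A j)" for y
    using someI_ex[OF nbhd[OF that]] unfolding V_def by simp_all
  define M where "M = (\<Union>j. A j)"
  have V1: "open (V y)" "y \<in> V y" "\<And>z. z \<in> V y \<Longrightarrow> z \<in> M \<Longrightarrow> rel y z" if "y \<in> M" for y
    using V[of y] that unfolding M_def by blast+
  have SM: "S \<subseteq> M" using S(2) by (simp add: M_def)
  define G where "G = (\<Union>z\<in>{z\<in>M. rel x z}. V z)"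
  define H where "H = (\<Union>z\<in>{z\<in>M. \<not> rel x z}. V z)"
  have op: "open G" "open H" using V1(1) unfolding G_def H_def by (auto intro!: open_UN)
  have cov: "S \<subseteq> G \<union> H"
  proof
    fix s assume "s \<in> S"
    then have "s \<in> M" "s \<in> V s" using SM V1(2) by auto
    then show "s \<in> G \<union> H" unfolding G_def H_def by blast
  qed
  have disj: "G \<inter> H \<inter> S = {}"
  proof (rule ccontr)
    assume "G \<inter> H \<inter> S \<noteq> {}"
    then obtain s z z' where s: "s \<in> S" "z \<in> M" "rel x z" "s \<in> V z" "z' \<in> M" "\<not> rel x z'" "s \<in> V z'"
      unfolding G_def H_def by blast
    then have "rel z s" "rel z' s" using V1(3) SM by auto
    then have "rel x z'" using s(3) rel_trans rel_sym by meson
    then show False using s by blast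
  qed
  have GH: "G \<inter> S = {} \<or> H \<inter> S = {}" by (rule connectedD[OF S(1) op disj cov])
  have xM: "x \<in> M" using S SM by blast
  have xG: "x \<in> G"
    using V1[OF xM] xM unfolding G_def by blast
  have yM: "y \<in> M" and "y \<notin> H" using GH xG S SM by blast+
  then have "rel x y" using V1(2)[OF yM] unfolding H_def by blast
  then obtain j where "joined n (A j) x y D" by (auto simp: rel_def)
  then show ?thesis unfolding D_def by (rule joined_subset) auto
qed

text \<open>Finitely many points lie in a common \<open>A j\<close>, and among more than
  \<open>N\<close> of them two are joined to the same point of its net.\<close>

lemma exhaustion_count:
  fixes A :: "nat \<Rightarrow> (nat \<Rightarrow> real) set"
  assumes A0: "\<And>j x i. x \<in> A j \<Longrightarrow> i \<ge> n \<Longrightarrow> x i = 0" and inc: "\<And>j. A j \<subseteq> A (Suc j)"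
    and near: "\<And>j. \<exists>P. finite P \<and> card P \<le> N \<and> (\<forall>x\<in>A j. \<exists>p\<in>P. joined n (A j) x p L)"
    and X: "finite X" "X \<subseteq> (\<Union>j. A j)" "card X > N"
  shows "\<exists>x\<in>X. \<exists>y\<in>X. x \<noteq> y \<and> (\<exists>S. connected S \<and> S \<subseteq> (\<Union>j. A j) \<and> x \<in> S \<and> y \<in> S)"
proof -
  have mono: "A i \<subseteq> A j" if "i \<le> j" for i j
    using lift_Suc_mono_le[of A, OF inc that] .
  define J where "J x = (SOME j. x \<in> A j)" for x
  have J: "x \<in> A (J x)" if "x \<in> X" for x
    using that X(2) unfolding J_def by (intro someI_ex[of "\<lambda>j. x \<in> A j"]) blast
  define j where "j = Max (J ` X)"
  have Xj: "x \<in> A j" if "x \<in> X" for x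
    using J mono[of "J x" j] X(1) that by (auto simp: j_def)
  obtain P where P: "finite P" "card P \<le> N" "\<forall>x\<in>A j. \<exists>p\<in>P. joined n (A j) x p L" using near by blast
  have "\<forall>x\<in>X. \<exists>p. p \<in> P \<and> joined n (A j) x p L"
  proof
    fix x assume "x \<in> X"
    then show "\<exists>p. p \<in> P \<and> joined n (A j) x p L" using Xj P(3) by blast
  qed
  then have "\<exists>p. \<forall>x\<in>X. p x \<in> P \<and> joined n (A j) x (p x) L" by (rule bchoice)
  then obtain p where p': "\<forall>x\<in>X. p x \<in> P \<and> joined n (A j) x (p x) L" by (rule exE)
  have p: "p x \<in> P" "joined n (A j) x (p x) L" if "x \<in> X" for x using p' that by auto
  have "\<not> inj_on p X"
  proof
    assume "inj_on p X"
    then have "card X \<le> card P" using p P(1) by (intro card_inj_on_le[of p]) auto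
    then show False using X(3) P(2) by simp
  qed
  then obtain x y where xy: "x \<in> X" "y \<in> X" "x \<noteq> y" "p x = p y" by (auto simp: inj_on_def)
  have "joined n (A j) x (p x) L" "joined n (A j) (p x) y L"
    using p(2)[OF xy(1)] joined_sym[OF p(2)[OF xy(2)]] xy(4) by auto
  then have xyj: "joined n (A j) x y (L + L)" by (rule joined_trans)
  have "\<exists>S. connected S \<and> S \<subseteq> A j \<and> x \<in> S \<and> y \<in> S"
    by (rule joined_connected[OF _ xyj]) (rule A0)
  then obtain S where "connected S" "S \<subseteq> A j" "x \<in> S" "y \<in> S" by (elim exE conjE)
  then have "\<exists>S. connected S \<and> S \<subseteq> (\<Union>j. A j) \<and> x \<in> S \<and> y \<in> S"
    by (intro exI[of _ S]) auto
  then show ?thesis using xy(1-3) by (intro bexI[of _ x] bexI[of _ y] conjI)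
qed

section \<open>Slack variables\<close>

definition path_bound :: "nat \<Rightarrow> nat \<Rightarrow> real" where
  "path_bound m d = 64 * (real m)\<^sup>2 * real (dep_bound (2 * m) (2 * d + 1) 2) + 2"

text \<open>The neighbourhoods |h_l| \<le> 1 / (j + 1) inside the box of radius 5 m are compact and
  decreasing with bounds independent of j, so \<open>joined_limit\<close> applies. The paths may
  leave the unit box.\<close>

lemma paths_in_variety:
  assumes m: "0 < m" and h: "\<And>l. l < d \<Longrightarrow> bd m m 2 0 (h l)"
  shows "\<exists>P. finite P \<and> card P \<le> dep_bound m d 2 \<and>
    (\<forall>x\<in>{x. (\<forall>i\<ge>m. x i = 0) \<and> (\<forall>i<m. \<bar>x i\<bar> \<le> 1) \<and> (\<forall>l<d. h l x = 0)}.
      \<exists>p\<in>P. joined m {y. (\<forall>i\<ge>m. y i = 0) \<and> (\<forall>l<d. h l y = 0)} x p (path_bound m d))"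
proof -
  let ?Z = "{x. (\<forall>i\<ge>m. x i = 0) \<and> (\<forall>i<m. \<bar>x i\<bar> \<le> 1) \<and> (\<forall>l<d. h l x = 0)}"
  define K where "K j = {y. (\<forall>i\<ge>m. y i = 0) \<and> (\<forall>i<m. \<bar>y i\<bar> \<le> 5 * real m) \<and>
    (\<forall>l<d. \<bar>h l y\<bar> \<le> 1 / real (Suc j))}" for j
  have comp: "compact (K j)" for j
  proof -
    have K: "K j = {y. (\<forall>i<m. \<bar>y i\<bar> \<le> 5 * real m) \<and> (\<forall>i\<ge>m. y i = 0)} \<inter>
      (\<Inter>l\<in>{..<d}. {y. \<bar>h l y\<bar> \<le> 1 / real (Suc j)})"
      by (auto simp: K_def)
    have "closed {y. \<bar>h l y\<bar> \<le> 1 / real (Suc j)}" if "l < d" for l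
    proof -
      have "continuous_on UNIV (h l)" using bd_imp_polyfun[OF h[OF that]] continuous_on_polyfun by blast
      then show ?thesis by (intro closed_Collect_le continuous_intros)
    qed
    then show ?thesis unfolding K by (intro compact_Int_closed compact_box closed_INT) auto
  qed
  have dec: "K (Suc j) \<subseteq> K j" for j
  proof
    fix y assume y: "y \<in> K (Suc j)"
    have "1 / real (Suc (Suc j)) \<le> 1 / real (Suc j)" by (simp add: frac_le)
    then have "\<bar>h l y\<bar> \<le> 1 / real (Suc j)" if "l < d" for l
      using y that unfolding K_def by (smt (verit) mem_Collect_eq)
    then show "y \<in> K j" using y by (simp add: K_def)
  qed
  have near: "\<exists>P. finite P \<and> card P \<le> dep_bound m d 2 \<and> (\<forall>x\<in>?Z. \<exists>p\<in>P. joined m (K j) x p (path_bound m d))" for j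
  proof -
    have "1 / real (Suc j) > 0" by simp
    then have "\<exists>P. finite P \<and> card P \<le> dep_bound m d 2 \<and>
      (\<forall>x. (\<forall>i\<ge>m. x i = 0) \<longrightarrow> (\<forall>i<m. \<bar>x i\<bar> \<le> 1) \<longrightarrow> (\<forall>l<d. h l x = 0) \<longrightarrow>
        (\<exists>p\<in>P. joined m (K j) x p (path_bound m d)))"
      unfolding K_def path_bound_def using m h by (intro paths_near_variety)
    then obtain P where P: "finite P" "card P \<le> dep_bound m d 2"
      "\<forall>x. (\<forall>i\<ge>m. x i = 0) \<longrightarrow> (\<forall>i<m. \<bar>x i\<bar> \<le> 1) \<longrightarrow> (\<forall>l<d. h l x = 0) \<longrightarrow>
        (\<exists>p\<in>P. joined m (K j) x p (path_bound m d))"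
      by (elim exE conjE)
    then show ?thesis by (intro exI[of _ P]) simp
  qed
  have "path_bound m d \<ge> 0" by (simp add: path_bound_def)
  from joined_limit[where K = K, OF comp compact_imp_closed[OF comp] dec this near]
  obtain P where P: "finite P" "card P \<le> dep_bound m d 2"
    "\<forall>x\<in>?Z. \<exists>p\<in>P. joined m (\<Inter>j. K j) x p (path_bound m d)"
    by (elim exE conjE)
  have sub: "(\<Inter>j. K j) \<subseteq> {y. (\<forall>i\<ge>m. y i = 0) \<and> (\<forall>l<d. h l y = 0)}"
  proof
    fix y assume y: "y \<in> (\<Inter>j. K j)"
    have "h l y = 0" if "l < d" for l
    proof (rule ccontr)
      assume "h l y \<noteq> 0"
      then obtain j where "1 / real (Suc j) < \<bar>h l y\<bar>"
        using nat_approx_posE[of "\<bar>h l y\<bar>"] by auto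
      moreover have "\<bar>h l y\<bar> \<le> 1 / real (Suc j)" using y that by (auto simp: K_def)
      ultimately show False by simp
    qed
    then show "y \<in> {y. (\<forall>i\<ge>m. y i = 0) \<and> (\<forall>l<d. h l y = 0)}" using y by (auto simp: K_def)
  qed
  show ?thesis
  proof (intro exI[of _ P] conjI ballI P(1,2))
    fix x assume x: "x \<in> ?Z"
    from bspec[OF P(3) x] obtain p where p: "p \<in> P" "joined m (\<Inter>j. K j) x p (path_bound m d)"
      by (elim bexE)
    show "\<exists>p\<in>P. joined m {y. (\<forall>i\<ge>m. y i = 0) \<and> (\<forall>l<d. h l y = 0)} x p (path_bound m d)"
      by (rule bexI[of _ p]) (rule joined_subset[OF p(2) sub], rule p(1))
  qed
qed

lemma joined_map:
  assumes j: "joined m S x y L" and f: "\<And>z. z \<in> S \<Longrightarrow> f z \<in> T" "\<And>z w. nd n (f z) (f w) \<le> nd m z w"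
  shows "joined n T (f x) (f y) L"
proof -
  obtain g where g: "0 \<le> L" "g 0 = x" "g L = y" "\<forall>t\<in>{0..L}. g t \<in> S"
    "\<forall>s\<in>{0..L}. \<forall>t\<in>{0..L}. nd m (g s) (g t) \<le> \<bar>s - t\<bar>"
    using j unfolding joined_def by blast
  have "nd n (f (g s)) (f (g t)) \<le> \<bar>s - t\<bar>" if "s \<in> {0..L}" "t \<in> {0..L}" for s t
    using f(2)[of "g s" "g t"] g(5) that by force
  then show ?thesis unfolding joined_def using g f(1) by (intro conjI exI[of _ "\<lambda>t. f (g t)"]) auto
qed

text \<open>
  Slack variables \<open>s\<^sub>i\<close> turn \<open>q\<^sub>i \<ge> 0\<close> into \<open>q\<^sub>i = \<sigma>\<^sub>i s\<^sub>i\<^sup>2\<close>; the weight \<open>\<sigma>\<^sub>i\<close>, a bound for \<open>q\<^sub>i\<close> on the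
  ball, keeps \<open>s\<^sub>i\<close> in the unit interval. The projection forgetting the slack variables does not
  increase lengths.
\<close>

lemma paths_semialgebraic:
  fixes q :: "nat \<Rightarrow> (nat \<Rightarrow> real) \<Rightarrow> real" and l :: nat
  assumes q: "\<And>i. i < k \<Longrightarrow> bd n n 2 0 (q i)"
  defines "A \<equiv> {x. (\<forall>i\<ge>n. x i = 0) \<and> L2_set x {..<n} \<le> 1 \<and> (\<forall>i<k. if i < l then q i x = 0 else q i x \<ge> 0)}"
  shows "\<exists>P. finite P \<and> card P \<le> dep_bound (n + k + 1) (k + 1) 2 \<and>
    (\<forall>x\<in>A. \<exists>p\<in>P. joined n A x p (path_bound (n + k + 1) (k + 1)))"
proof -
  \<comment> \<open>One slack variable for each of the \<open>k\<close> conditions and one for the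
    ball.\<close>
  define m where "m = n + k + 1"
  have poly: "polyfun n (q i)" if "i < k" for i using bd_imp_polyfun[OF q[OF that]] by simp
  define \<sigma> where "\<sigma> i = (SOME C. C > 0 \<and> (\<forall>x. (\<forall>j<n. \<bar>x j\<bar> \<le> 1) \<longrightarrow> \<bar>q i x\<bar> \<le> C))" for i
  have \<sigma>: "\<sigma> i > 0 \<and> (\<forall>x. (\<forall>j<n. \<bar>x j\<bar> \<le> 1) \<longrightarrow> \<bar>q i x\<bar> \<le> \<sigma> i)" if i: "i < k" for i
  proof -
    obtain C where "C \<ge> 0" "\<forall>x. (\<forall>j<n. \<bar>x j\<bar> \<le> 1) \<longrightarrow> \<bar>q i x\<bar> \<le> C"
      using polyfun_bounded[OF poly[OF i]] by blast
    then have "\<exists>C. C > 0 \<and> (\<forall>x. (\<forall>j<n. \<bar>x j\<bar> \<le> 1) \<longrightarrow> \<bar>q i x\<bar> \<le> C)"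
      by (intro exI[of _ "C + 1"]) (auto intro: add_nonneg_pos order_trans)
    then show ?thesis unfolding \<sigma>_def by (rule someI_ex)
  qed
  \<comment> \<open>The ball becomes an equation as well; this keeps the projected paths in the
    ball, although \<open>paths_in_variety\<close> does not confine paths to the unit box.\<close>
  define h where "h i = (if i < k then if i < l then q i else (\<lambda>z. q i z - \<sigma> i * (z (n + i))\<^sup>2)
    else (\<lambda>z. 1 - (\<Sum>j<n. (z j)\<^sup>2) - (z (n + k))\<^sup>2))" for i
  have bdh: "bd m m 2 0 (h i)" if "i < k + 1" for i
  proof -
    have sq: "bd m m 2 0 (\<lambda>z. (z j)\<^sup>2)" if "j < m" for j
      using bd_power2[OF bd_var_z[OF that, of 1 m 0]] by simp
    have qi: "bd m m 2 0 (q i)" if "i < k" using bd_extend[OF q[OF that]] by (simp add: m_def)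
    show ?thesis
    proof (cases "i < k")
      case True
      then have "n + i < m" by (simp add: m_def)
      then show ?thesis using True by (auto simp: h_def intro!: qi bd_diff bd_cmult sq)
    next
      case False
      have "j < m" if "j < n" for j using that by (simp add: m_def)
      moreover have "n + k < m" by (simp add: m_def)
      ultimately show ?thesis using False by (auto simp: h_def intro!: bd_diff bd_sum sq bd_const)
    qed
  qed
  have m0: "0 < m" by (simp add: m_def)
  define Z where "Z = {y. (\<forall>i\<ge>m. y i = 0) \<and> (\<forall>l<k + 1. h l y = 0)}"
  have "\<exists>P. finite P \<and> card P \<le> dep_bound m (k + 1) 2 \<and>
    (\<forall>x\<in>{x. (\<forall>i\<ge>m. x i = 0) \<and> (\<forall>i<m. \<bar>x i\<bar> \<le> 1) \<and> (\<forall>l<k + 1. h l x = 0)}.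
      \<exists>p\<in>P. joined m Z x p (path_bound m (k + 1)))"
    unfolding Z_def using m0 bdh by (intro paths_in_variety)
  then obtain P where P: "finite P" "card P \<le> dep_bound m (k + 1) 2"
    "\<forall>x\<in>{x. (\<forall>i\<ge>m. x i = 0) \<and> (\<forall>i<m. \<bar>x i\<bar> \<le> 1) \<and> (\<forall>l<k + 1. h l x = 0)}.
      \<exists>p\<in>P. joined m Z x p (path_bound m (k + 1))"
    by (elim exE conjE)
  define pr where "pr z = (\<lambda>i. if i < n then z i else 0)" for z :: "nat \<Rightarrow> real"
  have prq: "q i (pr z) = q i z" if "i < k" for i z
    by (rule polyfun_cong[OF poly[OF that]]) (simp add: pr_def)
  have prA: "pr z \<in> A" if "z \<in> Z" for z
  proof -
    have hz: "h i z = 0" if "i < k + 1" for i using \<open>z \<in> Z\<close> that by (simp add: Z_def)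
    have "(\<Sum>j<n. (pr z j)\<^sup>2) = (\<Sum>j<n. (z j)\<^sup>2)" by (simp add: pr_def)
    also have "\<dots> \<le> 1" using hz[of k] by (simp add: h_def) (smt (verit) zero_le_power2)
    finally have "L2_set (pr z) {..<n} \<le> 1" by (simp add: L2_set_def)
    moreover have "if i < l then q i (pr z) = 0 else q i (pr z) \<ge> 0" if "i < k" for i
    proof (cases "i < l")
      case True
      then show ?thesis using hz[of i] that by (simp add: h_def prq)
    next
      case False
      then have "q i z = \<sigma> i * (z (n + i))\<^sup>2" using hz[of i] that by (simp add: h_def)
      then show ?thesis using False \<sigma>[OF that] by (simp add: prq[OF that])
    qed
    moreover have "\<forall>i\<ge>n. pr z i = 0" by (simp add: pr_def)
    ultimately show ?thesis unfolding A_def by blast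
  qed
  have pr_nd: "nd n (pr z) (pr w) \<le> nd m z w" for z w
  proof -
    have "(\<Sum>i<n. (pr z i - pr w i)\<^sup>2) = (\<Sum>i<n. (z i - w i)\<^sup>2)" by (simp add: pr_def)
    also have "\<dots> \<le> (\<Sum>i<m. (z i - w i)\<^sup>2)" by (intro sum_mono2) (auto simp: m_def)
    finally show ?thesis by (simp add: nd_def L2_set_def)
  qed
  have "\<exists>p\<in>pr ` P. joined n A x p (path_bound m (k + 1))" if x: "x \<in> A" for x
  proof -
    have x0: "\<forall>i\<ge>n. x i = 0" and x1: "L2_set x {..<n} \<le> 1"
      and xq: "\<And>i. i < k \<Longrightarrow> if i < l then q i x = 0 else q i x \<ge> 0" using x by (auto simp: A_def)
    have xi: "\<forall>j<n. \<bar>x j\<bar> \<le> 1" using abs_le_L2_set[of "{..<n}" _ x] x1 by force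
    have xs: "(\<Sum>j<n. (x j)\<^sup>2) \<le> 1" using x1 by (simp add: L2_set_def)
    define z where "z i = (if i < n then x i else if i < n + k then sqrt (q (i - n) x / \<sigma> (i - n))
      else if i = n + k then sqrt (1 - (\<Sum>j<n. (x j)\<^sup>2)) else 0)" for i
    have qz: "q i z = q i x" if "i < k" for i
      by (rule polyfun_cong[OF poly[OF that]]) (simp add: z_def)
    have qs: "0 \<le> q i x / \<sigma> i" "q i x / \<sigma> i \<le> 1" if "i < k" for i
      using xq[OF that] \<sigma>[OF that] xi by (auto simp: field_simps split: if_splits)
    have "z i = 0" if "i \<ge> m" for i using that by (simp add: z_def m_def)
    moreover have "\<bar>z i\<bar> \<le> 1" if im: "i < m" for i
    proof -
      consider "i < n" | "n \<le> i" "i < n + k" | "i = n + k" using im by (force simp: m_def)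
      then show ?thesis
      proof cases
        case 1
        then show ?thesis using xi by (simp add: z_def)
      next
        case 2
        then show ?thesis using qs[of "i - n"] by (simp add: z_def)
      next
        case 3
        then show ?thesis using xs by (simp add: z_def sum_nonneg)
      qed
    qed
    moreover have "h i z = 0" if "i < k + 1" for i
    proof (cases "i < k")
      case True
      then show ?thesis using xq[OF True] \<sigma>[OF True] qs(1)[OF True] qz[OF True] by (simp add: h_def z_def)
    next
      case False
      then show ?thesis using that xs by (simp add: h_def z_def)
    qed
    ultimately obtain p where p: "p \<in> P" "joined m Z z p (path_bound m (k + 1))" using P(3) by blast
    have "joined n A (pr z) (pr p) (path_bound m (k + 1))" using joined_map[OF p(2) prA pr_nd] .
    moreover have "pr z = x" using x0 by (auto simp: pr_def z_def)
    ultimately show ?thesis using p(1) by blast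
  qed
  moreover have "finite (pr ` P)" "card (pr ` P) \<le> dep_bound m (k + 1) 2"
    using P(1,2) card_image_le[of P pr] by auto
  ultimately show ?thesis unfolding m_def by (intro exI[of _ "pr ` P"]) simp
qed

section \<open>Geodesic diameters\<close>

lemma bd_rpoly_eval:
  assumes "quadratic_rpoly n q"
  shows "bd n n 2 0 (rpoly_eval q)"
proof -
  have "bd n n 2 0 (\<lambda>x. \<Prod>i\<in>Poly_Mapping.keys e. x i ^ Poly_Mapping.lookup e i)"
    if e: "e \<in> Poly_Mapping.keys q" for e
  proof -
    have "bd n n (\<Sum>i\<in>Poly_Mapping.keys e. Poly_Mapping.lookup e i * 1)
      (\<Sum>i\<in>Poly_Mapping.keys e. Poly_Mapping.lookup e i * 0)
      (\<lambda>x. \<Prod>i\<in>Poly_Mapping.keys e. x i ^ Poly_Mapping.lookup e i)"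
      using assms e by (intro bd_prod bd_power bd_var_z) (auto simp: quadratic_rpoly_def)
    then show ?thesis using assms e by (auto simp: quadratic_rpoly_def elim: bd_weaken)
  qed
  then have "bd n n 2 0 (\<lambda>x. \<Sum>e\<in>Poly_Mapping.keys q. Poly_Mapping.lookup q e *
      (\<Prod>i\<in>Poly_Mapping.keys e. x i ^ Poly_Mapping.lookup e i))"
    by (intro bd_sum bd_cmult)
  then show ?thesis unfolding rpoly_eval_def[abs_def] .
qed

lemma connectedin_Euclidean_space:
  "connectedin (subtopology (Euclidean_space n) M) S \<longleftrightarrow>
    connected S \<and> S \<subseteq> topspace (Euclidean_space n) \<and> S \<subseteq> M"
  by (auto simp: connectedin_subtopology Euclidean_space_def euclidean_product_topology
      connectedin_iff_connected subtopology_subtopology)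

text \<open>The length of an inscribed polygon is bounded by a sum of parameter differences, which
  telescopes.\<close>

lemma path_length_le:
  assumes D: "D \<ge> 0" and g: "\<And>s t. s \<in> {0..1} \<Longrightarrow> t \<in> {0..1} \<Longrightarrow> nd n (g s) (g t) \<le> D * \<bar>s - t\<bar>"
  shows "path_length n g \<le> ennreal D"
  unfolding path_length_def
proof (rule SUP_least)
  fix ts :: "real list" assume "ts \<in> {ts. sorted ts \<and> set ts \<subseteq> {0..1}}"
  then have ts: "sorted ts" "set ts \<subseteq> {0..1}" by auto
  have mem: "ts ! j \<in> {0..1}" if "j < length ts" for j using ts(2) nth_mem[OF that] by blast
  have "(\<Sum>j<length ts - 1. ennreal (L2_set (\<lambda>i. g (ts ! Suc j) i - g (ts ! j) i) {..<n}))
    \<le> (\<Sum>j<length ts - 1. ennreal (D * ts ! Suc j - D * ts ! j))"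
  proof (rule sum_mono, rule ennreal_leI)
    fix j assume "j \<in> {..<length ts - 1}"
    then have j: "j < length ts" "Suc j < length ts" by auto
    have "ts ! j \<le> ts ! Suc j" using ts(1) j by (intro sorted_nth_mono) auto
    then show "L2_set (\<lambda>i. g (ts ! Suc j) i - g (ts ! j) i) {..<n} \<le> D * ts ! Suc j - D * ts ! j"
      using g[OF mem[OF j(2)] mem[OF j(1)]] by (simp add: nd_def right_diff_distrib)
  qed
  also have "\<dots> = ennreal (\<Sum>j<length ts - 1. D * ts ! Suc j - D * ts ! j)"
  proof (rule sum_ennreal)
    fix j assume "j \<in> {..<length ts - 1}"
    then have "ts ! j \<le> ts ! Suc j" using ts(1) by (intro sorted_nth_mono) auto
    then show "0 \<le> D * ts ! Suc j - D * ts ! j" using D by (simp add: mult_left_mono)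
  qed
  also have "(\<Sum>j<length ts - 1. D * ts ! Suc j - D * ts ! j) = D * ts ! (length ts - 1) - D * ts ! 0"
    by (rule sum_lessThan_telescope)
  also have "ennreal \<dots> \<le> ennreal D"
  proof (cases "ts = []")
    \<comment> \<open>Both indices are 0 for the empty list, so the two unspecified entries
      cancel.\<close>
    case True
    then show ?thesis by simp
  next
    case False
    then have "ts ! (length ts - 1) \<le> 1" "ts ! 0 \<ge> 0" using mem[of "length ts - 1"] mem[of 0] by auto
    then have "D * ts ! (length ts - 1) \<le> D * 1" "0 \<le> D * ts ! 0"
      using D by (intro mult_left_mono mult_nonneg_nonneg; simp)+
    then show ?thesis by (intro ennreal_leI) simp
  qed
  finally show "(\<Sum>j<length ts - 1. ennreal (L2_set (\<lambda>i. g (ts ! Suc j) i - g (ts ! j) i) {..<n})) \<le> ennreal D" .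
qed

text \<open>The given path runs in \<open>M\<close>, but its image is connected and meets the
  component \<open>C\<close>, hence lies in \<open>C\<close>. Run through with speed
  \<open>D\<close>, it is defined on the unit interval.\<close>

lemma joined_imp_geodesic_dist_le:
  assumes M: "M \<subseteq> topspace (Euclidean_space n)" and j: "joined n M x y D"
    and C: "C \<in> connected_components_of (subtopology (Euclidean_space n) M)" "x \<in> C"
  shows "geodesic_dist n C x y \<le> ennreal D"
proof -
  obtain g where g: "0 \<le> D" "g 0 = x" "g D = y" "\<And>t. t \<in> {0..D} \<Longrightarrow> g t \<in> M"
    "\<And>s t. s \<in> {0..D} \<Longrightarrow> t \<in> {0..D} \<Longrightarrow> nd n (g s) (g t) \<le> \<bar>s - t\<bar>"
    using j unfolding joined_def by blast
  define f where "f t = g (D * t)" for t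
  have D1: "D * t \<in> {0..D}" if "t \<in> {0..1}" for t using g(1) that by (auto simp: mult_left_le)
  have fM: "f t \<in> M" if "t \<in> {0..1}" for t unfolding f_def by (rule g(4)[OF D1[OF that]])
  have f: "nd n (f s) (f t) \<le> D * \<bar>s - t\<bar>" if "s \<in> {0..1}" "t \<in> {0..1}" for s t
    using g(5)[OF D1[OF that(1)] D1[OF that(2)]] g(1) by (simp add: f_def abs_mult flip: right_diff_distrib)
  have "continuous_on {0..1} f"
  proof (rule continuous_on_coordinatewise_then_product)
    fix i
    have "D-lipschitz_on {0..1} (\<lambda>t. f t i)"
    proof (rule lipschitz_onI)
      fix s t :: real assume st: "s \<in> {0..1}" "t \<in> {0..1}"
      show "dist (f s i) (f t i) \<le> D * dist s t"
      proof (cases "i < n")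
        case True
        then show ?thesis using abs_le_nd[OF True, of "f s" "f t"] f[OF st] by (simp add: dist_real_def)
      next
        case False
        then have "f s i = 0" "f t i = 0"
          using subsetD[OF M fM[OF st(1)]] subsetD[OF M fM[OF st(2)]] by (auto simp: topspace_Euclidean_space)
        then show ?thesis using g(1) by simp
      qed
    qed (rule g(1))
    then show "continuous_on {0..1} (\<lambda>t. f t i)" by (rule lipschitz_on_continuous_on)
  qed
  then have cont: "continuous_map (subtopology euclideanreal {0..1}) (powertop_real UNIV) f"
    by (simp add: euclidean_product_topology)
  have "connected (f ` {0..1})" using \<open>continuous_on {0..1} f\<close> by (intro connected_continuous_image) auto
  moreover have "f ` {0..1} \<subseteq> M" using fM by blast
  ultimately have "connectedin (subtopology (Euclidean_space n) M) (f ` {0..1})"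
    using M unfolding connectedin_Euclidean_space by blast
  moreover have f0: "f 0 = x" "f 1 = y" using g by (simp_all add: f_def)
  then have "\<not> disjnt C (f ` {0..1})" using C(2) by (force simp: disjnt_iff)
  ultimately have fC: "f ` {0..1} \<subseteq> C" using connected_components_of_maximal[OF C(1)] by blast
  moreover have "f ` {0..1} \<subseteq> {x. \<forall>i\<ge>n. x i = 0}"
    using fM M unfolding topspace_Euclidean_space by blast
  ultimately have "pathin (subtopology (Euclidean_space n) C) f"
    using cont unfolding pathin_def Euclidean_space_def subtopology_subtopology
    by (intro continuous_map_into_subtopology) auto
  then have "geodesic_dist n C x y \<le> path_length n f"
    unfolding geodesic_dist_def using f0 by (intro INF_lower) simp
  also have "\<dots> \<le> ennreal D" by (rule path_length_le[OF g(1) f])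
  finally show ?thesis .
qed

text \<open>Take one point from each of more than \<open>N\<close> components: by
  \<open>count\<close> two of them lie in a connected subset of \<open>M\<close>, so their
  components coincide. Finiteness then turns the infinite sum into a finite one with at most
  \<open>N\<close> terms.\<close>

lemma sum_geodesic_diameters_le:
  assumes M: "M \<subseteq> topspace (Euclidean_space n)" and D: "D \<ge> 0"
    and joined: "\<And>S x y. connected S \<Longrightarrow> S \<subseteq> M \<Longrightarrow> x \<in> S \<Longrightarrow> y \<in> S \<Longrightarrow> joined n M x y D"
    and count: "\<And>X. finite X \<Longrightarrow> X \<subseteq> M \<Longrightarrow> card X > N \<Longrightarrow>
      \<exists>x\<in>X. \<exists>y\<in>X. x \<noteq> y \<and> (\<exists>S. connected S \<and> S \<subseteq> M \<and> x \<in> S \<and> y \<in> S)"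
  shows "sum_geodesic_diameters n M \<le> ennreal (real N * D)"
proof -
  let ?T = "subtopology (Euclidean_space n) M"
  have sub: "connected C \<and> C \<subseteq> M" if "C \<in> connected_components_of ?T" for C
    using connectedin_connected_components_of[OF that] unfolding connectedin_Euclidean_space by blast
  have small: "card F \<le> N" if F: "finite F" "F \<subseteq> connected_components_of ?T" for F
  proof (rule ccontr)
    assume big: "\<not> card F \<le> N"
    define r where "r C = (SOME x. x \<in> C)" for C :: "(nat \<Rightarrow> real) set"
    have r: "r C \<in> C" if "C \<in> F" for C
      using nonempty_connected_components_of F(2) that unfolding r_def by (metis ex_in_conv someI subsetD)
    have overlap: "B = C" if BC: "B \<in> F" "C \<in> F" "z \<in> B" "z \<in> C" for B C z
    proof -
      have "B \<in> connected_components_of ?T" "C \<in> connected_components_of ?T" using BC F by auto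
      then show ?thesis using connected_components_of_overlap BC(3,4) by blast
    qed
    have "inj_on r F" using r overlap by (intro inj_onI) metis
    then have "card (r ` F) > N" using big by (simp add: card_image)
    moreover have "r ` F \<subseteq> M" using r sub F by blast
    ultimately obtain x y S where xy: "x \<in> r ` F" "y \<in> r ` F" "x \<noteq> y" and S: "connected S" "S \<subseteq> M" "x \<in> S" "y \<in> S"
      using count[of "r ` F"] F(1) by blast
    obtain B C where BC: "B \<in> F" "x = r B" "C \<in> F" "y = r C" using xy by blast
    have conS: "connectedin ?T S" using S M unfolding connectedin_Euclidean_space by blast
    have "S \<subseteq> B"
      using F(2) BC(1) r[OF BC(1)] S(3) BC(2)
      by (intro connected_components_of_maximal[OF _ conS]) (auto simp: disjnt_iff)
    then have "y \<in> B" using S by blast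
    then have "B = C" using overlap[OF BC(1,3)] r[OF BC(3)] BC(4) by blast
    then show False using xy BC by simp
  qed
  have fin: "finite (connected_components_of ?T)"
  proof (rule ccontr)
    assume "infinite (connected_components_of ?T)"
    then obtain F where "finite F" "card F = Suc N" "F \<subseteq> connected_components_of ?T"
      using infinite_arbitrarily_large by blast
    then show False using small[of F] by simp
  qed
  have diam: "geodesic_diameter n C \<le> ennreal D" if C: "C \<in> connected_components_of ?T" for C
    unfolding geodesic_diameter_def
  proof (intro SUP_least)
    fix x y assume xy: "x \<in> C" "y \<in> C"
    have "joined n M x y D" using joined[of C x y] sub[OF C] xy by blast
    then show "geodesic_dist n C x y \<le> ennreal D"
      by (rule joined_imp_geodesic_dist_le[OF M _ C xy(1)])
  qed
  have "sum_geodesic_diameters n M = (\<Sum>C\<in>connected_components_of ?T. geodesic_diameter n C)"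
    unfolding sum_geodesic_diameters_def by (rule infsum_finite[OF fin])
  also have "\<dots> \<le> (\<Sum>C\<in>connected_components_of ?T. ennreal D)" by (intro sum_mono diam)
  also have "\<dots> = ennreal (real (card (connected_components_of ?T)) * D)"
    using D by (simp add: ennreal_mult ennreal_of_nat_eq_real_of_nat)
  also have "\<dots> \<le> ennreal (real N * D)"
    using small[OF fin order_refl] D by (intro ennreal_leI mult_right_mono) auto
  finally show ?thesis .
qed

lemma sign_set_Int_unit_cball:
  assumes "l \<le> m" "m \<le> k"
  shows "sign_set n l m k Q \<inter> unit_cball n = {x. (\<forall>i\<ge>n. x i = 0) \<and> L2_set x {..<n} \<le> 1 \<and>
    (\<forall>i<k. (i < l \<longrightarrow> rpoly_eval (Q (Suc i)) x = 0) \<and> (l \<le> i \<and> i < m \<longrightarrow> rpoly_eval (Q (Suc i)) x \<ge> 0) \<and>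
      (m \<le> i \<longrightarrow> rpoly_eval (Q (Suc i)) x > 0))}" (is "_ = ?R")
proof -
  have shift: "(\<forall>i\<in>{a+1..b}. R i) \<longleftrightarrow> (\<forall>i. a \<le> i \<and> i < b \<longrightarrow> R (Suc i))" for a b R
  proof -
    have eq: "{a+1..b} = Suc ` {a..<b}" by (simp add: image_Suc_atLeastLessThan atLeastLessThanSuc_atLeastAtMost)
    show ?thesis unfolding eq by (simp only: ball_simps) auto
  qed
  have shift0: "(\<forall>i\<in>{1..b}. R i) \<longleftrightarrow> (\<forall>i<b. R (Suc i))" for b R using shift[of 0 b R] by simp
  show ?thesis
  proof (rule Set.set_eqI)
    fix x
    have key: "(\<forall>i<l. R0 i) \<and> (\<forall>i. l \<le> i \<and> i < m \<longrightarrow> R1 i) \<and> (\<forall>i. m \<le> i \<and> i < k \<longrightarrow> R2 i) \<longleftrightarrow>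
      (\<forall>i<k. (i < l \<longrightarrow> R0 i) \<and> (l \<le> i \<and> i < m \<longrightarrow> R1 i) \<and> (m \<le> i \<longrightarrow> R2 i))" for R0 R1 R2
      using assms less_le_trans by blast
    show "x \<in> sign_set n l m k Q \<inter> unit_cball n \<longleftrightarrow> x \<in> ?R"
      unfolding sign_set_def unit_cball_def topspace_Euclidean_space shift shift0
      by (simp only: Int_iff mem_Collect_eq key) blast
  qed
qed

text \<open>
  A strict inequality \<open>q > 0\<close> is exhausted by the inequalities \<open>q \<ge> 1 / (j + 1)\<close>, with the same
  bounds for all \<open>j\<close>.
\<close>

lemma sum_geodesic_diameters_sign_set_le:
  assumes lm: "l \<le> m" "m \<le> k" and Q: "\<forall>i\<in>{1..k}. quadratic_rpoly n (Q i)"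
  defines "N \<equiv> dep_bound (n + k + 1) (k + 1) 2" and "L \<equiv> path_bound (n + k + 1) (k + 1)"
  shows "sum_geodesic_diameters n (sign_set n l m k Q \<inter> unit_cball n) \<le>
    ennreal (real N * (2 * L * (real N ^ 2 + 1)))"
proof -
  let ?M = "sign_set n l m k Q \<inter> unit_cball n"
  define q where "q i = rpoly_eval (Q (Suc i))" for i
  have bdq: "bd n n 2 0 (q i)" if "i < k" for i
    unfolding q_def using Q that by (intro bd_rpoly_eval) simp
  have polyq: "polyfun n (q i)" if "i < k" for i using bd_imp_polyfun[OF bdq[OF that]] by simp
  have cont: "continuous_on UNIV (q i)" if "i < k" for i by (rule continuous_on_polyfun[OF polyq[OF that]])
  define p where "p j i = (\<lambda>x. q i x - (if i < m then 0 else 1 / real (Suc j)))" for j i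
  define A where "A j = {x. (\<forall>i\<ge>n. x i = 0) \<and> L2_set x {..<n} \<le> 1 \<and>
    (\<forall>i<k. if i < l then p j i x = 0 else p j i x \<ge> 0)}" for j
  have M_eq: "?M = {x. (\<forall>i\<ge>n. x i = 0) \<and> L2_set x {..<n} \<le> 1 \<and>
    (\<forall>i<k. (i < l \<longrightarrow> q i x = 0) \<and> (l \<le> i \<and> i < m \<longrightarrow> q i x \<ge> 0) \<and> (m \<le> i \<longrightarrow> q i x > 0))}"
    unfolding q_def by (rule sign_set_Int_unit_cball[OF lm])
  have near: "\<exists>P. finite P \<and> card P \<le> N \<and> (\<forall>x\<in>A j. \<exists>p\<in>P. joined n (A j) x p L)" for j
  proof -
    have "bd n n 2 0 (p j i)" if "i < k" for i
      unfolding p_def by (intro bd_diff bdq that bd_const)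
    then show ?thesis unfolding A_def N_def L_def by (rule paths_semialgebraic)
  qed
  have A0: "x i = 0" if "x \<in> A j" "n \<le> i" for x i j using that by (simp add: A_def)
  have inc: "A j \<subseteq> A (Suc j)" for j
  proof
    fix x assume x: "x \<in> A j"
    have "1 / real (Suc (Suc j)) \<le> 1 / real (Suc j)" by (simp add: frac_le)
    then have mono: "p j i x \<le> p (Suc j) i x" for i by (simp add: p_def)
    have "if i < l then p (Suc j) i x = 0 else p (Suc j) i x \<ge> 0" if "i < k" for i
    proof (cases "i < l")
      case True
      then have "p j i x = 0" using x that by (simp add: A_def)
      then show ?thesis using True lm by (simp add: p_def)
    next
      case False
      then have "p j i x \<ge> 0" using x that by (simp add: A_def)
      then show ?thesis using False mono[of i] by simp
    qed
    then show "x \<in> A (Suc j)" using x unfolding A_def by blast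
  qed
  have comp: "compact (A j)" for j
  proof -
    have pc: "continuous_on UNIV (p j i)" if "i < k" for i
      unfolding p_def by (intro continuous_intros cont that)
    have A_eq: "A j = {x. (\<forall>i<n. \<bar>x i\<bar> \<le> 1) \<and> (\<forall>i\<ge>n. x i = 0)} \<inter> ({x. L2_set x {..<n} \<le> 1} \<inter>
      (\<Inter>i\<in>{..<k}. if i < l then {x. p j i x = 0} else {x. p j i x \<ge> 0}))"
    proof (rule Set.set_eqI)
      fix x
      have "\<bar>x i\<bar> \<le> 1" if "L2_set x {..<n} \<le> 1" "i < n" for i
        using abs_le_L2_set[of "{..<n}" i x] that by simp
      then show "x \<in> A j \<longleftrightarrow> x \<in> {x. (\<forall>i<n. \<bar>x i\<bar> \<le> 1) \<and> (\<forall>i\<ge>n. x i = 0)} \<inter> ({x. L2_set x {..<n} \<le> 1} \<inter>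
      (\<Inter>i\<in>{..<k}. if i < l then {x. p j i x = 0} else {x. p j i x \<ge> 0}))"
        by (auto simp: A_def split: if_splits)
    qed
    have "closed {x :: nat \<Rightarrow> real. L2_set x {..<n} \<le> 1}"
      unfolding L2_set_def by (intro closed_Collect_le continuous_intros continuous_on_product_coordinates)
    moreover have "closed (if i < l then {x. p j i x = 0} else {x. p j i x \<ge> 0})" if "i < k" for i
      using pc[OF that] by (auto intro!: closed_Collect_eq closed_Collect_le continuous_on_const)
    ultimately show ?thesis unfolding A_eq by (intro compact_Int_closed compact_box closed_Int closed_INT) auto
  qed
  have AM: "A j \<subseteq> ?M" for j
  proof
    fix x assume x: "x \<in> A j"
    have "(i < l \<longrightarrow> q i x = 0) \<and> (l \<le> i \<and> i < m \<longrightarrow> q i x \<ge> 0) \<and> (m \<le> i \<longrightarrow> q i x > 0)" if "i < k" for i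
    proof -
      have px: "if i < l then p j i x = 0 else p j i x \<ge> 0" using x that by (simp add: A_def)
      have "q i x > 0" if "m \<le> i"
      proof -
        have "q i x - 1 / real (Suc j) \<ge> 0" using px that lm by (simp add: p_def)
        moreover have "1 / real (Suc j) > 0" by simp
        ultimately show ?thesis by linarith
      qed
      then show ?thesis using px lm by (auto simp: p_def split: if_splits)
    qed
    then show "x \<in> ?M" using x unfolding M_eq A_def by blast
  qed
  have loc: "\<exists>j U. open U \<and> x \<in> U \<and> U \<inter> ?M \<subseteq> A j" if x: "x \<in> ?M" for x
  proof -
    \<comment> \<open>The 1 is inserted for the case without strict inequalities.\<close>
    have "\<exists>j. 1 / real (Suc j) < Min (insert 1 ((\<lambda>i. q i x) ` {m..<k}))"
    proof -
      have "Min (insert 1 ((\<lambda>i. q i x) ` {m..<k})) > 0" using x unfolding M_eq by auto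
      then show ?thesis using nat_approx_posE by (metis)
    qed
    then obtain j where j: "1 / real (Suc j) < Min (insert 1 ((\<lambda>i. q i x) ` {m..<k}))" by blast
    \<comment> \<open>Near \<open>x\<close> the strict inequalities hold with the margin of
      \<open>A j\<close>; this is the local agreement asked for by
      \<open>exhaustion_joined\<close>.\<close>
    define U where "U = (\<Inter>i\<in>{m..<k}. {y. q i y > 1 / real (Suc j)})"
    have "open U"
      unfolding U_def using cont by (intro open_INT) (auto intro!: open_Collect_less continuous_on_const)
    moreover have "x \<in> U" using j by (auto simp: U_def)
    moreover have "U \<inter> ?M \<subseteq> A j"
    proof
      fix y assume y: "y \<in> U \<inter> ?M"
      have "if i < l then p j i y = 0 else p j i y \<ge> 0" if "i < k" for i
      proof -
        have "(i < l \<longrightarrow> q i y = 0) \<and> (l \<le> i \<and> i < m \<longrightarrow> q i y \<ge> 0)" using y that unfolding M_eq by blast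
        moreover have "m \<le> i \<longrightarrow> q i y > 1 / real (Suc j)" using y that by (auto simp: U_def)
        ultimately show ?thesis using lm by (auto simp: p_def)
      qed
      then show "y \<in> A j" using y unfolding M_eq A_def by blast
    qed
    ultimately show ?thesis by blast
  qed
  have Un: "(\<Union>j. A j) = ?M"
  proof
    show "(\<Union>j. A j) \<subseteq> ?M" using AM by blast
    show "?M \<subseteq> (\<Union>j. A j)"
    proof
      fix x assume x: "x \<in> ?M"
      obtain j U where "x \<in> U" "U \<inter> ?M \<subseteq> A j" using loc[OF x] by blast
      then show "x \<in> (\<Union>j. A j)" using x by blast
    qed
  qed
  have L: "L \<ge> 0" by (simp add: L_def path_bound_def)
  show ?thesis
  proof (rule sum_geodesic_diameters_le)
    show "?M \<subseteq> topspace (Euclidean_space n)" by (auto simp: sign_set_def)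
    show "2 * L * ((real N)\<^sup>2 + 1) \<ge> 0" using L by simp
    show "joined n ?M x y (2 * L * (real N ^ 2 + 1))"
      if "connected S" "S \<subseteq> ?M" "x \<in> S" "y \<in> S" for S x y
    proof -
      have "joined n (\<Union>j. A j) x y (2 * L * (real N ^ 2 + 1))"
      proof (rule exhaustion_joined[of A n L N S x y])
        show "\<exists>j U. open U \<and> x \<in> U \<and> U \<inter> (\<Union>j. A j) \<subseteq> A j" if "x \<in> (\<Union>j. A j)" for x
          using that unfolding Un by (rule loc)
        show "S \<subseteq> (\<Union>j. A j)" using that(2) unfolding Un .
      qed (fact comp A0 inc L near that)+
      then show ?thesis unfolding Un .
    qed
    show "\<exists>x\<in>X. \<exists>y\<in>X. x \<noteq> y \<and> (\<exists>S. connected S \<and> S \<subseteq> ?M \<and> x \<in> S \<and> y \<in> S)"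
      if "finite X" "X \<subseteq> ?M" "card X > N" for X
    proof -
      have "\<exists>x\<in>X. \<exists>y\<in>X. x \<noteq> y \<and> (\<exists>S. connected S \<and> S \<subseteq> (\<Union>j. A j) \<and> x \<in> S \<and> y \<in> S)"
      proof (rule exhaustion_count[of A n N L X])
        show "X \<subseteq> (\<Union>j. A j)" using that(2) unfolding Un .
      qed (fact A0 inc near that)+
      then show ?thesis unfolding Un .
    qed
  qed
qed

section \<open>The bound as a polynomial in the dimension\<close>

lemma dep_bound_poly:
  "\<exists>p :: real poly. Polynomial.degree p \<le> e \<and> (\<forall>n. real (dep_bound (a * n + b) e 2) = poly p (real n))"
proof (intro exI[of _ "Polynomial.smult 3 ([: real (8 * (b + 1) * (e + 1)), real (8 * a * (e + 1)) :] ^ e)"] conjI allI)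
  have "Polynomial.degree ([: real (8 * (b + 1) * (e + 1)), real (8 * a * (e + 1)) :] ^ e) \<le>
      Polynomial.degree [: real (8 * (b + 1) * (e + 1)), real (8 * a * (e + 1)) :] * e"
    by (rule degree_power_le)
  also have "\<dots> \<le> 1 * e" by (intro mult_right_mono) (auto simp: degree_pCons_eq_if)
  finally show "Polynomial.degree (Polynomial.smult 3
      ([: real (8 * (b + 1) * (e + 1)), real (8 * a * (e + 1)) :] ^ e)) \<le> e"
    using degree_smult_le[of 3] order_trans by fastforce
  fix n
  have "2 * 2\<^sup>2 * (a * n + b + 1) * (e + 1) = 8 * (b + 1) * (e + 1) + n * (8 * a * (e + 1))"
    by (simp add: algebra_simps)
  then have "dep_bound (a * n + b) e 2 = 3 * (8 * (b + 1) * (e + 1) + n * (8 * a * (e + 1))) ^ e"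
    unfolding dep_bound_def by presburger
  then show "real (dep_bound (a * n + b) e 2) =
      poly (Polynomial.smult 3 ([: real (8 * (b + 1) * (e + 1)), real (8 * a * (e + 1)) :] ^ e)) (real n)"
    by (simp only: of_nat_mult of_nat_add of_nat_power poly_smult poly_power poly_pCons) simp
qed

theorem theorem15:
  shows "\<exists>C::real. C > 0 \<and> (\<forall>k::nat. k \<ge> 1 \<longrightarrow>
    (\<exists>t :: real poly. real (Polynomial.degree t) \<le> C * real k \<and>
      (\<forall>(n::nat) (l::nat) (m::nat) (Q :: nat \<Rightarrow> rpoly).
         n \<ge> 1 \<longrightarrow> l \<le> m \<longrightarrow> m \<le> k \<longrightarrow> (\<forall>i\<in>{1..k}. quadratic_rpoly n (Q i)) \<longrightarrow>
         enn2ereal (sum_geodesic_diameters n (sign_set n l m k Q \<inter> unit_cball n))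
           \<le> ereal (poly t (real n)))))"
proof (rule exI[of _ 13], intro conjI allI impI)
  fix k :: nat assume k: "k \<ge> 1"
  obtain u :: "real poly" where u: "Polynomial.degree u \<le> k + 1"
    "\<And>n. real (dep_bound (1 * n + (k + 1)) (k + 1) 2) = poly u (real n)"
    using dep_bound_poly[of "k + 1" 1 "k + 1"] by blast
  obtain v :: "real poly" where v: "Polynomial.degree v \<le> 2 * (k + 1) + 1"
    "\<And>n. real (dep_bound (2 * n + 2 * (k + 1)) (2 * (k + 1) + 1) 2) = poly v (real n)"
    using dep_bound_poly[of "2 * (k + 1) + 1" 2 "2 * (k + 1)"] by blast
  define w where "w = Polynomial.smult 64 ([: real (k + 1), 1 :]\<^sup>2 * v) + [:2:]"
  define t where "t = u * (Polynomial.smult 2 w * (u\<^sup>2 + 1))"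
  have "Polynomial.degree ([: real (k + 1), 1 :]\<^sup>2 * v) \<le> 2 + (2 * (k + 1) + 1)"
    using v(1) degree_mult_le[of "[: real (k + 1), 1 :]\<^sup>2" v] degree_power_le[of "[: real (k + 1), 1 :]" 2]
    by (simp add: degree_pCons_eq_if)
  then have dw: "Polynomial.degree w \<le> 2 * k + 5"
    unfolding w_def by (intro degree_add_le degree_smult_le[THEN order_trans]) auto
  have du: "Polynomial.degree (u\<^sup>2 + 1) \<le> 2 * (k + 1)"
    using degree_power_le[of u 2] u(1) by (intro degree_add_le) auto
  have "Polynomial.degree t \<le> Polynomial.degree u + (Polynomial.degree w + Polynomial.degree (u\<^sup>2 + 1))"
    unfolding t_def
    by (meson add_mono degree_mult_le degree_smult_le order_refl order_trans)
  also have "\<dots> \<le> (k + 1) + ((2 * k + 5) + 2 * (k + 1))" by (intro add_mono dw du u(1))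
  \<comment> \<open>The sum is 5 k + 8, at most 13 k because \<open>k\<close> is at least 1.\<close>
  also have "\<dots> \<le> 13 * k" using k by presburger
  finally have "Polynomial.degree t \<le> 13 * k" .
  then have deg: "real (Polynomial.degree t) \<le> 13 * real k" by linarith
  have bound: "enn2ereal (sum_geodesic_diameters n (sign_set n l m k Q \<inter> unit_cball n)) \<le> ereal (poly t (real n))"
    if lm: "l \<le> m" "m \<le> k" and Q: "\<forall>i\<in>{1..k}. quadratic_rpoly n (Q i)" for n l m Q
  proof -
    have N: "real (dep_bound (n + k + 1) (k + 1) 2) = poly u (real n)"
      using u(2)[of n] by (simp add: add.assoc)
    have "2 * (n + k + 1) = 2 * n + 2 * (k + 1)" by simp
    then have L: "path_bound (n + k + 1) (k + 1) = poly w (real n)"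
      using v(2)[of n] unfolding path_bound_def w_def by (simp add: algebra_simps)
    let ?b = "poly u (real n) * (2 * poly w (real n) * ((poly u (real n))\<^sup>2 + 1))"
    have t: "poly t (real n) = ?b" by (simp add: t_def)
    have "sum_geodesic_diameters n (sign_set n l m k Q \<inter> unit_cball n) \<le> ennreal (poly t (real n))"
      using sum_geodesic_diameters_sign_set_le[OF lm Q] unfolding N L t .
    then have "enn2ereal (sum_geodesic_diameters n (sign_set n l m k Q \<inter> unit_cball n)) \<le>
      enn2ereal (ennreal (poly t (real n)))" by (simp add: less_eq_ennreal.rep_eq)
    moreover have "poly t (real n) \<ge> 0"
      unfolding t unfolding N[symmetric] L[symmetric] by (simp add: path_bound_def)
    ultimately show ?thesis by (simp add: enn2ereal_ennreal)
  qed
  show "\<exists>t :: real poly. real (Polynomial.degree t) \<le> 13 * real k \<and>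
      (\<forall>(n::nat) (l::nat) (m::nat) (Q :: nat \<Rightarrow> rpoly).
         n \<ge> 1 \<longrightarrow> l \<le> m \<longrightarrow> m \<le> k \<longrightarrow> (\<forall>i\<in>{1..k}. quadratic_rpoly n (Q i)) \<longrightarrow>
         enn2ereal (sum_geodesic_diameters n (sign_set n l m k Q \<inter> unit_cball n))
           \<le> ereal (poly t (real n)))"
    by (intro exI[of _ t] conjI deg allI impI bound)
qed simp

end
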